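(* Let $k$ be a field, $0\neq q\in k$, and let $m\le n$ be positive integers. Then the quantum grassmannian $\mathcal{G}_q(m,n)$ is a maximal order (in its division ring of fractions).
   Context: $\mathcal{O}_q(M_{mn})$ is the (unital associative) $k$-algebra generated by $X_{ij}$, $1\le i\le m$, $1\le j\le n$, subject to the relations, for $1\le i<k\le m$ and $1\le j<l\le n$: $X_{ij}X_{il}=qX_{il}X_{ij}$, $X_{ij}X_{kj}=qX_{kj}X_{ij}$, $X_{il}X_{kj}=X_{kj}X_{il}$, $X_{ij}X_{kl}-X_{kl}X_{ij}=(q-q^{-1})X_{il}X_{kj}$. For an $m$-element subset $J=\{j_1<\dots<j_m\}\subseteq\{1,\dots,n\}$ the maximal quantum minor is $[J]=\sum_{\sigma\in S_m}(-q)^{\ell(\sigma)}X_{1 j_{\sigma(1)}}\cdots X_{m j_{\sigma(m)}}$, where $\ell(\sigma)$ is the length of $\sigma$. The quantum grassmannian $\mathcal{G}_q(m,n)$ is the $k$-subalgebra of $\mathcal{O}_q(M_{mn})$ generated by all the $[J]$; it is a noetherian domain, so it has a division ring of fractions. A noetherian domain $R$ with division ring of fractions $Q$ is a maximal order in $Q$ if: whenever $T$ is a ring with $R\subseteq T\subseteq Q$ and there exist nonzero $a,b\in R$ with $aTb\subseteq R$, then $T=R$. *)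

theory Defs
  imports
    "HOL-Library.Poly_Mapping"
    "HOL-Combinatorics.Permutations"
    "HOL-Algebra.QuotRing"
    "HOL-Algebra.Generated_Rings"
begin

section \<open>Free algebras\<close>

text \<open>
  The free monoid is written additively so that the convolution product of
  \<^theory>\<open>HOL-Library.Poly_Mapping\<close> is the (noncommutative) product of the free algebra.
  \<^type>\<open>list\<close> itself is not made an instance, to leave its class instances untouched.
\<close>

datatype 'i free_monoid = Word (letters: "'i list")

instantiation free_monoid :: (type) monoid_add
begin

definition "0 = Word []"
definition "u + v = Word (letters u @ letters v)"

instance
  by standard (simp_all add: zero_free_monoid_def plus_free_monoid_def)

end

definition scal :: "'k::ring_1 \<Rightarrow> ('i free_monoid \<Rightarrow>\<^sub>0 'k)"
  where "scal c = Poly_Mapping.single 0 c"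

definition var :: "'i \<Rightarrow> ('i free_monoid \<Rightarrow>\<^sub>0 'k::ring_1)"
  where "var i = Poly_Mapping.single (Word [i]) 1"

text \<open>The free unital associative algebra on the set \<open>I\<close> of generators.\<close>

definition free_algebra :: "'i set \<Rightarrow> ('i free_monoid \<Rightarrow>\<^sub>0 'k::ring_1) ring"
  where "free_algebra I =
    \<lparr>carrier = {p. \<forall>w \<in> Poly_Mapping.keys p. set (letters w) \<subseteq> I},
     mult = (*), one = 1, zero = 0, add = (+)\<rparr>"

lemma ring_free_algebra: "ring (free_algebra I :: ('i free_monoid \<Rightarrow>\<^sub>0 'k::ring_1) ring)"
proof (rule ringI)
  let ?F = "free_algebra I :: ('i free_monoid \<Rightarrow>\<^sub>0 'k) ring"
  show "abelian_group ?F"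
  proof (rule abelian_groupI)
    fix x y assume "x \<in> carrier ?F" "y \<in> carrier ?F"
    then show "x \<oplus>\<^bsub>?F\<^esub> y \<in> carrier ?F"
      using keys_add[of x y] by (auto simp: free_algebra_def)
  next
    fix x assume x: "x \<in> carrier ?F"
    show "\<exists>y\<in>carrier ?F. y \<oplus>\<^bsub>?F\<^esub> x = \<zero>\<^bsub>?F\<^esub>"
      using x by (intro bexI[of _ "- x"]) (auto simp: free_algebra_def keys_minus)
  qed (auto simp: free_algebra_def algebra_simps)
  show "monoid ?F"
  proof (rule monoidI)
    fix x y assume "x \<in> carrier ?F" "y \<in> carrier ?F"
    then show "x \<otimes>\<^bsub>?F\<^esub> y \<in> carrier ?F"
      using keys_mult[of x y] by (fastforce simp: free_algebra_def plus_free_monoid_def)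
  qed (auto simp: free_algebra_def mult.assoc zero_free_monoid_def)
qed (auto simp: free_algebra_def algebra_simps)

lemma scal_in_carrier: "scal c \<in> carrier (free_algebra I)"
  by (auto simp: scal_def free_algebra_def zero_free_monoid_def)

lemma var_in_carrier: "i \<in> I \<Longrightarrow> var i \<in> carrier (free_algebra I)"
  by (auto simp: var_def free_algebra_def)

lemma mult_in_carrier:
  "\<lbrakk>x \<in> carrier (free_algebra I); y \<in> carrier (free_algebra I)\<rbrakk> \<Longrightarrow> x * y \<in> carrier (free_algebra I)"
  using keys_mult[of x y] by (fastforce simp: free_algebra_def plus_free_monoid_def)

lemma minus_in_carrier:
  fixes x y :: "'i free_monoid \<Rightarrow>\<^sub>0 'k::ring_1"
  shows "\<lbrakk>x \<in> carrier (free_algebra I); y \<in> carrier (free_algebra I)\<rbrakk> \<Longrightarrow> x - y \<in> carrier (free_algebra I)"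
  using keys_diff[of x y] by (fastforce simp: free_algebra_def)

section \<open>Quantum matrices and the quantum grassmannian\<close>

text \<open>
  \<open>qX i j\<close> is the free generator indexed by \<open>(i, j)\<close>.  In \<open>qmat_rels\<close>, each relation is imposed for
  all rows and columns that occur in it; in particular the relations within a single row
  (resp. column) hold for every row \<open>i \<le> m\<close> (resp. column \<open>j \<le> n\<close>), including the last one.
\<close>

abbreviation qX :: "nat \<Rightarrow> nat \<Rightarrow> ((nat \<times> nat) free_monoid \<Rightarrow>\<^sub>0 'k::field)"
  where "qX i j \<equiv> var (i, j)"

definition qmat_rels :: "'k::field \<Rightarrow> nat \<Rightarrow> nat \<Rightarrow> ((nat \<times> nat) free_monoid \<Rightarrow>\<^sub>0 'k) set"
  where "qmat_rels q m n =
    {qX i j * qX i l - scal q * qX i l * qX i j | i j l.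
        1 \<le> i \<and> i \<le> m \<and> 1 \<le> j \<and> j < l \<and> l \<le> n} \<union>
    {qX i j * qX k j - scal q * qX k j * qX i j | i k j.
        1 \<le> i \<and> i < k \<and> k \<le> m \<and> 1 \<le> j \<and> j \<le> n} \<union>
    {qX i l * qX k j - qX k j * qX i l | i k j l.
        1 \<le> i \<and> i < k \<and> k \<le> m \<and> 1 \<le> j \<and> j < l \<and> l \<le> n} \<union>
    {qX i j * qX k l - qX k l * qX i j - scal (q - inverse q) * qX i l * qX k j | i k j l.
        1 \<le> i \<and> i < k \<and> k \<le> m \<and> 1 \<le> j \<and> j < l \<and> l \<le> n}"

abbreviation qmat_free :: "nat \<Rightarrow> nat \<Rightarrow> ((nat \<times> nat) free_monoid \<Rightarrow>\<^sub>0 'k::field) ring"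
  where "qmat_free m n \<equiv> free_algebra ({1..m} \<times> {1..n})"

definition qmat_ideal :: "'k::field \<Rightarrow> nat \<Rightarrow> nat \<Rightarrow> ((nat \<times> nat) free_monoid \<Rightarrow>\<^sub>0 'k) set"
  where "qmat_ideal q m n = Idl\<^bsub>qmat_free m n\<^esub> (qmat_rels q m n)"

lemma qmat_rels_subset_carrier: "qmat_rels q m n \<subseteq> carrier (qmat_free m n)"
  unfolding qmat_rels_def
  by (auto intro!: minus_in_carrier mult_in_carrier scal_in_carrier var_in_carrier)

lemma ideal_qmat_ideal: "ideal (qmat_ideal q m n) (qmat_free m n)"
  unfolding qmat_ideal_def
  by (rule ring.genideal_ideal[OF ring_free_algebra qmat_rels_subset_carrier])

type_synonym 'k qmat_elt = "((nat \<times> nat) free_monoid \<Rightarrow>\<^sub>0 'k) set"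

definition qmat :: "'k::field \<Rightarrow> nat \<Rightarrow> nat \<Rightarrow> 'k qmat_elt ring"
  where "qmat q m n = qmat_free m n Quot qmat_ideal q m n"

definition qmat_class ::
    "'k::field \<Rightarrow> nat \<Rightarrow> nat \<Rightarrow> ((nat \<times> nat) free_monoid \<Rightarrow>\<^sub>0 'k) \<Rightarrow> 'k qmat_elt"
  where "qmat_class q m n p = qmat_ideal q m n +>\<^bsub>qmat_free m n\<^esub> p"

definition perm_length :: "nat \<Rightarrow> (nat \<Rightarrow> nat) \<Rightarrow> nat"
  where "perm_length m \<sigma> = card {(i, j). 1 \<le> i \<and> i < j \<and> j \<le> m \<and> \<sigma> j < \<sigma> i}"

text \<open>\<open>sorted_list_of_set J ! (r - 1)\<close> is the \<open>r\<close>-th smallest element \<open>j\<^sub>r\<close> of \<open>J\<close>.\<close>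

definition qminor :: "'k::field \<Rightarrow> nat \<Rightarrow> nat \<Rightarrow> nat set \<Rightarrow> 'k qmat_elt"
  where "qminor q m n J = qmat_class q m n
    (\<Sum>\<sigma> | \<sigma> permutes {1..m}. scal ((- q) ^ perm_length m \<sigma>) *
       prod_list (map (\<lambda>i. qX i (sorted_list_of_set J ! (\<sigma> i - 1))) [1..<Suc m]))"

text \<open>
  The \<open>k\<close>-subalgebra generated by the maximal quantum minors, i.e. the subring generated by them
  together with the scalars.
\<close>

definition qgrass_carrier :: "'k::field \<Rightarrow> nat \<Rightarrow> nat \<Rightarrow> 'k qmat_elt set"
  where "qgrass_carrier q m n = generate_ring (qmat q m n)
    (range (\<lambda>c. qmat_class q m n (scal c)) \<union>
     {qminor q m n J | J. J \<subseteq> {1..n} \<and> card J = m})"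

definition qgrass :: "'k::field \<Rightarrow> nat \<Rightarrow> nat \<Rightarrow> 'k qmat_elt ring"
  where "qgrass q m n = (qmat q m n)\<lparr>carrier := qgrass_carrier q m n\<rparr>"

section \<open>Maximal orders\<close>

text \<open>
  HOL-Algebra's notions of domain and field assume commutativity, and its noetherian rings are
  defined by two-sided ideals, so the noncommutative notions are introduced here.
\<close>

definition left_ideal :: "'a set \<Rightarrow> ('a, 'b) ring_scheme \<Rightarrow> bool"
  where "left_ideal I R \<longleftrightarrow>
    additive_subgroup I R \<and> (\<forall>x\<in>carrier R. \<forall>a\<in>I. x \<otimes>\<^bsub>R\<^esub> a \<in> I)"

definition right_ideal :: "'a set \<Rightarrow> ('a, 'b) ring_scheme \<Rightarrow> bool"
  where "right_ideal I R \<longleftrightarrow>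
    additive_subgroup I R \<and> (\<forall>x\<in>carrier R. \<forall>a\<in>I. a \<otimes>\<^bsub>R\<^esub> x \<in> I)"

definition nc_noetherian :: "('a, 'b) ring_scheme \<Rightarrow> bool"
  where "nc_noetherian R \<longleftrightarrow> ring R \<and>
    (\<forall>C :: nat \<Rightarrow> 'a set. (\<forall>i. left_ideal (C i) R) \<and> incseq C \<longrightarrow> (\<exists>N. \<forall>i\<ge>N. C i = C N)) \<and>
    (\<forall>C :: nat \<Rightarrow> 'a set. (\<forall>i. right_ideal (C i) R) \<and> incseq C \<longrightarrow> (\<exists>N. \<forall>i\<ge>N. C i = C N))"

definition nc_domain :: "('a, 'b) ring_scheme \<Rightarrow> bool"
  where "nc_domain R \<longleftrightarrow> ring R \<and> \<one>\<^bsub>R\<^esub> \<noteq> \<zero>\<^bsub>R\<^esub> \<and>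
    (\<forall>a\<in>carrier R. \<forall>b\<in>carrier R. a \<otimes>\<^bsub>R\<^esub> b = \<zero>\<^bsub>R\<^esub> \<longrightarrow> a = \<zero>\<^bsub>R\<^esub> \<or> b = \<zero>\<^bsub>R\<^esub>)"

definition division_ring :: "('a, 'b) ring_scheme \<Rightarrow> bool"
  where "division_ring Q \<longleftrightarrow> ring Q \<and> \<one>\<^bsub>Q\<^esub> \<noteq> \<zero>\<^bsub>Q\<^esub> \<and> Units Q = carrier Q - {\<zero>\<^bsub>Q\<^esub>}"

text \<open>
  \<open>Q\<close>, with the embedding \<open>\<iota>\<close> of \<open>R\<close>, is a division ring of (left and right) fractions of \<open>R\<close>.
\<close>

definition division_ring_of_fractions ::
    "('a, 'b) ring_scheme \<Rightarrow> ('c, 'd) ring_scheme \<Rightarrow> ('a \<Rightarrow> 'c) \<Rightarrow> bool"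
  where "division_ring_of_fractions R Q \<iota> \<longleftrightarrow>
    ring R \<and> division_ring Q \<and> \<iota> \<in> ring_hom R Q \<and> inj_on \<iota> (carrier R) \<and>
    (\<forall>x\<in>carrier Q. \<exists>a\<in>carrier R. \<exists>b\<in>carrier R - {\<zero>\<^bsub>R\<^esub>}. x = \<iota> a \<otimes>\<^bsub>Q\<^esub> inv\<^bsub>Q\<^esub> (\<iota> b)) \<and>
    (\<forall>x\<in>carrier Q. \<exists>a\<in>carrier R. \<exists>b\<in>carrier R - {\<zero>\<^bsub>R\<^esub>}. x = inv\<^bsub>Q\<^esub> (\<iota> b) \<otimes>\<^bsub>Q\<^esub> \<iota> a)"

definition maximal_order ::
    "('a, 'b) ring_scheme \<Rightarrow> ('c, 'd) ring_scheme \<Rightarrow> ('a \<Rightarrow> 'c) \<Rightarrow> bool"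
  where "maximal_order R Q \<iota> \<longleftrightarrow>
    nc_noetherian R \<and> nc_domain R \<and> division_ring_of_fractions R Q \<iota> \<and>
    (\<forall>T. subring T Q \<and> \<iota> ` carrier R \<subseteq> T \<and>
      (\<exists>a\<in>carrier R - {\<zero>\<^bsub>R\<^esub>}. \<exists>b\<in>carrier R - {\<zero>\<^bsub>R\<^esub>}.
         \<forall>t\<in>T. \<iota> a \<otimes>\<^bsub>Q\<^esub> t \<otimes>\<^bsub>Q\<^esub> \<iota> b \<in> \<iota> ` carrier R)
      \<longrightarrow> T = \<iota> ` carrier R)"

end

theory Submission
  imports Defs "HOL-Library.Product_Lexorder" "HOL-Library.Multiset"
begin

text \<open>
  The algebra of quantum matrices embeds into a quantum torus, by inverting Cauchon's deleting
  derivations, in such a way that \<open>X\<^sub>i\<^sub>j\<close> has leading exponent \<open>e\<^sub>i\<^sub>j\<close> for the lexicographic order of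
  exponents.  Hence ordered monomials are linearly independent, and leading exponents are additive on
  products.

  The leading exponents of nonzero elements of the quantum grassmannian are sums of the exponents of
  the diagonal terms of the maximal minors: such sums are described by linear
  inequalities between consecutive rows \<open>i\<close> and \<open>i + 1\<close>, and these follow from the straightening law
  for \<open>2 \<times> 2\<close> minors of these two rows, since by Laplace expansion every maximal minor is a
  combination of products of such minors and of entries of the other rows.

  So the leading exponents form a finitely generated monoid that is completely integrally closed.
  Dickson's lemma then gives chain conditions and the Ore condition, and comparing leading terms gives
  the maximal order property.
\<close>

section \<open>Ore domains and their division rings of fractions\<close>

text \<open>The aim is to find all leading exponents of the grassmannian without a straightening law
  for maximal minors. Read an exponent \<open>a\<close> as a filling in which row \<open>k\<close>
  contains the number \<open>j\<close> exactly \<open>lookup a (k, j)\<close> times. The exponents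
  to be described are then the semistandard tableaux of rectangular shape with \<open>m\<close>
  rows. Strict increase down the columns compares only adjacent rows, so each pair of rows can be
  treated by itself, inside a larger algebra with a simpler straightening law; uniqueness of the
  leading exponent puts the conditions back together. Conversely, every such tableau is the sum of
  its columns, and these are diagonal terms of minors. The presentation by relations alone does not
  tell when an element vanishes; operators with a leading exponent are nonzero, and this decides it.
  Apart from scalars no central elements are used, so roots of unity need no separate
  treatment.\<close>

abbreviation (in ring) nonzero :: "'a set" where "nonzero \<equiv> carrier R - {\<zero>}"

locale ore_domain = ring R for R (structure) +
  assumes one_not_zero: "\<one> \<noteq> \<zero>"
    and integral: "\<lbrakk>a \<in> carrier R; b \<in> carrier R; a \<otimes> b = \<zero>\<rbrakk> \<Longrightarrow> a = \<zero> \<or> b = \<zero>"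
    and right_ore: "\<lbrakk>a \<in> nonzero; b \<in> nonzero\<rbrakk>
      \<Longrightarrow> \<exists>x\<in>nonzero. \<exists>y\<in>nonzero. a \<otimes> x = b \<otimes> y"
    and left_ore: "\<lbrakk>a \<in> nonzero; b \<in> nonzero\<rbrakk>
      \<Longrightarrow> \<exists>x\<in>nonzero. \<exists>y\<in>nonzero. x \<otimes> a = y \<otimes> b"
begin

lemma mult_nonzero: "\<lbrakk>a \<in> nonzero; b \<in> nonzero\<rbrakk> \<Longrightarrow> a \<otimes> b \<in> nonzero"
  using integral by blast

lemma right_cancel:
  assumes "x \<in> carrier R" "y \<in> carrier R" "c \<in> nonzero" "x \<otimes> c = y \<otimes> c"
  shows "x = y"
proof -
  have "(x \<ominus> y) \<otimes> c = \<zero>"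
    using assms by (simp add: a_minus_def l_distr l_minus r_neg)
  then have "x \<ominus> y = \<zero>" using integral[of "x \<ominus> y" c] assms by auto
  then show ?thesis using assms by (simp add: r_right_minus_eq)
qed

lemma right_ore_zero:
  assumes "a \<in> carrier R" "b \<in> nonzero"
  shows "\<exists>x\<in>nonzero. \<exists>y\<in>carrier R. a \<otimes> x = b \<otimes> y"
proof (cases "a = \<zero>")
  case True
  then show ?thesis using assms one_not_zero by (intro bexI[of _ \<one>] bexI[of _ \<zero>]) auto
next
  case False
  then show ?thesis using right_ore[of a b] assms by blast
qed

text \<open>
  A fraction \<open>a b\<^sup>-\<^sup>1\<close> is represented by the graph \<open>{(x, y). y = a b\<^sup>-\<^sup>1 x}\<close> of left multiplication by
  it, which is a right submodule of \<open>R \<times> R\<close>.  Products are then closures of relational compositions,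
  so no well-definedness on equivalence classes of pairs has to be checked.
\<close>

definition partial_hom :: "('a \<times> 'a) set \<Rightarrow> bool"
  where "partial_hom G \<longleftrightarrow> G \<subseteq> carrier R \<times> carrier R \<and>
    (\<forall>x y x' y'. (x, y) \<in> G \<and> (x', y') \<in> G \<longrightarrow> (x \<oplus> x', y \<oplus> y') \<in> G) \<and>
    (\<forall>x y r. (x, y) \<in> G \<and> r \<in> carrier R \<longrightarrow> (x \<otimes> r, y \<otimes> r) \<in> G) \<and>
    (\<forall>y. (\<zero>, y) \<in> G \<longrightarrow> y = \<zero>) \<and> (\<exists>x y. x \<noteq> \<zero> \<and> (x, y) \<in> G)"

text \<open>Saturation: \<open>x\<close> receives the value \<open>y\<close> as soon as some nonzero
  multiple \<open>x \<otimes> c\<close> receives \<open>y \<otimes> c\<close>. Graphs that come from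
  different denominators of one fraction thereby become equal as sets.\<close>

definition cl :: "('a \<times> 'a) set \<Rightarrow> ('a \<times> 'a) set"
  where "cl G = {(x, y). x \<in> carrier R \<and> y \<in> carrier R \<and>
    (\<exists>c\<in>nonzero. (x \<otimes> c, y \<otimes> c) \<in> G)}"

definition fraction :: "('a \<times> 'a) set \<Rightarrow> bool"
  where "fraction G \<longleftrightarrow> partial_hom G \<and> cl G \<subseteq> G"

lemma partial_homD:
  assumes "partial_hom G"
  shows "(x, y) \<in> G \<Longrightarrow> x \<in> carrier R" "(x, y) \<in> G \<Longrightarrow> y \<in> carrier R"
    and "\<lbrakk>(x, y) \<in> G; (x', y') \<in> G\<rbrakk> \<Longrightarrow> (x \<oplus> x', y \<oplus> y') \<in> G"
    and "\<lbrakk>(x, y) \<in> G; r \<in> carrier R\<rbrakk> \<Longrightarrow> (x \<otimes> r, y \<otimes> r) \<in> G"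
    and "(\<zero>, y) \<in> G \<Longrightarrow> y = \<zero>"
    and "\<exists>x y. x \<in> nonzero \<and> y \<in> carrier R \<and> (x, y) \<in> G"
  using assms unfolding partial_hom_def by blast+

lemma partial_hom_single_valued:
  assumes "partial_hom G" "(x, y) \<in> G" "(x, y') \<in> G"
  shows "y = y'"
proof -
  note P = partial_homD[OF assms(1)]
  have c: "x \<in> carrier R" "y \<in> carrier R" "y' \<in> carrier R" using P(1,2) assms by auto
  have "(x \<oplus> x \<otimes> (\<ominus> \<one>), y \<oplus> y' \<otimes> (\<ominus> \<one>)) \<in> G"
    using P(3,4) assms by simp
  then have "(\<zero>, y \<ominus> y') \<in> G"
    using c by (simp add: r_minus r_neg a_minus_def)
  then have "y \<ominus> y' = \<zero>" using P(5) by blast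
  then show ?thesis using c by (simp add: r_right_minus_eq)
qed

lemma fractionD:
  assumes "fraction G"
  shows "partial_hom G"
    and "\<lbrakk>x \<in> carrier R; y \<in> carrier R; c \<in> nonzero; (x \<otimes> c, y \<otimes> c) \<in> G\<rbrakk> \<Longrightarrow> (x, y) \<in> G"
  using assms unfolding fraction_def cl_def by blast+

lemma subset_cl: "partial_hom G \<Longrightarrow> G \<subseteq> cl G"
  using partial_homD(1,2)[of G] one_not_zero by (fastforce simp: cl_def intro!: bexI[of _ \<one>])

lemma cl_memI: "\<lbrakk>partial_hom G; (x, y) \<in> G\<rbrakk> \<Longrightarrow> (x, y) \<in> cl G"
  using subset_cl by blast

text \<open>For sums, a common right multiple of the two witnesses \<open>c\<close>,
  \<open>c'\<close> is again a witness. For scaling by \<open>r\<close>, an equation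
  \<open>r \<otimes> f = c \<otimes> g\<close> moves the witness across \<open>r\<close>.\<close>

lemma fraction_cl:
  assumes G: "partial_hom G"
  shows "fraction (cl G)"
proof -
  note P = partial_homD[OF G]
  have add: "(x \<oplus> x', y \<oplus> y') \<in> cl G" if h: "(x, y) \<in> cl G" "(x', y') \<in> cl G" for x y x' y'
  proof -
    obtain c where c: "c \<in> nonzero" "(x \<otimes> c, y \<otimes> c) \<in> G"
      and xy: "x \<in> carrier R" "y \<in> carrier R"
      using h(1) unfolding cl_def by blast
    obtain c' where c': "c' \<in> nonzero" "(x' \<otimes> c', y' \<otimes> c') \<in> G"
      and xy': "x' \<in> carrier R" "y' \<in> carrier R"
      using h(2) unfolding cl_def by blast
    obtain e e' where e: "e \<in> nonzero" "e' \<in> nonzero" "c \<otimes> e = c' \<otimes> e'"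
      using right_ore c c' by meson
    have ee: "e \<in> carrier R" "e' \<in> carrier R" "c \<in> carrier R" "c' \<in> carrier R" using e c c' by auto
    have "(x \<otimes> c \<otimes> e \<oplus> x' \<otimes> c' \<otimes> e', y \<otimes> c \<otimes> e \<oplus> y' \<otimes> c' \<otimes> e') \<in> G"
      using P(3)[OF P(4)[OF c(2)] P(4)[OF c'(2)], of e e'] ee by blast
    then have "((x \<oplus> x') \<otimes> (c \<otimes> e), (y \<oplus> y') \<otimes> (c \<otimes> e)) \<in> G"
      using xy xy' ee e(3) by (simp add: l_distr m_assoc)
    moreover have "c \<otimes> e \<in> nonzero" using mult_nonzero c e by blast
    ultimately show ?thesis using xy xy' unfolding cl_def by blast
  qed
  have scale: "(x \<otimes> r, y \<otimes> r) \<in> cl G" if h: "(x, y) \<in> cl G" "r \<in> carrier R" for x y r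
  proof -
    obtain c where c: "c \<in> nonzero" "(x \<otimes> c, y \<otimes> c) \<in> G"
      and xy: "x \<in> carrier R" "y \<in> carrier R"
      using h(1) unfolding cl_def by blast
    obtain f g where f: "f \<in> nonzero" "g \<in> carrier R" "r \<otimes> f = c \<otimes> g"
      using right_ore_zero[of r c] c h(2) by blast
    have "(x \<otimes> r \<otimes> f, y \<otimes> r \<otimes> f) = (x \<otimes> c \<otimes> g, y \<otimes> c \<otimes> g)"
      using f c xy h(2) by (simp add: m_assoc)
    also have "\<dots> \<in> G" using P(4)[OF c(2) f(2)] .
    finally show ?thesis using f xy h(2) unfolding cl_def by blast
  qed
  have ph: "partial_hom (cl G)"
    unfolding partial_hom_def
  proof (intro conjI allI impI; (elim conjE)?)
    show "cl G \<subseteq> carrier R \<times> carrier R" unfolding cl_def by blast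
    fix y assume "(\<zero>, y) \<in> cl G"
    then obtain c where "c \<in> nonzero" "(\<zero> \<otimes> c, y \<otimes> c) \<in> G" and y: "y \<in> carrier R"
      unfolding cl_def by blast
    then have "y \<otimes> c = \<zero>" using P(5)[of "y \<otimes> c"] by auto
    then show "y = \<zero>" using integral[of y c] \<open>c \<in> nonzero\<close> y by blast
  next
    show "\<exists>x y. x \<noteq> \<zero> \<and> (x, y) \<in> cl G"
      using P(6) subset_cl[OF G] by blast
  qed (use add scale in blast)+
  have "cl (cl G) \<subseteq> cl G"
  proof clarify
    fix x y assume "(x, y) \<in> cl (cl G)"
    then obtain c d where cd: "c \<in> nonzero" "d \<in> nonzero"
      "(x \<otimes> c \<otimes> d, y \<otimes> c \<otimes> d) \<in> G" "x \<in> carrier R" "y \<in> carrier R"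
      unfolding cl_def by blast
    then have "(x \<otimes> (c \<otimes> d), y \<otimes> (c \<otimes> d)) \<in> G" by (simp add: m_assoc)
    then show "(x, y) \<in> cl G"
      using cd mult_nonzero[of c d] unfolding cl_def by blast
  qed
  then show ?thesis using ph unfolding fraction_def by blast
qed

text \<open>Every \<open>u\<close> has a nonzero multiple
  \<open>u \<otimes> e = x \<otimes> f\<close>, where both graphs are forced by their common value
  at \<open>x\<close>; saturation then divides by \<open>e\<close>.\<close>

lemma fraction_subset:
  assumes G: "fraction G" and H: "fraction H"
    and x: "x \<noteq> \<zero>" "(x, y) \<in> G" "(x, y) \<in> H"
  shows "H \<subseteq> G"
proof clarify
  fix u v assume uv: "(u, v) \<in> H"
  note PG = partial_homD[OF fractionD(1)[OF G]]
  note PH = partial_homD[OF fractionD(1)[OF H]]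
  have c: "u \<in> carrier R" "v \<in> carrier R" "x \<in> nonzero" "y \<in> carrier R"
    using PH(1,2) uv x by auto
  obtain e f where e: "e \<in> nonzero" "f \<in> carrier R" "u \<otimes> e = x \<otimes> f"
    using right_ore_zero c by blast
  have "(u \<otimes> e, v \<otimes> e) \<in> H" "(u \<otimes> e, y \<otimes> f) \<in> H"
    using PH(4)[OF uv, of e] PH(4)[OF x(3), of f] e by auto
  then have "v \<otimes> e = y \<otimes> f"
    using partial_hom_single_valued[OF fractionD(1)[OF H]] by blast
  then have "(u \<otimes> e, v \<otimes> e) \<in> G" using PG(4)[OF x(2), of f] e by simp
  then show "(u, v) \<in> G" using fractionD(2)[OF G] c e by blast
qed

text \<open>The device behind all ring axioms: an identity of fractions is settled by one nonzero
  point at which both sides take the same value.\<close>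

lemma fraction_eqI:
  assumes "fraction G" "fraction H" "x \<noteq> \<zero>" "(x, y) \<in> G" "(x, y) \<in> H"
  shows "G = H"
  using fraction_subset assms by blast

lemma fraction_reach:
  assumes "fraction G" "y \<in> carrier R"
  obtains c z where "c \<in> nonzero" "(y \<otimes> c, z) \<in> G"
proof -
  note P = partial_homD[OF fractionD(1)[OF assms(1)]]
  obtain b a where b: "b \<in> nonzero" "a \<in> carrier R" "(b, a) \<in> G" using P(6) by blast
  obtain c d where "c \<in> nonzero" "d \<in> carrier R" "y \<otimes> c = b \<otimes> d"
    using right_ore_zero[of y b] assms b by blast
  then show ?thesis using P(4)[OF b(3), of d] that by simp
qed

section \<open>Products and sums of fractions\<close>

definition comp_rel :: "('a \<times> 'a) set \<Rightarrow> ('a \<times> 'a) set \<Rightarrow> ('a \<times> 'a) set"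
  where "comp_rel G H = {(x, z). \<exists>y. (x, y) \<in> H \<and> (y, z) \<in> G}"

definition sum_rel :: "('a \<times> 'a) set \<Rightarrow> ('a \<times> 'a) set \<Rightarrow> ('a \<times> 'a) set"
  where "sum_rel G H = {(x, y \<oplus> z) | x y z. (x, y) \<in> G \<and> (x, z) \<in> H}"

lemma partial_hom_comp:
  assumes "fraction G" "fraction H"
  shows "partial_hom (comp_rel G H)"
proof -
  note PG = partial_homD[OF fractionD(1)[OF assms(1)]]
  note PH = partial_homD[OF fractionD(1)[OF assms(2)]]
  obtain b a where b: "b \<in> nonzero" "a \<in> carrier R" "(b, a) \<in> H" using PH(6) by blast
  obtain c z where c: "c \<in> nonzero" "(a \<otimes> c, z) \<in> G"
    using fraction_reach[OF assms(1) b(2)] .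
  have "(b \<otimes> c, a \<otimes> c) \<in> H" using PH(4)[OF b(3)] c by blast
  moreover have "b \<otimes> c \<noteq> \<zero>" using mult_nonzero b c by blast
  ultimately have "\<exists>x y. x \<noteq> \<zero> \<and> (x, y) \<in> comp_rel G H"
    using c unfolding comp_rel_def by blast
  then show ?thesis
    unfolding partial_hom_def comp_rel_def
    apply (intro conjI)
    subgoal using PG(2) PH(1) by blast
    subgoal using PG(3) PH(3) by blast
    subgoal using PG(4) PH(4) by blast
    subgoal using PG(5) PH(5) by blast
    subgoal by blast
    done
qed

lemma fraction_common_denominator:
  assumes "fraction G" "fraction H"
  obtains x y z where "x \<in> nonzero" "(x, y) \<in> G" "(x, z) \<in> H"
proof -
  note P = partial_homD[OF fractionD(1)[OF assms(1)]]
  obtain b a where b: "b \<in> nonzero" "a \<in> carrier R" "(b, a) \<in> G" using P(6) by blast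
  obtain c z where c: "c \<in> nonzero" "(b \<otimes> c, z) \<in> H"
    using fraction_reach[OF assms(2), of b] b by blast
  then show ?thesis using that[of "b \<otimes> c" "a \<otimes> c" z] mult_nonzero[of b c] P(4)[OF b(3), of c] b by blast
qed

lemma partial_hom_sum:
  assumes "fraction G" "fraction H"
  shows "partial_hom (sum_rel G H)"
proof -
  note PG = partial_homD[OF fractionD(1)[OF assms(1)]]
  note PH = partial_homD[OF fractionD(1)[OF assms(2)]]
  obtain x y z where xyz: "x \<in> nonzero" "(x, y) \<in> G" "(x, z) \<in> H"
    using fraction_common_denominator[OF assms] .
  have add: "(x \<oplus> x', y \<oplus> y') \<in> sum_rel G H"
    if h: "(x, y) \<in> sum_rel G H" "(x', y') \<in> sum_rel G H" for x y x' y'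
  proof -
    obtain a b where a: "(x, a) \<in> G" "(x, b) \<in> H" "y = a \<oplus> b" using h unfolding sum_rel_def by blast
    obtain c d where c: "(x', c) \<in> G" "(x', d) \<in> H" "y' = c \<oplus> d" using h unfolding sum_rel_def by blast
    have "y \<oplus> y' = (a \<oplus> c) \<oplus> (b \<oplus> d)"
      using a c PG(2) PH(2) by (simp add: a_ac)
    then show ?thesis using PG(3)[OF a(1) c(1)] PH(3)[OF a(2) c(2)] unfolding sum_rel_def by blast
  qed
  have scale: "(x \<otimes> r, y \<otimes> r) \<in> sum_rel G H"
    if h: "(x, y) \<in> sum_rel G H" "r \<in> carrier R" for x y r
  proof -
    obtain a b where a: "(x, a) \<in> G" "(x, b) \<in> H" "y = a \<oplus> b" using h unfolding sum_rel_def by blast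
    have "y \<otimes> r = a \<otimes> r \<oplus> b \<otimes> r"
      using a h PG(2) PH(2) by (simp add: l_distr)
    then show ?thesis using PG(4)[OF a(1) h(2)] PH(4)[OF a(2) h(2)] unfolding sum_rel_def by blast
  qed
  show ?thesis
    unfolding partial_hom_def
    apply (intro conjI)
    subgoal using PG(1,2) PH(2) unfolding sum_rel_def by blast
    subgoal using add by blast
    subgoal using scale by blast
    subgoal using PG(5) PH(5) unfolding sum_rel_def by fastforce
    subgoal using xyz unfolding sum_rel_def by blast
    done
qed

definition frac_mult where "frac_mult G H = cl (comp_rel G H)"
definition frac_add where "frac_add G H = cl (sum_rel G H)"
definition frac_of :: "'a \<Rightarrow> ('a \<times> 'a) set" where "frac_of a = {(x, a \<otimes> x) | x. x \<in> carrier R}"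

definition Frac :: "('a \<times> 'a) set ring"
  where "Frac = \<lparr>carrier = {G. fraction G}, mult = frac_mult, one = frac_of \<one>,
    zero = frac_of \<zero>, add = frac_add\<rparr>"

lemma fraction_mult: "\<lbrakk>fraction G; fraction H\<rbrakk> \<Longrightarrow> fraction (frac_mult G H)"
  unfolding frac_mult_def by (intro fraction_cl partial_hom_comp)

lemma fraction_add: "\<lbrakk>fraction G; fraction H\<rbrakk> \<Longrightarrow> fraction (frac_add G H)"
  unfolding frac_add_def by (intro fraction_cl partial_hom_sum)

lemma fraction_of: "a \<in> carrier R \<Longrightarrow> fraction (frac_of a)"
proof -
  assume a: "a \<in> carrier R"
  have ph: "partial_hom (frac_of a)"
    unfolding partial_hom_def frac_of_def
    using a one_not_zero by (auto simp: r_distr m_assoc intro!: exI[of _ \<one>])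
  have "cl (frac_of a) \<subseteq> frac_of a"
  proof clarify
    fix x y assume "(x, y) \<in> cl (frac_of a)"
    then obtain c where c: "x \<in> carrier R" "y \<in> carrier R" "c \<in> nonzero" "y \<otimes> c = a \<otimes> (x \<otimes> c)"
      unfolding cl_def frac_of_def by blast
    then have "y = a \<otimes> x"
      using right_cancel[of y "a \<otimes> x" c] a by (simp add: m_assoc)
    then show "(x, y) \<in> frac_of a" using c unfolding frac_of_def by blast
  qed
  then show ?thesis using ph unfolding fraction_def by blast
qed

lemma frac_ofI: "\<lbrakk>x \<in> carrier R; y = a \<otimes> x\<rbrakk> \<Longrightarrow> (x, y) \<in> frac_of a"
  unfolding frac_of_def by blast

lemma frac_multI: "\<lbrakk>fraction G; fraction H; (x, y) \<in> H; (y, z) \<in> G\<rbrakk> \<Longrightarrow> (x, z) \<in> frac_mult G H"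
  unfolding frac_mult_def by (intro cl_memI partial_hom_comp) (auto simp: comp_rel_def)

lemma frac_addI: "\<lbrakk>fraction G; fraction H; (x, y) \<in> G; (x, z) \<in> H\<rbrakk> \<Longrightarrow> (x, y \<oplus> z) \<in> frac_add G H"
  unfolding frac_add_def by (intro cl_memI partial_hom_sum) (auto simp: sum_rel_def)

lemma fraction_scale: "\<lbrakk>fraction G; (x, y) \<in> G; r \<in> carrier R\<rbrakk> \<Longrightarrow> (x \<otimes> r, y \<otimes> r) \<in> G"
  using partial_homD(4) fractionD(1) by blast

lemma fraction_carrier: "\<lbrakk>fraction G; (x, y) \<in> G\<rbrakk> \<Longrightarrow> x \<in> carrier R \<and> y \<in> carrier R"
  using partial_homD(1,2) fractionD(1) by blast

lemma fraction_point:
  assumes "fraction G" obtains x y where "x \<in> nonzero" "y \<in> carrier R" "(x, y) \<in> G"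
  using partial_homD(6) fractionD(1) assms by blast

text \<open>Enlarges the denominator \<open>b\<close> until the numerator lies in the domain of the
  next fraction of a composition.\<close>

lemma fraction_chain:
  assumes G: "fraction G" and b: "b \<in> nonzero" "a \<in> carrier R"
  obtains c z where "c \<in> nonzero" "b \<otimes> c \<in> nonzero" "(a \<otimes> c, z) \<in> G"
  using fraction_reach[OF G b(2)] mult_nonzero b by metis

section \<open>Ring axioms for fractions\<close>

lemma frac_mult_assoc:
  assumes F: "fraction F" and G: "fraction G" and H: "fraction H"
  shows "frac_mult (frac_mult F G) H = frac_mult F (frac_mult G H)"
proof -
  obtain x y where 1: "x \<in> nonzero" "y \<in> carrier R" "(x, y) \<in> H"
    using fraction_point[OF H] .
  obtain c z where 2: "c \<in> nonzero" "x \<otimes> c \<in> nonzero" "(y \<otimes> c, z) \<in> G"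
    using fraction_chain[OF G 1(1,2)] .
  have z: "z \<in> carrier R" using fraction_carrier[OF G 2(3)] by blast
  obtain d w where 3: "d \<in> nonzero" "x \<otimes> c \<otimes> d \<in> nonzero" "(z \<otimes> d, w) \<in> F"
    using fraction_chain[OF F 2(2) z] .
  have h: "(x \<otimes> c \<otimes> d, y \<otimes> c \<otimes> d) \<in> H" "(y \<otimes> c \<otimes> d, z \<otimes> d) \<in> G"
    using fraction_scale[OF H fraction_scale[OF H 1(3), of c], of d] fraction_scale[OF G 2(3), of d] 2 3 by auto
  show ?thesis
  proof (rule fraction_eqI)
    show "x \<otimes> c \<otimes> d \<noteq> \<zero>" using 3 by blast
    show "(x \<otimes> c \<otimes> d, w) \<in> frac_mult (frac_mult F G) H"
      by (intro frac_multI[OF _ _ h(1)] frac_multI[OF _ _ h(2)] fraction_mult F G H 3)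
    show "(x \<otimes> c \<otimes> d, w) \<in> frac_mult F (frac_mult G H)"
      by (intro frac_multI[OF _ _ _ 3(3)] frac_multI[OF _ _ h] fraction_mult F G H)
  qed (intro fraction_mult F G H)+
qed

lemma frac_distrib_right:
  assumes F: "fraction F" and G: "fraction G" and H: "fraction H"
  shows "frac_mult (frac_add F G) H = frac_add (frac_mult F H) (frac_mult G H)"
proof -
  obtain x y where 1: "x \<in> nonzero" "y \<in> carrier R" "(x, y) \<in> H"
    using fraction_point[OF H] .
  obtain c z where 2: "c \<in> nonzero" "x \<otimes> c \<in> nonzero" "(y \<otimes> c, z) \<in> G"
    using fraction_chain[OF G 1(1,2)] .
  have yc: "y \<otimes> c \<in> carrier R" using fraction_carrier[OF G 2(3)] by blast
  obtain d w where 3: "d \<in> nonzero" "x \<otimes> c \<otimes> d \<in> nonzero" "(y \<otimes> c \<otimes> d, w) \<in> F"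
    using fraction_chain[OF F 2(2) yc] .
  have h: "(x \<otimes> c \<otimes> d, y \<otimes> c \<otimes> d) \<in> H" "(y \<otimes> c \<otimes> d, z \<otimes> d) \<in> G"
    using fraction_scale[OF H fraction_scale[OF H 1(3), of c], of d] fraction_scale[OF G 2(3), of d] 2 3 by auto
  show ?thesis
  proof (rule fraction_eqI)
    show "x \<otimes> c \<otimes> d \<noteq> \<zero>" using 3 by blast
    show "(x \<otimes> c \<otimes> d, w \<oplus> z \<otimes> d) \<in> frac_mult (frac_add F G) H"
      by (intro frac_multI[OF _ _ h(1)] frac_addI[OF _ _ 3(3) h(2)] fraction_add F G H)
    show "(x \<otimes> c \<otimes> d, w \<oplus> z \<otimes> d) \<in> frac_add (frac_mult F H) (frac_mult G H)"
      by (intro frac_addI frac_multI[OF _ _ h(1) 3(3)] frac_multI[OF _ _ h] fraction_mult F G H)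
  qed (intro fraction_mult fraction_add F G H)+
qed

lemma frac_distrib_left:
  assumes F: "fraction F" and G: "fraction G" and H: "fraction H"
  shows "frac_mult H (frac_add F G) = frac_add (frac_mult H F) (frac_mult H G)"
proof -
  obtain x y z where 1: "x \<in> nonzero" "(x, y) \<in> F" "(x, z) \<in> G"
    using fraction_common_denominator[OF F G] .
  have yz: "y \<in> carrier R" "z \<in> carrier R" using fraction_carrier[OF F 1(2)] fraction_carrier[OF G 1(3)] by auto
  obtain c u where 2: "c \<in> nonzero" "x \<otimes> c \<in> nonzero" "(y \<otimes> c, u) \<in> H"
    using fraction_chain[OF H 1(1) yz(1)] .
  have zc: "z \<otimes> c \<in> carrier R" using 2 yz by blast
  obtain d v where 3: "d \<in> nonzero" "x \<otimes> c \<otimes> d \<in> nonzero" "(z \<otimes> c \<otimes> d, v) \<in> H"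
    using fraction_chain[OF H 2(2) zc] .
  have cd: "c \<in> carrier R" "d \<in> carrier R" using 2 3 by auto
  have h: "(x \<otimes> c \<otimes> d, y \<otimes> c \<otimes> d) \<in> F" "(x \<otimes> c \<otimes> d, z \<otimes> c \<otimes> d) \<in> G" "(y \<otimes> c \<otimes> d, u \<otimes> d) \<in> H"
    using fraction_scale[OF F fraction_scale[OF F 1(2), of c], of d]
      fraction_scale[OF G fraction_scale[OF G 1(3), of c], of d] fraction_scale[OF H 2(3), of d] cd by auto
  have uv: "u \<otimes> d \<in> carrier R" "v \<in> carrier R"
    using fraction_carrier[OF H h(3)] fraction_carrier[OF H 3(3)] by auto
  have sum: "(y \<otimes> c \<otimes> d \<oplus> z \<otimes> c \<otimes> d, u \<otimes> d \<oplus> v) \<in> H"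
    using partial_homD(3)[OF fractionD(1)[OF H] h(3) 3(3)] .
  show ?thesis
  proof (rule fraction_eqI)
    show "x \<otimes> c \<otimes> d \<noteq> \<zero>" using 3 by blast
    show "(x \<otimes> c \<otimes> d, u \<otimes> d \<oplus> v) \<in> frac_mult H (frac_add F G)"
      by (intro frac_multI[OF _ _ _ sum] frac_addI[OF _ _ h(1,2)] fraction_add F G H)
    show "(x \<otimes> c \<otimes> d, u \<otimes> d \<oplus> v) \<in> frac_add (frac_mult H F) (frac_mult H G)"
      by (intro frac_addI frac_multI[OF _ _ h(1,3)] frac_multI[OF _ _ h(2) 3(3)] fraction_mult F G H)
  qed (intro fraction_mult fraction_add F G H)+
qed

lemma frac_add_comm:
  assumes F: "fraction F" and G: "fraction G"
  shows "frac_add F G = frac_add G F"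
proof -
  obtain x y z where 1: "x \<in> nonzero" "(x, y) \<in> F" "(x, z) \<in> G"
    using fraction_common_denominator[OF F G] .
  have yz: "y \<oplus> z = z \<oplus> y" using fraction_carrier[OF F 1(2)] fraction_carrier[OF G 1(3)] a_comm by blast
  show ?thesis
    by (rule fraction_eqI[of _ _ x "y \<oplus> z"])
      (use 1 yz frac_addI[OF F G 1(2,3)] frac_addI[OF G F 1(3,2)] fraction_add F G in auto)
qed

lemma frac_add_assoc:
  assumes F: "fraction F" and G: "fraction G" and H: "fraction H"
  shows "frac_add (frac_add F G) H = frac_add F (frac_add G H)"
proof -
  obtain x y z where 1: "x \<in> nonzero" "(x, y) \<in> F" "(x, z) \<in> G"
    using fraction_common_denominator[OF F G] .
  obtain c u where 2: "c \<in> nonzero" "x \<otimes> c \<in> nonzero" "(x \<otimes> c, u) \<in> H"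
    using fraction_chain[OF H 1(1), of x] 1 by blast
  have h: "(x \<otimes> c, y \<otimes> c) \<in> F" "(x \<otimes> c, z \<otimes> c) \<in> G"
    using fraction_scale[OF F 1(2)] fraction_scale[OF G 1(3)] 2 by auto
  have "y \<otimes> c \<in> carrier R" "z \<otimes> c \<in> carrier R" "u \<in> carrier R"
    using fraction_carrier[OF F h(1)] fraction_carrier[OF G h(2)] fraction_carrier[OF H 2(3)] by auto
  then have eq: "y \<otimes> c \<oplus> z \<otimes> c \<oplus> u = y \<otimes> c \<oplus> (z \<otimes> c \<oplus> u)" by (simp add: a_assoc)
  show ?thesis
  proof (rule fraction_eqI)
    show "x \<otimes> c \<noteq> \<zero>" using 2 by blast
    show "(x \<otimes> c, y \<otimes> c \<oplus> z \<otimes> c \<oplus> u) \<in> frac_add (frac_add F G) H"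
      by (intro frac_addI h 2 fraction_add F G H)
    show "(x \<otimes> c, y \<otimes> c \<oplus> z \<otimes> c \<oplus> u) \<in> frac_add F (frac_add G H)"
      unfolding eq by (intro frac_addI h 2 fraction_add F G H)
  qed (intro fraction_mult fraction_add F G H)+
qed

lemma frac_zero_add:
  assumes F: "fraction F" shows "frac_add (frac_of \<zero>) F = F"
proof -
  obtain x y where 1: "x \<in> nonzero" "y \<in> carrier R" "(x, y) \<in> F"
    using fraction_point[OF F] .
  have "(x, \<zero> \<oplus> y) \<in> frac_add (frac_of \<zero>) F"
    using 1 by (intro frac_addI fraction_of F frac_ofI) auto
  then show ?thesis
    using fraction_eqI[of "frac_add (frac_of \<zero>) F" F x y] 1 fraction_add fraction_of F by auto
qed

lemma frac_one_mult:
  assumes F: "fraction F" shows "frac_mult (frac_of \<one>) F = F" "frac_mult F (frac_of \<one>) = F"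
proof -
  obtain x y where 1: "x \<in> nonzero" "y \<in> carrier R" "(x, y) \<in> F"
    using fraction_point[OF F] .
  have "(x, y) \<in> frac_mult (frac_of \<one>) F"
    using 1 by (intro frac_multI[of _ _ _ y] fraction_of F frac_ofI) auto
  then show "frac_mult (frac_of \<one>) F = F"
    using fraction_eqI[of "frac_mult (frac_of \<one>) F" F x y] 1 fraction_mult fraction_of F by auto
  have "(x, y) \<in> frac_mult F (frac_of \<one>)"
    using 1 by (intro frac_multI[of _ _ _ x] fraction_of F frac_ofI) auto
  then show "frac_mult F (frac_of \<one>) = F"
    using fraction_eqI[of "frac_mult F (frac_of \<one>)" F x y] 1 fraction_mult fraction_of F by auto
qed

lemma frac_neg:
  assumes F: "fraction F" shows "frac_add (frac_mult (frac_of (\<ominus> \<one>)) F) F = frac_of \<zero>"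
proof -
  obtain x y where 1: "x \<in> nonzero" "y \<in> carrier R" "(x, y) \<in> F"
    using fraction_point[OF F] .
  have "(x, \<ominus> y \<oplus> y) \<in> frac_add (frac_mult (frac_of (\<ominus> \<one>)) F) F"
    using 1 by (intro frac_addI frac_multI[of _ _ _ y] fraction_mult fraction_of F frac_ofI)
      (auto simp: l_minus)
  moreover have "(x, \<zero>) \<in> frac_of \<zero>" using 1 by (intro frac_ofI) auto
  ultimately show ?thesis
    using fraction_eqI[of "frac_add (frac_mult (frac_of (\<ominus> \<one>)) F) F" "frac_of \<zero>" x \<zero>]
      1 fraction_mult fraction_add fraction_of F by (auto simp: l_neg)
qed

lemma ring_Frac: "ring Frac"
proof (rule ringI)
  show "abelian_group Frac"
  proof (rule abelian_groupI)
    fix F assume "F \<in> carrier Frac"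
    then show "\<exists>y\<in>carrier Frac. y \<oplus>\<^bsub>Frac\<^esub> F = \<zero>\<^bsub>Frac\<^esub>"
      by (auto simp: Frac_def fraction_mult fraction_of frac_neg
          intro!: bexI[of _ "frac_mult (frac_of (\<ominus> \<one>)) F"] exI[of _ "frac_mult (frac_of (\<ominus> \<one>)) F"])
  next
    fix F G assume "F \<in> carrier Frac" "G \<in> carrier Frac"
    then show "F \<oplus>\<^bsub>Frac\<^esub> G = G \<oplus>\<^bsub>Frac\<^esub> F" using frac_add_comm by (simp add: Frac_def)
  qed (auto simp: Frac_def fraction_add fraction_of frac_add_assoc frac_zero_add)
  show "monoid Frac"
    by (rule monoidI) (auto simp: Frac_def fraction_mult fraction_of frac_mult_assoc frac_one_mult)
qed (auto simp: Frac_def frac_distrib_left frac_distrib_right)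

lemma frac_of_hom: "frac_of \<in> ring_hom R Frac"
proof (rule ring_hom_memI)
  fix x y assume xy: "x \<in> carrier R" "y \<in> carrier R"
  show "frac_of x \<in> carrier Frac" using xy by (simp add: Frac_def fraction_of)
  show "frac_of (x \<otimes> y) = frac_of x \<otimes>\<^bsub>Frac\<^esub> frac_of y"
    using fraction_eqI[of "frac_of (x \<otimes> y)" "frac_mult (frac_of x) (frac_of y)" \<one> "x \<otimes> y"]
      xy one_not_zero frac_multI[of "frac_of x" "frac_of y" \<one> y "x \<otimes> y"]
    by (simp add: Frac_def fraction_of fraction_mult frac_ofI)
  show "frac_of (x \<oplus> y) = frac_of x \<oplus>\<^bsub>Frac\<^esub> frac_of y"
    using fraction_eqI[of "frac_of (x \<oplus> y)" "frac_add (frac_of x) (frac_of y)" \<one> "x \<oplus> y"]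
      xy one_not_zero frac_addI[of "frac_of x" "frac_of y" \<one> x y]
    by (simp add: Frac_def fraction_of fraction_add frac_ofI)
qed (simp add: Frac_def)

lemma frac_of_eq_iff: "\<lbrakk>a \<in> carrier R; b \<in> carrier R\<rbrakk> \<Longrightarrow> frac_of a = frac_of b \<longleftrightarrow> a = b"
proof
  assume a: "a \<in> carrier R" "b \<in> carrier R" "frac_of a = frac_of b"
  have "(\<one>, a) \<in> frac_of b" using a(1) frac_ofI[of \<one> a a] unfolding a(3)[symmetric] by simp
  then show "a = b" using a by (auto simp: frac_of_def)
qed simp

section \<open>Inverses, and the division ring of fractions\<close>

lemma fraction_converse:
  assumes G: "fraction G" and p: "y \<noteq> \<zero>" "(x, y) \<in> G"
  shows "fraction (G\<inverse>)"
proof -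
  note P = partial_homD[OF fractionD(1)[OF G]]
  have yc: "y \<in> nonzero" "x \<in> carrier R" using P(1,2) p by auto
  have x: "x \<noteq> \<zero>" using P(5) p by blast
  have inj: "u = \<zero>" if u: "(u, \<zero>) \<in> G" for u
  proof -
    have uc: "u \<in> carrier R" using P(1) u by blast
    obtain c d where c: "c \<in> nonzero" "d \<in> carrier R" "u \<otimes> c = x \<otimes> d"
      using right_ore_zero[of u x] uc x yc by blast
    have "(u \<otimes> c, \<zero>) \<in> G" "(u \<otimes> c, y \<otimes> d) \<in> G"
      using P(4)[OF u, of c] P(4)[OF p(2), of d] c by auto
    then have "y \<otimes> d = \<zero>" using partial_hom_single_valued[OF fractionD(1)[OF G]] by blast
    then have "d = \<zero>" using integral[of y d] yc c by blast
    then show ?thesis using c uc integral[of u c] yc by auto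
  qed
  show ?thesis
    unfolding fraction_def
  proof
    show "partial_hom (G\<inverse>)"
      unfolding partial_hom_def
      apply (intro conjI)
      subgoal using P(1,2) by blast
      subgoal using P(3) by blast
      subgoal using P(4) by blast
      subgoal using inj by blast
      subgoal using p by blast
      done
    show "cl (G\<inverse>) \<subseteq> G\<inverse>"
      using fractionD(2)[OF G] unfolding cl_def by blast
  qed
qed

text \<open>The inverse is the converse graph. Injectivity of a graph with one nonzero value, shown
  above, is what makes the converse single valued.\<close>

lemma Frac_unit:
  assumes G: "fraction G" and p: "y \<noteq> \<zero>" "(x, y) \<in> G"
  shows "G \<in> Units Frac" "inv\<^bsub>Frac\<^esub> G = G\<inverse>"
proof -
  interpret F: ring Frac by (rule ring_Frac)
  note cG = fraction_converse[OF assms]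
  have c: "G \<in> carrier Frac" "G\<inverse> \<in> carrier Frac" using G cG by (auto simp: Frac_def)
  have xy: "x \<in> carrier R" "y \<in> carrier R" using fraction_carrier G p by auto
  have x: "x \<noteq> \<zero>" using partial_homD(5)[OF fractionD(1)[OF G]] p by blast
  have "frac_mult G (G\<inverse>) = frac_of \<one>"
    using fraction_eqI[of "frac_mult G (G\<inverse>)" "frac_of \<one>" y y] p xy
      frac_multI[OF G cG, of y x y] fraction_mult[OF G cG] fraction_of frac_ofI[of y y \<one>] by auto
  moreover have "frac_mult (G\<inverse>) G = frac_of \<one>"
    using fraction_eqI[of "frac_mult (G\<inverse>) G" "frac_of \<one>" x x] p xy x
      frac_multI[OF cG G, of x y x] fraction_mult[OF cG G] fraction_of frac_ofI[of x x \<one>] by auto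
  ultimately have i: "G \<otimes>\<^bsub>Frac\<^esub> G\<inverse> = \<one>\<^bsub>Frac\<^esub>" "G\<inverse> \<otimes>\<^bsub>Frac\<^esub> G = \<one>\<^bsub>Frac\<^esub>"
    by (auto simp: Frac_def)
  then show "G \<in> Units Frac" using c unfolding Units_def by blast
  show "inv\<^bsub>Frac\<^esub> G = G\<inverse>" using i c F.inv_char by blast
qed

lemma division_ring_Frac: "division_ring Frac"
proof -
  interpret F: ring Frac by (rule ring_Frac)
  have ne: "\<one>\<^bsub>Frac\<^esub> \<noteq> \<zero>\<^bsub>Frac\<^esub>"
    using frac_of_eq_iff[of \<one> \<zero>] one_not_zero by (simp add: Frac_def)
  have "G \<in> Units Frac" if "G \<in> carrier Frac" "G \<noteq> \<zero>\<^bsub>Frac\<^esub>" for G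
  proof -
    have G: "fraction G" using that by (simp add: Frac_def)
    obtain x y where xy: "x \<in> nonzero" "y \<in> carrier R" "(x, y) \<in> G" using fraction_point[OF G] .
    have "y \<noteq> \<zero>"
    proof
      assume "y = \<zero>"
      then have "G = frac_of \<zero>"
        using fraction_eqI[OF G fraction_of, of \<zero> x \<zero>] xy frac_ofI[of x \<zero> \<zero>] by auto
      then show False using that by (simp add: Frac_def)
    qed
    then show ?thesis using Frac_unit(1)[OF G] xy by blast
  qed
  moreover have "\<zero>\<^bsub>Frac\<^esub> \<notin> Units Frac"
    using ne by (metis F.Units_l_inv_ex F.r_null)
  ultimately have "Units Frac = carrier Frac - {\<zero>\<^bsub>Frac\<^esub>}"
    using F.Units_closed by blast
  then show ?thesis using ne ring_Frac unfolding division_ring_def by blast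
qed

theorem division_ring_of_fractions_Frac: "division_ring_of_fractions R Frac frac_of"
proof -
  have inv: "(b \<otimes> x, x) \<in> inv\<^bsub>Frac\<^esub> (frac_of b)" "fraction (inv\<^bsub>Frac\<^esub> (frac_of b))"
    if "b \<in> nonzero" "x \<in> carrier R" for b x
  proof -
    have p: "(\<one>, b) \<in> frac_of b" "b \<noteq> \<zero>" using that by (auto intro!: frac_ofI)
    have "inv\<^bsub>Frac\<^esub> (frac_of b) = (frac_of b)\<inverse>" using Frac_unit(2)[OF fraction_of] that p by blast
    then show "(b \<otimes> x, x) \<in> inv\<^bsub>Frac\<^esub> (frac_of b)" "fraction (inv\<^bsub>Frac\<^esub> (frac_of b))"
      using that frac_ofI[of x "b \<otimes> x" b] fraction_converse[OF fraction_of p(2,1)] by auto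
  qed
  have "\<exists>a\<in>carrier R. \<exists>b\<in>nonzero. G = frac_of a \<otimes>\<^bsub>Frac\<^esub> inv\<^bsub>Frac\<^esub> (frac_of b)"
    "\<exists>a\<in>carrier R. \<exists>b\<in>nonzero. G = inv\<^bsub>Frac\<^esub> (frac_of b) \<otimes>\<^bsub>Frac\<^esub> frac_of a"
    if "G \<in> carrier Frac" for G
  proof -
    have G: "fraction G" using that by (simp add: Frac_def)
    obtain b a where ba: "b \<in> nonzero" "a \<in> carrier R" "(b, a) \<in> G" using fraction_point[OF G] .
    have "(b, a) \<in> frac_mult (frac_of a) (inv\<^bsub>Frac\<^esub> (frac_of b))"
      using inv[OF ba(1), of \<one>] ba by (intro frac_multI[of _ _ _ \<one>] fraction_of frac_ofI) auto
    then have "G = frac_of a \<otimes>\<^bsub>Frac\<^esub> inv\<^bsub>Frac\<^esub> (frac_of b)"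
      using fraction_eqI[OF G, of _ b a] ba inv(2)[OF ba(1,2)] fraction_of fraction_mult
      by (simp add: Frac_def)
    then show "\<exists>a\<in>carrier R. \<exists>b\<in>nonzero. G = frac_of a \<otimes>\<^bsub>Frac\<^esub> inv\<^bsub>Frac\<^esub> (frac_of b)"
      using ba by blast
    \<comment> \<open>By \<open>b' \<otimes> a = a' \<otimes> b\<close> the fraction with right
      denominator \<open>b\<close> also has the left denominator \<open>b'\<close>. As
      \<open>left_ore\<close> speaks of nonzero elements only, \<open>a = \<zero>\<close> is given
      the denominator \<open>\<one>\<close>.\<close>
    obtain b' a' where b': "b' \<in> nonzero" "a' \<in> carrier R" "b' \<otimes> a = a' \<otimes> b"
    proof (cases "a = \<zero>")
      case True
      then show ?thesis using that[of \<one> \<zero>] one_not_zero ba by simp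
    next
      case False
      then show ?thesis using left_ore[of a b] ba that by blast
    qed
    have "(b, a' \<otimes> b) \<in> frac_of a'" using ba by (auto intro!: frac_ofI)
    moreover have "(a' \<otimes> b, a) \<in> inv\<^bsub>Frac\<^esub> (frac_of b')" using inv(1)[OF b'(1) ba(2)] b' by simp
    ultimately have "(b, a) \<in> frac_mult (inv\<^bsub>Frac\<^esub> (frac_of b')) (frac_of a')"
      using frac_multI inv(2)[OF b'(1) b'(2)] fraction_of b' by blast
    then have "G = inv\<^bsub>Frac\<^esub> (frac_of b') \<otimes>\<^bsub>Frac\<^esub> frac_of a'"
      using fraction_eqI[OF G, of _ b a] ba b' inv(2)[OF b'(1) b'(2)] fraction_of fraction_mult
      by (simp add: Frac_def)
    then show "\<exists>a\<in>carrier R. \<exists>b\<in>nonzero. G = inv\<^bsub>Frac\<^esub> (frac_of b) \<otimes>\<^bsub>Frac\<^esub> frac_of a"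
      using b' by blast
  qed
  moreover have "inj_on frac_of (carrier R)" using frac_of_eq_iff by (auto simp: inj_on_def)
  ultimately show ?thesis
    unfolding division_ring_of_fractions_def
    using ring_axioms division_ring_Frac frac_of_hom by blast
qed

end

section \<open>Domains with a leading exponent\<close>

text \<open>Transfers results on right ideals and right multiples to the left-handed side.\<close>

definition opposite :: "('a, 'b) ring_scheme \<Rightarrow> ('a, 'b) ring_scheme"
  where "opposite R = R\<lparr>mult := (\<lambda>x y. y \<otimes>\<^bsub>R\<^esub> x)\<rparr>"

lemma opposite_simps [simp]:
  "carrier (opposite R) = carrier R" "\<zero>\<^bsub>opposite R\<^esub> = \<zero>\<^bsub>R\<^esub>" "\<one>\<^bsub>opposite R\<^esub> = \<one>\<^bsub>R\<^esub>"
  "x \<oplus>\<^bsub>opposite R\<^esub> y = x \<oplus>\<^bsub>R\<^esub> y" "x \<otimes>\<^bsub>opposite R\<^esub> y = y \<otimes>\<^bsub>R\<^esub> x"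
  by (simp_all add: opposite_def)

lemma a_minus_opposite [simp]: "x \<ominus>\<^bsub>opposite R\<^esub> y = x \<ominus>\<^bsub>R\<^esub> y"
  by (simp add: a_minus_def a_inv_def opposite_def)

lemma right_ideal_opposite: "right_ideal I (opposite R) \<longleftrightarrow> left_ideal I R"
  by (simp add: right_ideal_def left_ideal_def additive_subgroup_def opposite_def)

lemma ring_opposite: "ring R \<Longrightarrow> ring (opposite R)"
proof -
  assume "ring R"
  then interpret ring R .
  show ?thesis
  proof (rule ringI)
    show "abelian_group (opposite R)"
    proof (rule abelian_groupI)
      fix x assume "x \<in> carrier (opposite R)"
      then show "\<exists>y\<in>carrier (opposite R). y \<oplus>\<^bsub>opposite R\<^esub> x = \<zero>\<^bsub>opposite R\<^esub>"
        using l_neg by auto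
    qed (auto simp: a_ac)
    show "monoid (opposite R)" by (rule monoidI) (auto simp: m_assoc)
  qed (auto simp: l_distr r_distr)
qed

lemma (in ring) right_idealI:
  assumes "I \<subseteq> carrier R" "\<zero> \<in> I" "\<And>x y. \<lbrakk>x \<in> I; y \<in> I\<rbrakk> \<Longrightarrow> x \<oplus> y \<in> I"
    and r: "\<And>x r. \<lbrakk>x \<in> I; r \<in> carrier R\<rbrakk> \<Longrightarrow> x \<otimes> r \<in> I"
  shows "right_ideal I R"
proof -
  have "\<ominus> x \<in> I" if "x \<in> I" for x
    using r[OF that, of "\<ominus> \<one>"] that assms(1) by (auto simp: r_minus)
  then have "additive_subgroup I R"
    using assms unfolding additive_subgroup_def
    by (intro add.subgroupI) (auto simp: a_inv_def[symmetric])
  then show ?thesis unfolding right_ideal_def using r by blast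
qed

lemma (in ring) right_idealD:
  assumes "right_ideal I R"
  shows "x \<in> I \<Longrightarrow> x \<in> carrier R" "\<zero> \<in> I" "\<lbrakk>x \<in> I; y \<in> I\<rbrakk> \<Longrightarrow> x \<oplus> y \<in> I"
    "\<lbrakk>x \<in> I; y \<in> I\<rbrakk> \<Longrightarrow> x \<ominus> y \<in> I" "\<lbrakk>x \<in> I; r \<in> carrier R\<rbrakk> \<Longrightarrow> x \<otimes> r \<in> I"
proof -
  have s: "additive_subgroup I R" using assms unfolding right_ideal_def by blast
  show "x \<in> I \<Longrightarrow> x \<in> carrier R" using additive_subgroup.a_Hcarr[OF s] by blast
  show "\<zero> \<in> I" using additive_subgroup.zero_closed[OF s] .
  show "\<lbrakk>x \<in> I; y \<in> I\<rbrakk> \<Longrightarrow> x \<oplus> y \<in> I" using additive_subgroup.a_closed[OF s] .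
  show "\<lbrakk>x \<in> I; y \<in> I\<rbrakk> \<Longrightarrow> x \<ominus> y \<in> I"
    using additive_subgroup.a_closed[OF s] additive_subgroup.a_inv_closed[OF s]
    by (auto simp: a_minus_def)
  show "\<lbrakk>x \<in> I; r \<in> carrier R\<rbrakk> \<Longrightarrow> x \<otimes> r \<in> I" using assms unfolding right_ideal_def by blast
qed

text \<open>
  \<open>v\<close> plays the role of the exponent of the leading term: its values form a submonoid of an ordered
  abelian group, which is well-quasi-ordered by divisibility (as every finitely generated commutative
  monoid is) and completely integrally closed.
\<close>

locale leading_exponent = ring R for R (structure) +
  fixes v :: "'a \<Rightarrow> 'g::linordered_ab_group_add"
  assumes one_not_zero: "\<one> \<noteq> \<zero>"
    and v_mult: "\<lbrakk>a \<in> nonzero; b \<in> nonzero\<rbrakk> \<Longrightarrow> a \<otimes> b \<noteq> \<zero> \<and> v (a \<otimes> b) = v a + v b"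
    and v_cancel: "\<lbrakk>a \<in> nonzero; b \<in> nonzero; v a = v b\<rbrakk> \<Longrightarrow>
      \<exists>c\<in>carrier R. (\<forall>x\<in>carrier R. c \<otimes> x = x \<otimes> c) \<and> (a \<ominus> c \<otimes> b = \<zero> \<or> v (a \<ominus> c \<otimes> b) < v a)"
    and v_nonneg: "a \<in> nonzero \<Longrightarrow> 0 \<le> v a"
    and v_wqo: "(\<And>k :: nat. f k \<in> v ` nonzero) \<Longrightarrow> \<exists>i j. i < j \<and> f j - f i \<in> v ` nonzero"
    and v_integrally_closed: "\<lbrakk>\<And>k :: nat. f k \<in> v ` nonzero; \<And>k. f (Suc k) = f k + g\<rbrakk>
      \<Longrightarrow> g \<in> v ` nonzero"

text \<open>The axioms are symmetric: values commute, and the coefficient \<open>c\<close> of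
  \<open>v_cancel\<close> is central, so it may stand on either side.\<close>

lemma leading_exponent_opposite:
  assumes "leading_exponent R v" shows "leading_exponent (opposite R) v"
proof -
  interpret leading_exponent R v by fact
  interpret O: ring "opposite R" using ring_opposite ring_axioms by blast
  show ?thesis
  proof
    fix a b assume "a \<in> carrier (opposite R) - {\<zero>\<^bsub>opposite R\<^esub>}" "b \<in> carrier (opposite R) - {\<zero>\<^bsub>opposite R\<^esub>}"
    then show "a \<otimes>\<^bsub>opposite R\<^esub> b \<noteq> \<zero>\<^bsub>opposite R\<^esub> \<and> v (a \<otimes>\<^bsub>opposite R\<^esub> b) = v a + v b"
      using v_mult[of b a] by (simp add: add.commute)
  next
    fix a b assume h: "a \<in> carrier (opposite R) - {\<zero>\<^bsub>opposite R\<^esub>}" "b \<in> carrier (opposite R) - {\<zero>\<^bsub>opposite R\<^esub>}"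
      "v a = v b"
    then show "\<exists>c\<in>carrier (opposite R). (\<forall>x\<in>carrier (opposite R). c \<otimes>\<^bsub>opposite R\<^esub> x = x \<otimes>\<^bsub>opposite R\<^esub> c) \<and>
      (a \<ominus>\<^bsub>opposite R\<^esub> c \<otimes>\<^bsub>opposite R\<^esub> b = \<zero>\<^bsub>opposite R\<^esub> \<or> v (a \<ominus>\<^bsub>opposite R\<^esub> c \<otimes>\<^bsub>opposite R\<^esub> b) < v a)"
      using v_cancel[of a b] by fastforce
  next
    fix f and g :: 'c assume "\<And>k :: nat. f k \<in> v ` (carrier (opposite R) - {\<zero>\<^bsub>opposite R\<^esub>})" "\<And>k. f (Suc k) = f k + g"
    then show "g \<in> v ` (carrier (opposite R) - {\<zero>\<^bsub>opposite R\<^esub>})"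
      using v_integrally_closed[of f g] by simp
  qed (use one_not_zero v_nonneg v_wqo in auto)
qed

section \<open>Chain conditions, the Ore condition and maximality\<close>

context leading_exponent begin

abbreviation vals :: "'g set" where "vals \<equiv> v ` nonzero"

lemma v_one: "v \<one> = 0"
  using v_mult[of \<one> \<one>] one_not_zero by simp

text \<open>In an infinite descent, \<open>v_wqo\<close> would make some \<open>f j - f i\<close>
  with \<open>i < j\<close> a value, hence nonnegative.\<close>

lemma wf_values: "wf {(x, y). x \<in> vals \<and> y \<in> vals \<and> x < y}"
proof (rule ccontr)
  assume "\<not> ?thesis"
  then obtain f where f: "\<And>i :: nat. f i \<in> vals \<and> f (Suc i) < f i"
    unfolding wf_iff_no_infinite_down_chain by fast
  have dec: "f j < f i" if "i < j" for i j
    using that by (induction rule: less_Suc_induct) (use f in \<open>auto intro: less_trans\<close>)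
  obtain i j where ij: "i < j" "f j - f i \<in> vals" using v_wqo[of f] f by blast
  then obtain x where "x \<in> nonzero" "f j - f i = v x" by blast
  then have "0 \<le> f j - f i" using v_nonneg[of x] by simp
  then show False using dec[OF ij(1)] by simp
qed

text \<open>Induction on the leading exponent: an element of \<open>J\<close> minus a central
  multiple of an element of \<open>I\<close> with the same exponent is zero or has a smaller
  exponent.\<close>

lemma right_ideal_eqI:
  assumes I: "right_ideal I R" and J: "right_ideal J R" and "I \<subseteq> J"
    and v: "v ` (J - {\<zero>}) \<subseteq> v ` (I - {\<zero>})"
  shows "I = J"
proof -
  note I' = right_idealD[OF I] and J' = right_idealD[OF J]
  have "\<forall>a\<in>J - {\<zero>}. v a = g \<longrightarrow> a \<in> I" for g
  proof (induction g rule: wf_induct_rule[OF wf_values])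
    case (1 g)
    show ?case
    proof (intro ballI impI)
      fix a assume a: "a \<in> J - {\<zero>}" "v a = g"
      then obtain b where b: "b \<in> I - {\<zero>}" "v a = v b" using v by blast
      have ab: "a \<in> nonzero" "b \<in> nonzero" using a b J' I' by auto
      obtain c where c: "c \<in> carrier R" "\<forall>x\<in>carrier R. c \<otimes> x = x \<otimes> c"
        "a \<ominus> c \<otimes> b = \<zero> \<or> v (a \<ominus> c \<otimes> b) < v a"
        using v_cancel[OF ab b(2)] by blast
      have cb: "c \<otimes> b \<in> I" using c ab I'(5)[of b c] b by auto
      then have d: "a \<ominus> c \<otimes> b \<in> J" using a J'(4) \<open>I \<subseteq> J\<close> by blast
      have "a \<ominus> c \<otimes> b \<in> I"
      proof (cases "a \<ominus> c \<otimes> b = \<zero>")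
        case False
        then have "v (a \<ominus> c \<otimes> b) < g" "v (a \<ominus> c \<otimes> b) \<in> vals" "g \<in> vals"
          using c a d ab J'(1) by auto
        then show ?thesis using 1 d False by blast
      qed (use I' in simp)
      then have "a \<ominus> c \<otimes> b \<oplus> c \<otimes> b \<in> I" using I' cb by blast
      then show "a \<in> I" using ab c(1) by (simp add: a_minus_def a_assoc l_neg)
    qed
  qed
  then show ?thesis using \<open>I \<subseteq> J\<close> I'(2) by blast
qed

text \<open>Each strict inclusion contributes a new value. By \<open>v_wqo\<close> a later new value
  is an earlier one plus the value of some \<open>r\<close>, so it was already attained by a right
  multiple of the earlier element.\<close>

lemma right_ideals_stabilize:
  assumes C: "\<And>i. right_ideal (C i) R" and mono: "incseq C"
  shows "\<exists>N. \<forall>i\<ge>N. C i = C N"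
proof (rule ccontr)
  assume "\<not> ?thesis"
  then have "\<forall>N. \<exists>i\<ge>N. C i \<noteq> C N" by blast
  then obtain s where s: "\<And>N. s N \<ge> N" "\<And>N. C (s N) \<noteq> C N" by metis
  \<comment> \<open>Iterating \<open>s\<close> gives a subsequence along which every single
    inclusion is strict.\<close>
  define n where "n = rec_nat 0 (\<lambda>_. s)"
  have n: "n (Suc k) = s (n k)" for k by (simp add: n_def)
  have "\<exists>g. g \<in> v ` (C (n (Suc k)) - {\<zero>}) \<and> g \<notin> v ` (C (n k) - {\<zero>})" for k
    using right_ideal_eqI[OF C C, of "n k" "n (Suc k)"] s[of "n k"] incseqD[OF mono, of "n k" "n (Suc k)"] n
    by auto
  then obtain f where f: "\<And>k. f k \<in> v ` (C (n (Suc k)) - {\<zero>})" "\<And>k. f k \<notin> v ` (C (n k) - {\<zero>})"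
    by metis
  have "f k \<in> vals" for k using f(1)[of k] right_idealD(1)[OF C] by blast
  then obtain i j where ij: "i < j" "f j - f i \<in> vals" using v_wqo by blast
  then obtain r x where r: "r \<in> nonzero" "f j - f i = v r"
    and x: "x \<in> C (n (Suc i)) - {\<zero>}" "f i = v x" using f(1)[of i] by blast
  have "n k \<le> n (Suc k)" for k using s n by simp
  then have "n (Suc i) \<le> n j" using lift_Suc_mono_le[of n "Suc i" j] ij by simp
  then have "x \<in> C (n j)" using x incseqD[OF mono] by blast
  then have "x \<otimes> r \<in> C (n j)" using right_idealD(5)[OF C] r by blast
  moreover have "x \<otimes> r \<noteq> \<zero> \<and> v (x \<otimes> r) = f j"
    using v_mult[of x r] x r right_idealD(1)[OF C] by (auto simp: algebra_simps)
  ultimately have "f j \<in> v ` (C (n j) - {\<zero>})" by (intro image_eqI[of _ _ "x \<otimes> r"]) auto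
  then show False using f(2)[of j] by blast
qed

lemma integral: "\<lbrakk>a \<in> carrier R; b \<in> carrier R; a \<otimes> b = \<zero>\<rbrakk> \<Longrightarrow> a = \<zero> \<or> b = \<zero>"
  using v_mult by blast

text \<open>
  If \<open>aR \<inter> bR = 0\<close>, the right ideals \<open>aR + baR + \<dots> + b\<^sup>n\<^sup>-\<^sup>1aR\<close> form a strictly ascending chain.
\<close>

lemma right_ore:
  assumes a: "a \<in> nonzero" and b: "b \<in> nonzero"
  shows "\<exists>x\<in>nonzero. \<exists>y\<in>nonzero. a \<otimes> x = b \<otimes> y"
proof (rule ccontr)
  assume n: "\<not> ?thesis"
  have disj: "y = \<zero>" if h: "x \<in> carrier R" "y \<in> carrier R" "a \<otimes> x = b \<otimes> y" for x y
  proof (rule ccontr)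
    assume y: "y \<noteq> \<zero>"
    then have "x \<noteq> \<zero>" using h integral[of b y] a b by auto
    then show False using n h y by blast
  qed
  define C where "C = rec_nat {\<zero>} (\<lambda>_ I. {a \<otimes> x \<oplus> b \<otimes> y | x y. x \<in> carrier R \<and> y \<in> I})"
  have C0: "C 0 = {\<zero>}" and CS: "C (Suc k) = {a \<otimes> x \<oplus> b \<otimes> y | x y. x \<in> carrier R \<and> y \<in> C k}" for k
    by (simp_all add: C_def)
  have ri: "right_ideal (C k) R" for k
  proof (induction k)
    case 0
    show ?case unfolding C0 by (rule right_idealI) auto
  next
    case (Suc k)
    note D = right_idealD[OF Suc]
    show ?case
    proof (rule right_idealI)
      show "C (Suc k) \<subseteq> carrier R" using a b D(1) unfolding CS by blast
      have "\<zero> = a \<otimes> \<zero> \<oplus> b \<otimes> \<zero>" using a b by auto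
      then show "\<zero> \<in> C (Suc k)" using D(2) unfolding CS by blast
    next
      fix x y assume "x \<in> C (Suc k)" "y \<in> C (Suc k)"
      then obtain p q p' q' where h: "x = a \<otimes> p \<oplus> b \<otimes> q" "y = a \<otimes> p' \<oplus> b \<otimes> q'"
        "p \<in> carrier R" "p' \<in> carrier R" "q \<in> C k" "q' \<in> C k" unfolding CS by blast
      have "x \<oplus> y = a \<otimes> (p \<oplus> p') \<oplus> b \<otimes> (q \<oplus> q')"
        using h D(1) a b by (simp add: r_distr a_ac)
      then show "x \<oplus> y \<in> C (Suc k)" using h D(3) unfolding CS by blast
    next
      fix x r assume "x \<in> C (Suc k)" and r: "r \<in> carrier R"
      then obtain p q where h: "x = a \<otimes> p \<oplus> b \<otimes> q"
        "p \<in> carrier R" "q \<in> C k" unfolding CS by blast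
      have "x \<otimes> r = a \<otimes> (p \<otimes> r) \<oplus> b \<otimes> (q \<otimes> r)"
        using h D(1) a b r by (simp add: l_distr m_assoc)
      then show "x \<otimes> r \<in> C (Suc k)" using h r D(5) unfolding CS by blast
    qed
  qed
  have sub: "C k \<subseteq> C (Suc k)" for k
  proof (induction k)
    case 0
    show ?case using right_idealD(2)[OF ri] C0 by simp
  next
    case (Suc k)
    then show ?case unfolding CS[of "Suc k"] CS[of k] by blast
  qed
  then have "incseq C" by (rule incseq_SucI)
  then obtain N where "\<forall>i\<ge>N. C i = C N" using right_ideals_stabilize ri by blast
  then have "C (Suc N) = C N" using le_SucI[OF order_refl] by blast
  \<comment> \<open>Equality of two consecutive members descends: multiply by \<open>b\<close> on
    the left, and compare the \<open>b\<close>-components, which are unique because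
    \<open>aR\<close> and \<open>bR\<close> meet in zero.\<close>
  then have "C 1 = C 0"
  proof (induction N)
    case (Suc N)
    have "C (Suc N) \<subseteq> C N"
    proof
      fix x assume x: "x \<in> C (Suc N)"
      have xc: "x \<in> carrier R" using right_idealD(1)[OF ri x] .
      have "b \<otimes> x = a \<otimes> \<zero> \<oplus> b \<otimes> x" using xc a b by simp
      then have "b \<otimes> x \<in> C (Suc (Suc N))" using x unfolding CS[of "Suc N"] by blast
      then have "b \<otimes> x \<in> C (Suc N)" using Suc.prems by simp
      then obtain r y where ry: "r \<in> carrier R" "y \<in> C N" "b \<otimes> x = a \<otimes> r \<oplus> b \<otimes> y"
        unfolding CS by blast
      have yc: "y \<in> carrier R" using right_idealD(1)[OF ri ry(2)] .
      have "b \<otimes> (x \<ominus> y) = b \<otimes> x \<ominus> b \<otimes> y" using xc yc b by (simp add: a_minus_def r_distr r_minus)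
      also have "\<dots> = a \<otimes> r" using ry yc a b by (simp add: a_minus_def a_assoc r_neg)
      finally have "x \<ominus> y = \<zero>" using disj[of r "x \<ominus> y"] ry xc yc by simp
      then have "x = y" using xc yc by (simp add: r_right_minus_eq)
      then show "x \<in> C N" using ry by simp
    qed
    then show ?case using Suc.IH sub by blast
  qed simp
  moreover have "a \<otimes> \<one> \<oplus> b \<otimes> \<zero> \<in> C 1" using C0 by (simp add: CS) blast
  ultimately show False using a b C0 by simp
qed

interpretation opp: leading_exponent "opposite R" v
  by (rule leading_exponent_opposite) (rule leading_exponent_axioms)

lemma ore_domain: "ore_domain R"
proof
  fix a b assume "a \<in> nonzero" "b \<in> nonzero"
  then show "\<exists>x\<in>nonzero. \<exists>y\<in>nonzero. x \<otimes> a = y \<otimes> b"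
    using opp.right_ore[of a b] by simp
qed (use one_not_zero integral right_ore in auto)

lemma nc_noetherian: "nc_noetherian R"
  unfolding nc_noetherian_def
  using right_ideals_stabilize opp.right_ideals_stabilize[unfolded right_ideal_opposite] ring_axioms
  by blast

lemma nc_domain: "nc_domain R"
  unfolding nc_domain_def using integral one_not_zero ring_axioms by blast

text \<open>
  Extend \<open>v\<close> to the fractions.  If \<open>aTb \<subseteq> R\<close>, then \<open>v a + k v t + v b\<close> is a value of \<open>v\<close> on \<open>R\<close>
  for all \<open>k\<close> and \<open>t \<in> T\<close>, hence so is \<open>v t\<close>; now subtract from \<open>t\<close> an element of \<open>R\<close> with the same
  leading term and iterate.
\<close>

lemma maximal_order_subring:
  assumes frac: "division_ring_of_fractions R Q \<iota>"
    and T: "subring T Q" "\<iota> ` carrier R \<subseteq> T"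
    and a: "a \<in> nonzero" and b: "b \<in> nonzero"
    and ab: "\<And>t. t \<in> T \<Longrightarrow> \<iota> a \<otimes>\<^bsub>Q\<^esub> t \<otimes>\<^bsub>Q\<^esub> \<iota> b \<in> \<iota> ` carrier R"
  shows "T \<subseteq> \<iota> ` carrier R"
proof -
  interpret O: ore_domain R by (rule ore_domain)
  have divQ: "division_ring Q" and hom: "\<iota> \<in> ring_hom R Q" and inj: "inj_on \<iota> (carrier R)"
    using frac unfolding division_ring_of_fractions_def by auto
  have ringQ: "ring Q" and units: "Units Q = carrier Q - {\<zero>\<^bsub>Q\<^esub>}"
    and one_neq: "\<one>\<^bsub>Q\<^esub> \<noteq> \<zero>\<^bsub>Q\<^esub>"
    using divQ unfolding division_ring_def by auto
  interpret Q: ring Q by (rule ringQ)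
  interpret h: ring_hom_ring R Q \<iota>
    using hom by (intro ring_hom_ringI2 ring_axioms ringQ)
  note T' = subringE[OF T(1)]
  have Qmult: "x \<otimes>\<^bsub>Q\<^esub> y \<noteq> \<zero>\<^bsub>Q\<^esub>" if "x \<in> carrier Q - {\<zero>\<^bsub>Q\<^esub>}" "y \<in> carrier Q - {\<zero>\<^bsub>Q\<^esub>}" for x y
    using Q.Units_m_closed[of x y] that units by blast
  have \<iota>0: "\<iota> r \<noteq> \<zero>\<^bsub>Q\<^esub>" if "r \<in> nonzero" for r
  proof
    assume "\<iota> r = \<zero>\<^bsub>Q\<^esub>"
    then have "\<iota> r = \<iota> \<zero>" by simp
    then show False using that inj_onD[OF inj, of r \<zero>] by simp
  qed
  \<comment> \<open>A relation, not a function on fractions: that every nonzero fraction has exactly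
    one value is proved separately, uniqueness by common right multiples of denominators.\<close>
  define val where "val t g \<longleftrightarrow> (\<exists>r\<in>nonzero. \<exists>s\<in>nonzero. t \<otimes>\<^bsub>Q\<^esub> \<iota> s = \<iota> r \<and> g = v r - v s)"
    for t g
  have val_ex: "\<exists>g. val t g" if t: "t \<in> carrier Q - {\<zero>\<^bsub>Q\<^esub>}" for t
  proof -
    obtain r s where rs: "r \<in> carrier R" "s \<in> nonzero" "t = \<iota> r \<otimes>\<^bsub>Q\<^esub> inv\<^bsub>Q\<^esub> (\<iota> s)"
      using frac t unfolding division_ring_of_fractions_def by blast
    have u: "\<iota> s \<in> Units Q" using rs \<iota>0 units by auto
    have "t \<otimes>\<^bsub>Q\<^esub> \<iota> s = \<iota> r" using rs u by (simp add: Q.m_assoc Q.Units_l_inv)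
    moreover have "r \<noteq> \<zero>" using rs t u by auto
    ultimately show ?thesis using rs unfolding val_def by blast
  qed
  have val_unique: "g = h" if gh: "val t g" "val t h" "t \<in> carrier Q" for t g h
  proof -
    obtain r s where 1: "r \<in> nonzero" "s \<in> nonzero" "t \<otimes>\<^bsub>Q\<^esub> \<iota> s = \<iota> r" "g = v r - v s"
      using gh(1) unfolding val_def by blast
    obtain r' s' where 2: "r' \<in> nonzero" "s' \<in> nonzero" "t \<otimes>\<^bsub>Q\<^esub> \<iota> s' = \<iota> r'" "h = v r' - v s'"
      using gh(2) unfolding val_def by blast
    obtain x y where xy: "x \<in> nonzero" "y \<in> nonzero" "s \<otimes> x = s' \<otimes> y"
      using right_ore 1 2 by blast
    have "\<iota> (r \<otimes> x) = t \<otimes>\<^bsub>Q\<^esub> \<iota> (s \<otimes> x)" using 1(1,2) xy(1) gh(3) by (simp add: 1(3)[symmetric] Q.m_assoc)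
    also have "\<dots> = \<iota> (r' \<otimes> y)" using 2(1,2) xy(2) gh(3) by (simp add: xy(3) 2(3)[symmetric] Q.m_assoc)
    finally have "\<iota> (r \<otimes> x) = \<iota> (r' \<otimes> y)" .
    moreover have "r \<otimes> x \<in> carrier R" "r' \<otimes> y \<in> carrier R" using 1(1) 2(1) xy(1,2) by auto
    ultimately have "r \<otimes> x = r' \<otimes> y" using inj_onD[OF inj] by blast
    then have "v r + v x = v r' + v y" using v_mult[of r x] v_mult[of r' y] 1 2 xy by simp
    moreover have "v s + v x = v s' + v y" using v_mult[of s x] v_mult[of s' y] 1 2 xy by simp
    ultimately have "(v r + v x) - (v s + v x) = (v r' + v y) - (v s' + v y)" by simp
    then show ?thesis using 1 2 by simp
  qed
  have val_mult: "val (t \<otimes>\<^bsub>Q\<^esub> u) (g + h)"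
    if gh: "val t g" "val u h" "t \<in> carrier Q" "u \<in> carrier Q" for t u g h
  proof -
    obtain r s where 1: "r \<in> nonzero" "s \<in> nonzero" "u \<otimes>\<^bsub>Q\<^esub> \<iota> s = \<iota> r" "h = v r - v s"
      using gh(2) unfolding val_def by blast
    obtain r' s' where 2: "r' \<in> nonzero" "s' \<in> nonzero" "t \<otimes>\<^bsub>Q\<^esub> \<iota> s' = \<iota> r'" "g = v r' - v s'"
      using gh(1) unfolding val_def by blast
    \<comment> \<open>The common multiple turns the numerator of \<open>u\<close> into a multiple of
      the denominator of \<open>t\<close>, so that the two fractions can be multiplied.\<close>
    obtain x y where xy: "x \<in> nonzero" "y \<in> nonzero" "r \<otimes> x = s' \<otimes> y"
      using right_ore 1 2 by blast
    have "t \<otimes>\<^bsub>Q\<^esub> u \<otimes>\<^bsub>Q\<^esub> \<iota> (s \<otimes> x) = t \<otimes>\<^bsub>Q\<^esub> ((u \<otimes>\<^bsub>Q\<^esub> \<iota> s) \<otimes>\<^bsub>Q\<^esub> \<iota> x)"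
      using 1(1,2) xy(1) gh(3,4) by (simp add: Q.m_assoc)
    also have "\<dots> = t \<otimes>\<^bsub>Q\<^esub> \<iota> (r \<otimes> x)" using 1 xy(1) by simp
    also have "\<dots> = t \<otimes>\<^bsub>Q\<^esub> \<iota> (s' \<otimes> y)" using xy(3) by simp
    also have "\<dots> = \<iota> (r' \<otimes> y)" using 2(1,2) xy(2) gh(3) by (simp add: 2(3)[symmetric] Q.m_assoc)
    finally have eq: "t \<otimes>\<^bsub>Q\<^esub> u \<otimes>\<^bsub>Q\<^esub> \<iota> (s \<otimes> x) = \<iota> (r' \<otimes> y)" .
    have "v r + v x = v s' + v y" using v_mult[of r x] v_mult[of s' y] 1 2 xy by simp
    then have "v s' = v r + v x - v y" by (simp add: algebra_simps)
    then have "g + h = v (r' \<otimes> y) - v (s \<otimes> x)"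
      using v_mult[of r' y] v_mult[of s x] 1(1,2) 2(1,2) xy(1,2)
      by (simp add: 1(4) 2(4))
    moreover have "r' \<otimes> y \<in> nonzero" "s \<otimes> x \<in> nonzero"
      using v_mult 1 2 xy by auto
    ultimately show ?thesis using eq unfolding val_def by blast
  qed
  have val_\<iota>: "val (\<iota> r) (v r)" if "r \<in> nonzero" for r
    unfolding val_def using that one_not_zero v_one
    by (intro bexI[of _ r] bexI[of _ \<one>]) auto
  have val_T: "g \<in> vals" if t: "t \<in> T" "t \<noteq> \<zero>\<^bsub>Q\<^esub>" and g: "val t g" for t g
  proof -
    have tQ: "t \<in> carrier Q - {\<zero>\<^bsub>Q\<^esub>}" using t T' by auto
    \<comment> \<open>\<open>h k\<close> is the \<open>k\<close>-fold sum of \<open>g\<close>, the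
      value of the \<open>k\<close>-th power of \<open>t\<close>.\<close>
    define h where "h = rec_nat (0::'g) (\<lambda>_ x. x + g)"
    have h: "h 0 = 0" "h (Suc k) = h k + g" for k by (simp_all add: h_def)
    have pow: "t [^]\<^bsub>Q\<^esub> k \<in> T \<and> t [^]\<^bsub>Q\<^esub> k \<in> carrier Q - {\<zero>\<^bsub>Q\<^esub>} \<and> val (t [^]\<^bsub>Q\<^esub> k) (h k)" for k :: nat
    proof (induction k)
      case 0
      have "val \<one>\<^bsub>Q\<^esub> 0" using val_\<iota>[of \<one>] one_not_zero v_one by simp
      then show ?case using T' one_neq h by simp
    next
      case (Suc k)
      then show ?case using T'(6) t tQ Qmult[of "t [^]\<^bsub>Q\<^esub> k" t] val_mult[of "t [^]\<^bsub>Q\<^esub> k" "h k" t g] g h by auto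
    qed
    have "v a + h k + v b \<in> vals" for k
    proof -
      obtain r where r: "r \<in> carrier R" "\<iota> a \<otimes>\<^bsub>Q\<^esub> t [^]\<^bsub>Q\<^esub> k \<otimes>\<^bsub>Q\<^esub> \<iota> b = \<iota> r"
        using ab[of "t [^]\<^bsub>Q\<^esub> k"] pow by blast
      have "val (\<iota> a \<otimes>\<^bsub>Q\<^esub> t [^]\<^bsub>Q\<^esub> k \<otimes>\<^bsub>Q\<^esub> \<iota> b) (v a + h k + v b)"
        using pow[of k] a b val_\<iota> by (intro val_mult) auto
      moreover have "\<iota> a \<otimes>\<^bsub>Q\<^esub> t [^]\<^bsub>Q\<^esub> k \<otimes>\<^bsub>Q\<^esub> \<iota> b \<noteq> \<zero>\<^bsub>Q\<^esub>"
      proof -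
        have "\<iota> a \<otimes>\<^bsub>Q\<^esub> t [^]\<^bsub>Q\<^esub> k \<noteq> \<zero>\<^bsub>Q\<^esub>" using Qmult[of "\<iota> a" "t [^]\<^bsub>Q\<^esub> k"] pow[of k] a \<iota>0[OF a] by auto
        then show ?thesis using Qmult[of "\<iota> a \<otimes>\<^bsub>Q\<^esub> t [^]\<^bsub>Q\<^esub> k" "\<iota> b"] pow[of k] a b \<iota>0[OF b] by auto
      qed
      then have r0: "r \<noteq> \<zero>" using r by auto
      ultimately have "v a + h k + v b = v r" using val_unique[of "\<iota> r"] val_\<iota>[of r] r by auto
      then show ?thesis using r r0 by blast
    qed
    then show ?thesis
      using v_integrally_closed[of "\<lambda>k. v a + h k + v b" g] h by (simp add: add_ac)
  qed
  have "\<forall>t\<in>T. t \<noteq> \<zero>\<^bsub>Q\<^esub> \<and> val t g \<longrightarrow> t \<in> \<iota> ` carrier R" for g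
  proof (induction g rule: wf_induct_rule[OF wf_values])
    case (1 g)
    show ?case
    proof (intro ballI impI; elim conjE)
      fix t assume t: "t \<in> T" "t \<noteq> \<zero>\<^bsub>Q\<^esub>" and g: "val t g"
      have tQ: "t \<in> carrier Q" using t T' by auto
      obtain p s where ps: "p \<in> nonzero" "s \<in> nonzero" "t \<otimes>\<^bsub>Q\<^esub> \<iota> s = \<iota> p" "g = v p - v s"
        using g unfolding val_def by blast
      obtain r where r: "r \<in> nonzero" "g = v r" using val_T[OF t g] by blast
      have rs: "r \<otimes> s \<in> nonzero" "v p = v (r \<otimes> s)"
        using v_mult[OF r(1) ps(2)] r ps by (auto simp: algebra_simps)
      obtain c where c: "c \<in> carrier R" "p \<ominus> c \<otimes> (r \<otimes> s) = \<zero> \<or> v (p \<ominus> c \<otimes> (r \<otimes> s)) < v p"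
        using v_cancel[OF ps(1) rs] by blast
      define t' where "t' = t \<ominus>\<^bsub>Q\<^esub> \<iota> (c \<otimes> r)"
      have crT: "\<iota> (c \<otimes> r) \<in> T" using T(2) c(1) r(1) by blast
      have t'T: "t' \<in> T" unfolding t'_def a_minus_def using t crT T'(5,7) by blast
      have "t' \<otimes>\<^bsub>Q\<^esub> \<iota> s = t \<otimes>\<^bsub>Q\<^esub> \<iota> s \<ominus>\<^bsub>Q\<^esub> \<iota> (c \<otimes> r) \<otimes>\<^bsub>Q\<^esub> \<iota> s"
        unfolding t'_def using tQ c r ps(2) by (simp add: a_minus_def Q.l_distr Q.l_minus)
      also have "\<dots> = \<iota> (p \<ominus> c \<otimes> (r \<otimes> s))"
        using c r ps by (simp add: a_minus_def Q.m_assoc)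
      finally have t's: "t' \<otimes>\<^bsub>Q\<^esub> \<iota> s = \<iota> (p \<ominus> c \<otimes> (r \<otimes> s))" .
      have d: "p \<ominus> c \<otimes> (r \<otimes> s) \<in> carrier R" using c r ps by auto
      have "t' \<in> \<iota> ` carrier R"
      proof (cases "t' = \<zero>\<^bsub>Q\<^esub>")
        case True
        then have "t' = \<iota> \<zero>" by simp
        then show ?thesis by blast
      next
        case False
        have t'Q: "t' \<in> carrier Q - {\<zero>\<^bsub>Q\<^esub>}" using False t'T T' by auto
        have "t' \<otimes>\<^bsub>Q\<^esub> \<iota> s \<noteq> \<zero>\<^bsub>Q\<^esub>" using Qmult[OF t'Q, of "\<iota> s"] ps \<iota>0[OF ps(2)] by auto
        then have d0: "p \<ominus> c \<otimes> (r \<otimes> s) \<noteq> \<zero>" using t's by auto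
        define g' where "g' = v (p \<ominus> c \<otimes> (r \<otimes> s)) - v s"
        have "val t' g'" unfolding val_def g'_def using d d0 ps(2) t's by blast
        moreover have "g' < g" using c(2) d0 ps(4) unfolding g'_def by simp
        \<comment> \<open>The induction runs over elements of \<open>vals\<close> only;
          \<open>val_T\<close> applies because \<open>t'\<close> belongs to \<open>T\<close> as
          well.\<close>
        moreover have "g' \<in> vals" using val_T[OF t'T False] calculation by blast
        moreover have "g \<in> vals" using r by blast
        ultimately show ?thesis using 1 t'T False by blast
      qed
      then obtain w where w: "w \<in> carrier R" "t' = \<iota> w" by blast
      have "t = t' \<oplus>\<^bsub>Q\<^esub> \<iota> (c \<otimes> r)"
        unfolding t'_def using tQ c r by (simp add: a_minus_def Q.a_assoc Q.l_neg)
      then have "t = \<iota> (w \<oplus> c \<otimes> r)" using w c r by simp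
      then show "t \<in> \<iota> ` carrier R" using w c r by blast
    qed
  qed
  then show ?thesis
  proof (intro subsetI)
    fix t assume t: "t \<in> T" and ih: "\<And>g. \<forall>t\<in>T. t \<noteq> \<zero>\<^bsub>Q\<^esub> \<and> val t g \<longrightarrow> t \<in> \<iota> ` carrier R"
    show "t \<in> \<iota> ` carrier R"
    proof (cases "t = \<zero>\<^bsub>Q\<^esub>")
      case True
      then have "t = \<iota> \<zero>" by simp
      then show ?thesis by blast
    next
      case False
      moreover have "t \<in> carrier Q" using t T'(1) by blast
      ultimately obtain g where "val t g" using val_ex[of t] by blast
      then show ?thesis using ih[of g] t False by blast
    qed
  qed
qed

theorem maximal_order:
  assumes "division_ring_of_fractions R Q \<iota>"
  shows "maximal_order R Q \<iota>"
  unfolding maximal_order_def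
proof (intro conjI allI impI)
  fix T
  assume "subring T Q \<and> \<iota> ` carrier R \<subseteq> T \<and> (\<exists>a\<in>nonzero. \<exists>b\<in>nonzero.
    \<forall>t\<in>T. \<iota> a \<otimes>\<^bsub>Q\<^esub> t \<otimes>\<^bsub>Q\<^esub> \<iota> b \<in> \<iota> ` carrier R)"
  then obtain a b where T: "subring T Q" "\<iota> ` carrier R \<subseteq> T" "a \<in> nonzero" "b \<in> nonzero"
    "\<forall>t\<in>T. \<iota> a \<otimes>\<^bsub>Q\<^esub> t \<otimes>\<^bsub>Q\<^esub> \<iota> b \<in> \<iota> ` carrier R" by blast
  show "T = \<iota> ` carrier R"
    using maximal_order_subring[OF assms T(1-4)] T(2,5) by (intro equalityI) auto
qed (fact assms nc_noetherian nc_domain)+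

theorem ex_division_ring_of_fractions:
  "\<exists>(Q :: ('a \<times> 'a) set ring) \<iota>. division_ring_of_fractions R Q \<iota>"
  using ore_domain.division_ring_of_fractions_Frac[OF ore_domain] by blast

end

section \<open>Quantum matrices over a ring\<close>

locale algebra = vector_space scale
  for scale :: "'k::field \<Rightarrow> 'r::ring_1 \<Rightarrow> 'r" (infixr "*s" 75) +
  assumes mult_scale_left: "(c *s x) * y = c *s (x * y)"
    and mult_scale_right: "x * (c *s y) = c *s (x * y)"
begin

lemmas scale_simps = mult_scale_left mult_scale_right scale_right_distrib scale_left_distrib
  scale_right_diff_distrib scale_left_diff_distrib

lemma q_commute_assoc: "a * b = c *s (b * a) \<Longrightarrow> a * (b * x) = c *s (b * (a * x))"
  by (metis mult.assoc mult_scale_left)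

lemma q_commute_sym: "\<lbrakk>a * b = c *s (b * a); c \<noteq> 0\<rbrakk> \<Longrightarrow> b * a = inverse c *s (a * b)"
  by simp

lemma q_commute_inverse:
  assumes "t * s = 1" "s * t = 1" "a * t = c *s (t * a)"
  shows "s * a = c *s (a * s)"
proof -
  have "s * a = s * (a * t) * s" using assms(1) by (simp add: mult.assoc)
  also have "\<dots> = c *s ((s * t) * a * s)" by (simp add: assms(3) scale_simps mult.assoc)
  finally show ?thesis using assms(2) by simp
qed

lemma q_commute_sum:
  assumes "\<And>a b. \<lbrakk>a \<in> A; b \<in> B\<rbrakk> \<Longrightarrow> f a * g b = c *s (g b * f a)"
  shows "sum f A * sum g B = c *s (sum g B * sum f A)"
proof -
  have "sum f A * sum g B = (\<Sum>a\<in>A. \<Sum>b\<in>B. c *s (g b * f a))"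
    using assms by (simp add: sum_product)
  also have "\<dots> = c *s (\<Sum>b\<in>B. \<Sum>a\<in>A. g b * f a)"
    by (subst sum.swap) (simp add: scale_sum_right)
  finally show ?thesis by (simp add: sum_product)
qed

end

locale quantum_matrix = algebra scale
  for scale :: "'k::field \<Rightarrow> 'r::ring_1 \<Rightarrow> 'r" (infixr "*s" 75) +
  fixes q :: 'k and m n :: nat and x :: "nat \<Rightarrow> nat \<Rightarrow> 'r"
  assumes q_nonzero: "q \<noteq> 0"
    and row: "\<lbrakk>1 \<le> i; i \<le> m; 1 \<le> j; j < l; l \<le> n\<rbrakk> \<Longrightarrow> x i j * x i l = q *s (x i l * x i j)"
    and col: "\<lbrakk>1 \<le> i; i < k; k \<le> m; 1 \<le> j; j \<le> n\<rbrakk> \<Longrightarrow> x i j * x k j = q *s (x k j * x i j)"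
    and anti: "\<lbrakk>1 \<le> i; i < k; k \<le> m; 1 \<le> j; j < l; l \<le> n\<rbrakk> \<Longrightarrow> x i l * x k j = x k j * x i l"
    and diag: "\<lbrakk>1 \<le> i; i < k; k \<le> m; 1 \<le> j; j < l; l \<le> n\<rbrakk>
      \<Longrightarrow> x i j * x k l = x k l * x i j + (q - inverse q) *s (x i l * x k j)"

text \<open>
  A row \<open>t\<close> is added to a quantum matrix \<open>z\<close> by reversing Cauchon's deleting derivations algorithm.
\<close>

locale row_extension = quantum_matrix scale q m n z
  for scale :: "'k::field \<Rightarrow> 'r::ring_1 \<Rightarrow> 'r" (infixr "*s" 75) and q m n z +
  fixes t s :: "nat \<Rightarrow> 'r"
  assumes t_inv: "t j * s j = 1" "s j * t j = 1"
    and tt: "\<lbrakk>1 \<le> j; j < l; l \<le> n\<rbrakk> \<Longrightarrow> t j * t l = q *s (t l * t j)"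
    and zt: "\<lbrakk>1 \<le> i; i \<le> m; 1 \<le> j; j \<le> n; 1 \<le> l; l \<le> n\<rbrakk>
      \<Longrightarrow> z i j * t l = (if j = l then q else 1) *s (t l * z i j)"
begin

abbreviation (input) p where "p \<equiv> inverse q"

text \<open>Unfolded, \<open>x i j\<close> for an old row is \<open>z i j\<close> plus all
  \<open>z i l * s l * t j\<close> with \<open>l > j\<close>: the inverses of all deletion steps
  along the new row at once. The tail sums \<open>w\<close> are singled out because they have
  uniform commutation factors, which the single summands lack.\<close>

definition y where "y i l = z i l * s l"
definition w where "w i j = (\<Sum>l\<in>{j..n}. y i l)"
definition x where "x i j = (if i = Suc m then t j else w i j * t j)"

lemma st1: "\<lbrakk>1 \<le> k; k < l; l \<le> n\<rbrakk> \<Longrightarrow> s l * t k = q *s (t k * s l)"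
  by (rule q_commute_inverse[OF t_inv]) (rule tt)

lemma st2: "\<lbrakk>1 \<le> l; l < k; k \<le> n\<rbrakk> \<Longrightarrow> s l * t k = p *s (t k * s l)"
  using q_nonzero by (intro q_commute_inverse[OF t_inv] q_commute_sym tt)

lemma ss: "\<lbrakk>1 \<le> j; j < l; l \<le> n\<rbrakk> \<Longrightarrow> s j * s l = q *s (s l * s j)"
  by (rule q_commute_inverse[OF t_inv]) (rule st1)

lemma sz: "\<lbrakk>1 \<le> i; i \<le> m; 1 \<le> j; j \<le> n; 1 \<le> l; l \<le> n\<rbrakk>
    \<Longrightarrow> s l * z i j = (if j = l then q else 1) *s (z i j * s l)"
  by (rule q_commute_inverse[OF t_inv]) (rule zt)

text \<open>The factor depends only on whether \<open>k \<le> l\<close>. Hence a tail sum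
  \<open>w i j\<close> has one common factor against \<open>t k\<close> for
  \<open>k \<le> j\<close>, and a sum over columns before \<open>l\<close> has the inverse factor
  against \<open>t l\<close>.\<close>

lemma yt:
  assumes "1 \<le> i" "i \<le> m" "1 \<le> l" "l \<le> n" "1 \<le> k" "k \<le> n"
  shows "y i l * t k = (if k \<le> l then q else p) *s (t k * y i l)"
proof -
  have tz: "t k * z i l = inverse (if l = k then q else 1) *s (z i l * t k)"
    using q_nonzero assms by (intro q_commute_sym zt) auto
  note tz' = q_commute_assoc[OF tz]
  consider "k < l" | "k = l" | "l < k" by linarith
  then show ?thesis
  proof cases
    case 1
    then show ?thesis using st1[of k l] tz' assms by (simp add: y_def mult.assoc scale_simps)
  next
    case 2
    then show ?thesis using tz' t_inv q_nonzero by (simp add: y_def mult.assoc scale_simps)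
  next
    case 3
    then show ?thesis using st2[of l k] tz' assms by (simp add: y_def mult.assoc scale_simps)
  qed
qed

lemma y_row:
  assumes "1 \<le> i" "i \<le> m" "1 \<le> j" "j < l" "l \<le> n"
  shows "y i j * y i l = (q * q) *s (y i l * y i j)"
proof -
  note r1 = row[OF assms] and r2 = ss[OF assms(3-5)]
  have r3: "s j * z i l = 1 *s (z i l * s j)" "s l * z i j = 1 *s (z i j * s l)"
    using sz[of i l j] sz[of i j l] assms by auto
  show ?thesis
    by (simp add: y_def mult.assoc scale_simps r2 q_commute_assoc[OF r1] q_commute_assoc[OF r3(1)]
        q_commute_assoc[OF r3(2)])
qed

lemma y_col:
  assumes "1 \<le> i" "i < k" "k \<le> m" "1 \<le> j" "j \<le> n"
  shows "y i j * y k j = q *s (y k j * y i j)"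
proof -
  note r1 = col[OF assms]
  have r3: "s j * z i j = q *s (z i j * s j)" "s j * z k j = q *s (z k j * s j)"
    using sz[of i j j] sz[of k j j] assms by auto
  show ?thesis
    by (simp add: y_def mult.assoc scale_simps q_commute_assoc[OF r1] q_commute_assoc[OF r3(1)]
        q_commute_assoc[OF r3(2)])
qed

lemma y_anti:
  assumes "1 \<le> i" "i < k" "k \<le> m" "1 \<le> j" "j < l" "l \<le> n"
  shows "y k j * y i l = q *s (y i l * y k j)"
proof -
  have r1: "z k j * z i l = 1 *s (z i l * z k j)" using anti[OF assms] by simp
  note r2 = ss[OF assms(4-6)]
  have r3: "s j * z i l = 1 *s (z i l * s j)" "s l * z k j = 1 *s (z k j * s l)"
    using sz[of i l j] sz[of k j l] assms by auto
  show ?thesis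
    by (simp add: y_def mult.assoc scale_simps r2 q_commute_assoc[OF r1] q_commute_assoc[OF r3(1)]
        q_commute_assoc[OF r3(2)])
qed

text \<open>Exchanging \<open>s j\<close> and \<open>s l\<close> costs \<open>q\<close>, which turns
  the coefficient \<open>q - inverse q\<close> of the quantum matrix relation into
  \<open>q * q - 1\<close>.\<close>

lemma y_diag:
  assumes "1 \<le> i" "i < k" "k \<le> m" "1 \<le> j" "j < l" "l \<le> n"
  shows "y i j * y k l = q *s (y k l * y i j) + (q * q - 1) *s (y i l * y k j)"
proof -
  note r2 = ss[OF assms(4-6)]
  have r1: "z i j * (z k l * u) = z k l * (z i j * u) + (q - p) *s (z i l * (z k j * u))" for u
    using arg_cong[OF diag[OF assms], of "\<lambda>v. v * u"] by (simp add: algebra_simps scale_simps)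
  have r3: "s j * z k l = 1 *s (z k l * s j)" "s l * z i j = 1 *s (z i j * s l)"
     "s l * z k j = 1 *s (z k j * s l)"
    using sz[of k l j] sz[of i j l] sz[of k j l] assms by auto
  show ?thesis
    using q_nonzero
    by (simp add: y_def mult.assoc scale_simps r1 r2 q_commute_assoc[OF r3(1)]
        q_commute_assoc[OF r3(2)] q_commute_assoc[OF r3(3)] right_diff_distrib left_diff_distrib)
qed

lemma w_split: "j < l \<Longrightarrow> l \<le> n \<Longrightarrow> w i j = (\<Sum>a\<in>{j..<l}. y i a) + w i l"
  unfolding w_def by (subst sum.union_disjoint[symmetric]) (auto intro!: sum.cong)

lemma w_t:
  assumes "1 \<le> i" "i \<le> m" "1 \<le> k" "k \<le> j" "j \<le> n"
  shows "w i j * t k = q *s (t k * w i j)"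
proof -
  have "w i j * sum t {k} = q *s (sum t {k} * w i j)"
    unfolding w_def using assms by (intro q_commute_sum) (auto simp: yt)
  then show ?thesis by simp
qed

lemma t_w: "\<lbrakk>1 \<le> i; i \<le> m; 1 \<le> k; k \<le> j; j \<le> n\<rbrakk> \<Longrightarrow> t k * w i j = p *s (w i j * t k)"
  using q_nonzero by (intro q_commute_sym w_t)

lemma t_v:
  assumes "1 \<le> i" "i \<le> m" "1 \<le> j" "l \<le> n"
  shows "t l * (\<Sum>a\<in>{j..<l}. y i a) = q *s ((\<Sum>a\<in>{j..<l}. y i a) * t l)"
proof -
  have "(\<Sum>a\<in>{j..<l}. y i a) * sum t {l} = p *s (sum t {l} * (\<Sum>a\<in>{j..<l}. y i a))"
    using assms by (intro q_commute_sum) (auto simp: yt)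
  then show ?thesis using q_nonzero by simp
qed

lemma v_w_diag:
  assumes "1 \<le> i" "i < k" "k \<le> m"
    and AB: "A \<subseteq> {1..n}" "B \<subseteq> {1..n}" "\<And>a b. \<lbrakk>a \<in> A; b \<in> B\<rbrakk> \<Longrightarrow> a < b"
  shows "(\<Sum>a\<in>A. y i a) * (\<Sum>b\<in>B. y k b) =
    q *s ((\<Sum>b\<in>B. y k b) * (\<Sum>a\<in>A. y i a)) + (q * q - 1) *s ((\<Sum>b\<in>B. y i b) * (\<Sum>a\<in>A. y k a))"
proof -
  have "(\<Sum>a\<in>A. y i a) * (\<Sum>b\<in>B. y k b) =
      (\<Sum>a\<in>A. \<Sum>b\<in>B. q *s (y k b * y i a) + (q * q - 1) *s (y i b * y k a))"
    unfolding sum_product using assms by (intro sum.cong refl y_diag) auto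
  also have "\<dots> = q *s (\<Sum>b\<in>B. \<Sum>a\<in>A. y k b * y i a) + (q * q - 1) *s (\<Sum>b\<in>B. \<Sum>a\<in>A. y i b * y k a)"
    unfolding sum.distrib by (subst (1 2) sum.swap) (simp add: scale_sum_right)
  finally show ?thesis by (simp add: sum_product)
qed

lemma w_w_anti:
  assumes "1 \<le> i" "i < k" "k \<le> m"
    and AB: "A \<subseteq> {1..n}" "B \<subseteq> {1..n}" "\<And>a b. \<lbrakk>a \<in> A; b \<in> B\<rbrakk> \<Longrightarrow> a < b"
  shows "(\<Sum>a\<in>A. y k a) * (\<Sum>b\<in>B. y i b) = q *s ((\<Sum>b\<in>B. y i b) * (\<Sum>a\<in>A. y k a))"
  using assms by (intro q_commute_sum y_anti) auto

text \<open>A new least index \<open>b\<close> adds the mixed terms \<open>y i b * T\<close> and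
  \<open>S * y k b\<close>. The correction \<open>q * q - 1\<close> arising from the first raises
  the coefficient of the second to \<open>q * q\<close>, and one factor \<open>q\<close> is absorbed
  on moving \<open>y k b\<close> in front of \<open>S\<close>.\<close>

lemma sum_y_col:
  assumes i: "1 \<le> i" "i < k" "k \<le> m" and "finite B" and B: "B \<subseteq> {1..n}"
  shows "(\<Sum>b\<in>B. y i b) * (\<Sum>b\<in>B. y k b) = q *s ((\<Sum>b\<in>B. y k b) * (\<Sum>b\<in>B. y i b))"
  using \<open>finite B\<close> B
proof (induction B rule: finite_linorder_min_induct)
  case (insert b A)
  have lt: "a < a'" if "a \<in> {b}" "a' \<in> A" for a a' using insert that by auto
  define S T where "S = (\<Sum>a\<in>A. y i a)" and "T = (\<Sum>a\<in>A. y k a)"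
  have 1: "y i b * T = q *s (T * y i b) + (q * q - 1) *s (S * y k b)"
    using v_w_diag[OF i, of "{b}" A] lt insert.prems by (simp add: S_def T_def)
  have 2: "y k b * S = q *s (S * y k b)"
    using w_w_anti[OF i, of "{b}" A] lt insert.prems by (simp add: S_def T_def)
  have 3: "y i b * y k b = q *s (y k b * y i b)" using i insert.prems by (intro y_col) auto
  have 4: "S * T = q *s (T * S)" using insert unfolding S_def T_def by auto
  have "b \<notin> A" using insert by auto
  then have eq: "sum (y i) (insert b A) = y i b + S" "sum (y k) (insert b A) = y k b + T"
    using insert.hyps by (simp_all add: S_def T_def)
  show ?case
    unfolding eq by (simp add: algebra_simps scale_simps 1 2 3 4)
qed simp

lemma y_w_row:
  assumes "1 \<le> i" "i \<le> m" and AB: "A \<subseteq> {1..n}" "B \<subseteq> {1..n}" "\<And>a b. \<lbrakk>a \<in> A; b \<in> B\<rbrakk> \<Longrightarrow> a < b"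
  shows "(\<Sum>a\<in>A. y i a) * (\<Sum>b\<in>B. y i b) = (q * q) *s ((\<Sum>b\<in>B. y i b) * (\<Sum>a\<in>A. y i a))"
  using assms by (intro q_commute_sum y_row) auto

text \<open>Splitting the tail sums at column \<open>l\<close> leaves blocks \<open>V\<close>,
  \<open>U\<close>, \<open>w i l\<close>, \<open>w k l\<close> whose commutation rules with one
  another and with \<open>t j\<close>, \<open>t l\<close> are known; each relation is checked by
  bringing both sides into the same order of factors. The new row, an old row against it, and two
  old rows are the separate cases.\<close>

lemma quantum_matrix_x: "quantum_matrix scale q (Suc m) n x"
proof
  show "q \<noteq> 0" by (rule q_nonzero)
next
  fix i j l assume h: "1 \<le> i" "i \<le> Suc m" "1 \<le> j" "j < l" "l \<le> n"
  show "x i j * x i l = q *s (x i l * x i j)"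
  proof (cases "i = Suc m")
    case True
    then show ?thesis using tt h by (simp add: x_def)
  next
    case False
    then have i: "i \<le> m" using h by simp
    define V where "V = (\<Sum>a\<in>{j..<l}. y i a)"
    have w: "w i j = V + w i l" using w_split h by (simp add: V_def)
    have 1: "t j * w i l = p *s (w i l * t j)" "t l * w i l = p *s (w i l * t l)"
      using t_w h i by auto
    have 2: "t l * V = q *s (V * t l)" using t_v h i by (simp add: V_def)
    have 3: "V * w i l = (q * q) *s (w i l * V)"
      unfolding V_def w_def using h i by (intro y_w_row) auto
    have 4: "t j * t l = q *s (t l * t j)" using tt h by simp
    show ?thesis
      using False q_nonzero
      by (simp add: x_def w ring_distribs mult.assoc scale_simps 4 q_commute_assoc[OF 1(1)]
          q_commute_assoc[OF 1(2)] q_commute_assoc[OF 2] q_commute_assoc[OF 3])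
  qed
next
  fix i k j assume h: "1 \<le> i" "i < k" "k \<le> Suc m" "1 \<le> j" "j \<le> n"
  have 1: "w i j * t j = q *s (t j * w i j)" using w_t h by simp
  show "x i j * x k j = q *s (x k j * x i j)"
  proof (cases "k = Suc m")
    case True
    then show ?thesis using h by (simp add: x_def mult.assoc scale_simps 1 q_commute_assoc[OF 1])
  next
    case False
    then have k: "k \<le> m" using h by simp
    have 2: "t j * w i j = p *s (w i j * t j)" "t j * w k j = p *s (w k j * t j)"
      using t_w h k by auto
    have 3: "w i j * w k j = q *s (w k j * w i j)"
      unfolding w_def using h k by (intro sum_y_col) auto
    show ?thesis using False h q_nonzero
      by (simp add: x_def mult.assoc scale_simps q_commute_assoc[OF 2(1)] q_commute_assoc[OF 2(2)]
          q_commute_assoc[OF 3])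
  qed
next
  fix i k j l assume h: "1 \<le> i" "i < k" "k \<le> Suc m" "1 \<le> j" "j < l" "l \<le> n"
  define V U where "V = (\<Sum>a\<in>{j..<l}. y i a)" and "U = (\<Sum>a\<in>{j..<l}. y k a)"
  have w: "w i j = V + w i l" "w k j = U + w k l" using w_split h by (simp_all add: V_def U_def)
  have 1: "t j * w i l = p *s (w i l * t j)" "t l * w i l = p *s (w i l * t l)"
    using t_w h by auto
  have 2: "t l * V = q *s (V * t l)" using t_v h by (simp add: V_def)
  have 4: "t j * t l = q *s (t l * t j)" using tt h by simp
  show "x i l * x k j = x k j * x i l"
  proof (cases "k = Suc m")
    case True
    then show ?thesis using h q_nonzero
      by (simp add: x_def mult.assoc scale_simps q_commute_assoc[OF 1(1)] 4)
  next
    case False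
    then have k: "k \<le> m" using h by simp
    have 5: "t l * w k l = p *s (w k l * t l)" "t j * w k l = p *s (w k l * t j)" using t_w h k by auto
    have 6: "t l * U = q *s (U * t l)" using t_v h k by (simp add: U_def)
    have 7: "U * w i l = q *s (w i l * U)"
      unfolding U_def w_def using h k by (intro w_w_anti) auto
    have "w i l * w k l = q *s (w k l * w i l)"
      unfolding w_def using h k by (intro sum_y_col) auto
    then have 8: "w k l * w i l = p *s (w i l * w k l)" using q_nonzero by (intro q_commute_sym)
    show ?thesis using False h q_nonzero
      by (simp add: x_def w ring_distribs mult.assoc scale_simps q_commute_assoc[OF 1(1)]
          q_commute_assoc[OF 1(2)] q_commute_assoc[OF 5(1)] q_commute_assoc[OF 6] q_commute_assoc[OF 7]
          q_commute_assoc[OF 8] 4)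
  qed
  show "x i j * x k l = x k l * x i j + (q - inverse q) *s (x i l * x k j)"
  proof (cases "k = Suc m")
    case True
    then show ?thesis using h q_nonzero
      by (simp add: x_def w ring_distribs mult.assoc scale_simps q_commute_assoc[OF 1(2)]
          q_commute_assoc[OF 2] 4)
  next
    case False
    then have k: "k \<le> m" using h by simp
    have 5: "t l * w k l = p *s (w k l * t l)" "t j * w k l = p *s (w k l * t j)" using t_w h k by auto
    have 6: "t l * U = q *s (U * t l)" using t_v h k by (simp add: U_def)
    have 7: "V * (w k l * u) = q *s (w k l * (V * u)) + (q * q - 1) *s (w i l * (U * u))" for u
    proof -
      have "V * w k l = q *s (w k l * V) + (q * q - 1) *s (w i l * U)"
        unfolding U_def V_def w_def using h k by (intro v_w_diag) auto
      from arg_cong[OF this, of "\<lambda>v. v * u"] show ?thesis by (simp add: ring_distribs mult.assoc scale_simps)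
    qed
    have "w i l * w k l = q *s (w k l * w i l)"
      unfolding w_def using h k by (intro sum_y_col) auto
    then have 8: "w k l * w i l = p *s (w i l * w k l)" using q_nonzero by (intro q_commute_sym)
    show ?thesis using False h q_nonzero
      by (simp add: x_def w ring_distribs mult.assoc scale_simps q_commute_assoc[OF 1(1)]
          q_commute_assoc[OF 1(2)] q_commute_assoc[OF 2] q_commute_assoc[OF 5(1)] q_commute_assoc[OF 5(2)]
          q_commute_assoc[OF 6] 7 q_commute_assoc[OF 8] 4)
  qed
qed

end

abbreviation (input) "lookup \<equiv> Poly_Mapping.lookup"
abbreviation (input) "keys \<equiv> Poly_Mapping.keys"
abbreviation (input) "single \<equiv> Poly_Mapping.single"

section \<open>Leading exponents of linear operators\<close>

text \<open>Linear operators on functions of exponents. The torus generators will be weighted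
  shifts, so associativity comes for free from composition and no twisted product has to be
  defined.\<close>

typedef (overloaded) ('e, 'k) endo =
  "{L :: ('e \<Rightarrow> 'k::field) \<Rightarrow> 'e \<Rightarrow> 'k. (\<forall>u v. L (\<lambda>b. u b + v b) = (\<lambda>b. L u b + L v b)) \<and>
    (\<forall>c v. L (\<lambda>b. c * v b) = (\<lambda>b. c * L v b))}"
  morphisms app Endo
  by (rule exI[of _ "\<lambda>v. v"]) simp

lemma endo_eqI: "(\<And>v b. app L v b = app M v b) \<Longrightarrow> L = M"
  by (rule app_inject[THEN iffD1]) (intro ext)

lemma app_add: "app L (\<lambda>b. u b + v b) = (\<lambda>b. app L u b + app L v b)"
  and app_scale: "app L (\<lambda>b. c * v b) = (\<lambda>b. c * app L v b)"
  using app[of L] by auto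

instantiation endo :: (type, field) ring_1
begin

definition "0 = Endo (\<lambda>v b. 0)"
definition "1 = Endo (\<lambda>v. v)"
definition "L + M = Endo (\<lambda>v b. app L v b + app M v b)"
definition "L - M = Endo (\<lambda>v b. app L v b - app M v b)"
definition "- L = Endo (\<lambda>v b. - app L v b)"
definition "L * M = Endo (\<lambda>v. app L (app M v))"

lemma app_simps [simp]:
  "app 0 v b = 0" "app 1 v b = v b" "app (L + M) v b = app L v b + app M v b"
  "app (L - M) v b = app L v b - app M v b" "app (- L) v b = - app L v b"
  "app (L * M) v = app L (app M v)"
  by (simp_all add: zero_endo_def one_endo_def plus_endo_def minus_endo_def uminus_endo_def
      times_endo_def Endo_inverse app_add app_scale algebra_simps)

instance
proof
  show "(0::('a, 'b) endo) \<noteq> 1"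
  proof
    assume "(0::('a, 'b) endo) = 1"
    then have "app (0::('a, 'b) endo) (\<lambda>_. 1) undefined = app 1 (\<lambda>_. 1) undefined" by simp
    then show False by (simp del: app_simps add: app_simps(1,2))
  qed
  have lin: "app L (app (M + N) v) b = app L (app M v) b + app L (app N v) b" for L M N :: "('a, 'b) endo" and v b
    using app_add[of L "app M v" "app N v"] by (simp add: fun_eq_iff[symmetric] app_simps(3)[abs_def])
  have ext: "app (M + N) v = (\<lambda>b. app M v b + app N v b)" for M N :: "('a, 'b) endo" and v by auto
  fix L M N :: "('a, 'b) endo"
  show "L * (M + N) = L * M + L * N"
    by (rule endo_eqI) (simp add: ext app_add)
  show "1 * L = L" "L * 1 = L" by (rule endo_eqI, simp add: one_endo_def Endo_inverse)+
qed (rule endo_eqI, simp add: algebra_simps)+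

end

definition escale :: "'k::field \<Rightarrow> ('e, 'k) endo \<Rightarrow> ('e, 'k) endo"
  where "escale c L = Endo (\<lambda>v b. c * app L v b)"

lemma app_escale [simp]: "app (escale c L) v b = c * app L v b"
  by (simp add: escale_def Endo_inverse app_add app_scale algebra_simps)

lemma app_escale_fun: "app (escale c L) v = (\<lambda>b. c * app L v b)"
  by auto

interpretation E: algebra escale
  by unfold_locales (rule endo_eqI, simp add: algebra_simps app_escale_fun app_scale)+

definition supp_le :: "'e::linordered_ab_group_add \<Rightarrow> ('e \<Rightarrow> 'k::zero) \<Rightarrow> bool"
  where "supp_le b v \<longleftrightarrow> (\<forall>b'>b. v b' = 0)"

text \<open>A leading term seen through the action: the highest position \<open>b\<close> moves to
  \<open>b + s\<close>, its coefficient being multiplied by \<open>c b \<noteq> 0\<close>. The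
  factor must be allowed to vary with \<open>b\<close>, since the shifts carry powers of
  \<open>q\<close> as weights. An arbitrary nonzero operator need not have such an
  \<open>s\<close>.\<close>

definition lead :: "('e::linordered_ab_group_add, 'k::field) endo \<Rightarrow> 'e \<Rightarrow> bool"
  where "lead L s \<longleftrightarrow> (\<exists>c. \<forall>b. c b \<noteq> 0 \<and>
    (\<forall>v. supp_le b v \<longrightarrow> supp_le (b + s) (app L v) \<and> app L v (b + s) = c b * v b))"

definition low :: "('e::linordered_ab_group_add, 'k::field) endo \<Rightarrow> 'e \<Rightarrow> bool"
  where "low L s \<longleftrightarrow> (\<forall>b v. supp_le b v \<longrightarrow> (\<forall>b'\<ge>b + s. app L v b' = 0))"

lemma lead_mult:
  assumes "lead L s" "lead M t" shows "lead (L * M) (s + t)"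
proof -
  obtain c where c: "\<And>b. c b \<noteq> 0"
    "\<And>b v. supp_le b v \<Longrightarrow> supp_le (b + s) (app L v) \<and> app L v (b + s) = c b * v b"
    using assms(1) unfolding lead_def by metis
  obtain d where d: "\<And>b. d b \<noteq> 0"
    "\<And>b v. supp_le b v \<Longrightarrow> supp_le (b + t) (app M v) \<and> app M v (b + t) = d b * v b"
    using assms(2) unfolding lead_def by metis
  have "supp_le (b + (s + t)) (app (L * M) v) \<and> app (L * M) v (b + (s + t)) = (c (b + t) * d b) * v b"
    if "supp_le b v" for b v
    using c(2)[of "b + t" "app M v"] d(2)[OF that] by (simp add: ac_simps)
  then show ?thesis unfolding lead_def using c(1) d(1) by (intro exI[of _ "\<lambda>b. c (b + t) * d b"]) auto
qed

lemma lead_one: "lead 1 0"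
proof -
  have "app 1 v = v" for v :: "'a \<Rightarrow> 'b" by auto
  then show ?thesis unfolding lead_def by (intro exI[of _ "\<lambda>_. 1"]) simp
qed

lemma lead_scale: "\<lbrakk>lead L s; c \<noteq> 0\<rbrakk> \<Longrightarrow> lead (escale c L) s"
proof -
  assume "lead L s" "c \<noteq> 0"
  then obtain d where d: "\<And>b. d b \<noteq> 0"
    "\<And>b v. supp_le b v \<Longrightarrow> supp_le (b + s) (app L v) \<and> app L v (b + s) = d b * v b"
    unfolding lead_def by metis
  show ?thesis unfolding lead_def
    using d \<open>c \<noteq> 0\<close> by (intro exI[of _ "\<lambda>b. c * d b"]) (auto simp: supp_le_def)
qed

lemma lead_add_low:
  assumes "lead L s" "low M s" shows "lead (L + M) s"
proof -
  obtain d where d: "\<And>b. d b \<noteq> 0"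
    "\<And>b v. supp_le b v \<Longrightarrow> supp_le (b + s) (app L v) \<and> app L v (b + s) = d b * v b"
    using assms unfolding lead_def by metis
  have m: "app M v b' = 0" if "supp_le b v" "b + s \<le> b'" for b v b'
    using assms(2) that unfolding low_def by blast
  have "supp_le (b + s) (app (L + M) v) \<and> app (L + M) v (b + s) = d b * v b" if "supp_le b v" for b v
    using d(2)[OF that] m[OF that] by (auto simp: supp_le_def)
  then show ?thesis unfolding lead_def using d(1) by metis
qed

lemma low_zero: "low 0 s" by (simp add: low_def)

lemma low_add: "\<lbrakk>low L s; low M s\<rbrakk> \<Longrightarrow> low (L + M) s" by (simp add: low_def)

lemma low_scale: "low L s \<Longrightarrow> low (escale c L) s" by (simp add: low_def)

lemma low_sum: "(\<And>a. a \<in> A \<Longrightarrow> low (f a) s) \<Longrightarrow> low (sum f A) s"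
  by (induction A rule: infinite_finite_induct) (auto intro: low_zero low_add)

lemma lead_imp_low: "\<lbrakk>lead L s; s < t\<rbrakk> \<Longrightarrow> low L t"
proof -
  assume L: "lead L s" and "s < t"
  have "app L v b' = 0" if v: "supp_le b v" and b': "b + t \<le> b'" for b v b'
  proof -
    have "b + s < b'" using \<open>s < t\<close> b' by (meson add_strict_left_mono less_le_trans)
    then show ?thesis using L v unfolding lead_def supp_le_def by blast
  qed
  then show ?thesis unfolding low_def by blast
qed

abbreviation delta :: "'e::linordered_ab_group_add \<Rightarrow> 'k::zero_neq_one" where "delta \<equiv> (\<lambda>b. if b = 0 then 1 else 0)"

text \<open>The unit vector at position 0 is a test vector: the highest position of its image is the
  leading exponent, which is therefore unique.\<close>

lemma lead_delta:
  assumes "lead L s" shows "supp_le s (app L delta)" "app L delta s \<noteq> 0"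
proof -
  obtain d where d: "\<And>b. d b \<noteq> 0"
    "\<And>b v. supp_le b v \<Longrightarrow> supp_le (b + s) (app L v) \<and> app L v (b + s) = d b * v b"
    using assms unfolding lead_def by metis
  have "supp_le 0 (delta :: 'a \<Rightarrow> 'b)" by (simp add: supp_le_def)
  from d(2)[OF this] d(1) show "supp_le s (app L delta)" "app L delta s \<noteq> 0" by simp_all
qed

lemma lead_unique: "\<lbrakk>lead L s; lead L t\<rbrakk> \<Longrightarrow> s = t"
  using lead_delta[of L s] lead_delta[of L t] by (metis supp_le_def linorder_neqE)

lemma lead_nonzero: "lead L s \<Longrightarrow> L \<noteq> 0"
  using lead_delta by force

text \<open>The scalar is the quotient of the top coefficients on the test vector
  \<open>delta\<close>. Since factors vary with the position, nothing is claimed about the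
  difference having a leading exponent; only its size is bounded if it has one.\<close>

lemma lead_cancel:
  assumes "lead L s" "lead M s"
  obtains c where "\<And>t. lead (L - escale c M) t \<Longrightarrow> t < s"
proof -
  define c where "c = app L delta s / app M delta s"
  show ?thesis
  proof (rule that[of c])
    fix t assume t: "lead (L - escale c M) t"
    have s: "app (L - escale c M) delta s = 0" using lead_delta(2)[OF assms(2)] by (simp add: c_def)
    have "app (L - escale c M) delta b = 0" if "b > s" for b
      using that lead_delta(1)[OF assms(1)] lead_delta(1)[OF assms(2)] by (simp add: supp_le_def)
    then show "t < s" using lead_delta(2)[OF t] s by (metis linorder_neqE)
  qed
qed

text \<open>By injectivity the largest exponent occurs once, and all other summands are
  \<open>low\<close> with respect to it.\<close>

lemma lead_sum:
  assumes "finite A" "A \<noteq> {}" and A: "\<And>a. a \<in> A \<Longrightarrow> lead (f a) (g a) \<and> c a \<noteq> 0" and "inj_on g A"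
  shows "\<exists>a\<in>A. lead (\<Sum>a\<in>A. escale (c a) (f a)) (g a)"
proof -
  have "Max (g ` A) \<in> g ` A" using assms by (intro Max_in) auto
  then obtain a where a: "a \<in> A" "g a = Max (g ` A)" by auto
  have "g b < g a" if "b \<in> A - {a}" for b
    using that a assms Max_ge[of "g ` A" "g b"] by (auto simp: less_le inj_on_def)
  then have "low (\<Sum>b\<in>A - {a}. escale (c b) (f b)) (g a)"
    using A by (intro low_sum low_scale) (blast intro: lead_imp_low)
  then have "lead (escale (c a) (f a) + (\<Sum>b\<in>A - {a}. escale (c b) (f b))) (g a)"
    using A[OF a(1)] by (intro lead_add_low lead_scale) blast+
  then show ?thesis using a(1) sum.remove[OF assms(1) a(1), of "\<lambda>a. escale (c a) (f a)"] by metis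
qed

section \<open>Quantum matrices inside a quantum torus\<close>

type_synonym exponent = "(nat \<times> nat) \<Rightarrow>\<^sub>0 int"

abbreviation unit_exp :: "nat \<Rightarrow> nat \<Rightarrow> exponent" where "unit_exp i j \<equiv> single (i, j) 1"

text \<open>The first key at which two exponents differ decides, keys being ordered by row and then
  by column.\<close>

lemma exponent_lessI:
  fixes f g :: exponent
  assumes "lookup f k < lookup g k" "\<And>k'. k' < k \<Longrightarrow> lookup f k' = lookup g k'"
  shows "f < g"
  using assms unfolding less_poly_mapping.rep_eq less_fun_def by blast

locale quantum_torus =
  fixes q :: "'k::field" and m n :: nat
  assumes q_nonzero: "q \<noteq> 0"
begin

text \<open>The power of \<open>q\<close> arising when the generator at \<open>(i, j)\<close> passes
  a monomial of exponent \<open>b\<close>: one factor for each later entry of its row and each later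
  entry of its column.\<close>

definition twist :: "nat \<Rightarrow> nat \<Rightarrow> exponent \<Rightarrow> int"
  where "twist i j b = (\<Sum>l\<in>{j<..n}. lookup b (i, l)) + (\<Sum>k\<in>{i<..m}. lookup b (k, j))"

lemma twist_add: "twist i j (a + b) = twist i j a + twist i j b"
  by (simp add: twist_def lookup_add sum.distrib)

lemma twist_diff: "twist i j (a - b) = twist i j a - twist i j b"
  by (simp add: twist_def lookup_minus sum_subtractf)

lemma twist_unit: "twist i j (unit_exp k l) =
    (if i = k \<and> j < l \<and> l \<le> n then 1 else 0) + (if j = l \<and> i < k \<and> k \<le> m then 1 else 0)"
proof -
  have "(\<Sum>l'\<in>{j<..n}. lookup (unit_exp k l) (i, l')) = (if i = k \<and> j < l \<and> l \<le> n then 1 else 0)"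
    by (cases "i = k") (auto simp: lookup_single when_def)
  moreover have "(\<Sum>k'\<in>{i<..m}. lookup (unit_exp k l) (k', j)) = (if j = l \<and> i < k \<and> k \<le> m then 1 else 0)"
    by (cases "j = l") (auto simp: lookup_single when_def)
  ultimately show ?thesis by (simp add: twist_def)
qed

definition T :: "nat \<Rightarrow> nat \<Rightarrow> (exponent, 'k) endo"
  where "T i j = Endo (\<lambda>v b. q powi twist i j b * v (b - unit_exp i j))"

definition T_inv :: "nat \<Rightarrow> nat \<Rightarrow> (exponent, 'k) endo"
  where "T_inv i j = Endo (\<lambda>v b. q powi (- twist i j b) * v (b + unit_exp i j))"

lemma app_T: "app (T i j) v b = q powi twist i j b * v (b - unit_exp i j)"
  by (simp add: T_def Endo_inverse algebra_simps)

lemma app_T_inv: "app (T_inv i j) v b = q powi (- twist i j b) * v (b + unit_exp i j)"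
  by (simp add: T_inv_def Endo_inverse algebra_simps)

lemma T_inverse: "T i j * T_inv i j = 1" "T_inv i j * T i j = 1"
  by (rule endo_eqI,
      simp add: app_T app_T_inv twist_add twist_diff twist_unit power_int_minus q_nonzero)+

lemma T_commute:
  "T i j * T k l = escale (q powi (twist i j (unit_exp k l) - twist k l (unit_exp i j))) (T k l * T i j)"
proof (rule endo_eqI)
  fix v b
  let ?g = "twist i j" and ?h = "twist k l" and ?e = "unit_exp i j" and ?f = "unit_exp k l"
  have "app (T i j * T k l) v b = q powi (?g b + ?h (b - ?e)) * v (b - ?e - ?f)"
    by (simp add: app_T power_int_add q_nonzero)
  also have "?g b + ?h (b - ?e) = (?g ?f - ?h ?e) + (?h b + ?g (b - ?f))"
    by (simp add: twist_diff)
  also have "q powi \<dots> * v (b - ?e - ?f) = q powi (?g ?f - ?h ?e) * (q powi ?h b * (q powi ?g (b - ?f) * v (b - ?f - ?e)))"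
    by (simp add: power_int_add q_nonzero diff_diff_eq add.commute)
  finally show "app (T i j * T k l) v b =
      app (escale (q powi (?g ?f - ?h ?e)) (T k l * T i j)) v b"
    by (simp add: app_T)
qed

lemma T_row: "\<lbrakk>j < l; l \<le> n\<rbrakk> \<Longrightarrow> T i j * T i l = escale q (T i l * T i j)"
  using T_commute[of i j i l] by (simp add: twist_unit)

lemma T_rows: "\<lbrakk>i < k; k \<le> m\<rbrakk> \<Longrightarrow> T i j * T k l = escale (if j = l then q else 1) (T k l * T i j)"
  using T_commute[of i j k l] by (simp add: twist_unit)

lemma lead_T: "lead (T i j) (unit_exp i j)"
  unfolding lead_def
  by (intro exI[of _ "\<lambda>b. q powi twist i j (b + unit_exp i j)"])
    (auto simp: app_T q_nonzero supp_le_def less_diff_eq)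

lemma lead_T_inv: "lead (T_inv i j) (- unit_exp i j)"
proof -
  have "b < b' + unit_exp i j" if "b - unit_exp i j < b'" for b b' :: exponent
    using that by (simp add: diff_less_eq)
  then show ?thesis
    unfolding lead_def
    by (intro exI[of _ "\<lambda>b. q powi (- twist i j (b - unit_exp i j))"])
      (auto simp: app_T_inv q_nonzero supp_le_def)
qed

text \<open>Row extension iterated: row \<open>Suc r\<close> enters as bare torus generators, and
  the rows before it are corrected by them.\<close>

primrec X :: "nat \<Rightarrow> nat \<Rightarrow> nat \<Rightarrow> (exponent, 'k) endo" where
  "X 0 i j = 0"
| "X (Suc r) i j = (if i = Suc r then T (Suc r) j
    else (\<Sum>l\<in>{j..n}. X r i l * T_inv (Suc r) l) * T (Suc r) j)"

text \<open>Against generators of rows not yet added, \<open>X r i j\<close> behaves like the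
  generator \<open>T i j\<close>: the factors of \<open>X r i a\<close> and of
  \<open>T_inv (Suc r) a\<close> cancel, so only the final \<open>T (Suc r) j\<close>
  contributes.\<close>

lemma X_T:
  assumes "1 \<le> i" "i \<le> r" "r < k" "k \<le> m" "1 \<le> j" "j \<le> n"
  shows "X r i j * T k l = escale (if j = l then q else 1) (T k l * X r i j)"
  using assms
proof (induction r arbitrary: j)
  case (Suc r)
  show ?case
  proof (cases "i = Suc r")
    case True
    then show ?thesis using T_rows Suc.prems by simp
  next
    case False
    let ?c = "\<lambda>a. if a = l then q else 1"
    have "X r i a * T_inv (Suc r) a * T k l = T k l * (X r i a * T_inv (Suc r) a)" if a: "a \<in> {j..n}" for a
    proof -
      have "T k l * T (Suc r) a = escale (inverse (?c a)) (T (Suc r) a * T k l)"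
        using q_nonzero Suc.prems by (intro E.q_commute_sym T_rows) auto
      then have 1: "T_inv (Suc r) a * T k l = escale (inverse (?c a)) (T k l * T_inv (Suc r) a)"
        by (rule E.q_commute_inverse[OF T_inverse])
      have 2: "X r i a * T k l = escale (?c a) (T k l * X r i a)" using Suc False a by simp
      show ?thesis
        by (simp add: mult.assoc 1 E.q_commute_assoc[OF 2] E.scale_simps q_nonzero)
    qed
    then have "(\<Sum>a\<in>{j..n}. X r i a * T_inv (Suc r) a) * T k l = T k l * (\<Sum>a\<in>{j..n}. X r i a * T_inv (Suc r) a)"
      by (simp add: sum_distrib_left sum_distrib_right)
    then have 3: "(\<Sum>a\<in>{j..n}. X r i a * T_inv (Suc r) a) * T k l =
        escale 1 (T k l * (\<Sum>a\<in>{j..n}. X r i a * T_inv (Suc r) a))" by simp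
    have 4: "T (Suc r) j * T k l = escale (?c j) (T k l * T (Suc r) j)"
      using Suc.prems by (intro T_rows) auto
    show ?thesis using False
      by (simp only: X.simps if_False mult.assoc 4 E.q_commute_assoc[OF 3] E.mult_scale_right E.scale_one)
  qed
qed simp

lemma quantum_matrix_X_aux: "r \<le> m \<Longrightarrow> quantum_matrix escale q r n (X r)"
proof (induction r)
  case 0
  show ?case by unfold_locales (use q_nonzero in auto)
next
  case (Suc r)
  then interpret quantum_matrix escale q r n "X r" by simp
  interpret row_extension escale q r n "X r" "T (Suc r)" "T_inv (Suc r)"
    using Suc.prems by unfold_locales (auto simp: T_inverse T_row X_T)
  have "x = X (Suc r)"
    by (intro ext) (simp add: x_def w_def y_def)
  then show ?case using quantum_matrix_x by metis
qed

lemma quantum_matrix_X: "quantum_matrix escale q m n (X m)"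
  by (rule quantum_matrix_X_aux) simp

text \<open>A correction term with \<open>l > j\<close> has no unit at \<open>(i, j)\<close>, the
  first key where its exponent differs from \<open>unit_exp i j\<close>, so it is lower.\<close>

lemma lead_X_aux: "\<lbrakk>1 \<le> i; i \<le> r; 1 \<le> j; j \<le> n\<rbrakk> \<Longrightarrow> lead (X r i j) (unit_exp i j)"
proof (induction r arbitrary: j)
  case (Suc r)
  show ?case
  proof (cases "i = Suc r")
    case True
    then show ?thesis using lead_T by simp
  next
    case False
    let ?f = "\<lambda>l. X r i l * T_inv (Suc r) l * T (Suc r) j"
    have f: "lead (?f l) (unit_exp i l + - unit_exp (Suc r) l + unit_exp (Suc r) j)" if "l \<in> {j..n}" for l
      using Suc False that by (intro lead_mult lead_T lead_T_inv Suc.IH) auto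
    have "unit_exp i l + - unit_exp (Suc r) l + unit_exp (Suc r) j < unit_exp i j" if "l \<in> {j<..n}" for l
      using that False Suc.prems
      by (intro exponent_lessI[of _ "(i, j)"]) (auto simp: lookup_add lookup_minus lookup_single when_def)
    then have "low (?f l) (unit_exp i j)" if "l \<in> {j<..n}" for l
      using f[of l] that by (intro lead_imp_low[OF f]) auto
    then have "lead (?f j + (\<Sum>l\<in>{j<..n}. ?f l)) (unit_exp i j)"
      using f[of j] Suc.prems by (intro lead_add_low low_sum) (auto simp: add.assoc)
    also have "?f j + (\<Sum>l\<in>{j<..n}. ?f l) = (\<Sum>l\<in>{j..n}. ?f l)"
    proof -
      have "{j..n} = insert j {j<..n}" using Suc.prems by auto
      then show ?thesis by simp
    qed
    finally show ?thesis using False by (simp add: sum_distrib_right)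
  qed
qed simp

lemma lead_X: "\<lbrakk>1 \<le> i; i \<le> m; 1 \<le> j; j \<le> n\<rbrakk> \<Longrightarrow> lead (X m i j) (unit_exp i j)"
  by (rule lead_X_aux)

end

section \<open>Straightening\<close>

lemma not_successivelyE:
  assumes "\<not> successively P w"
  obtains u g h v where "w = u @ g # h # v" "\<not> P g h"
proof -
  have "\<exists>u g h v. w = u @ g # h # v \<and> \<not> P g h"
    using assms
  proof (induction w rule: induct_list012)
    case (3 a b w)
    show ?case
    proof (cases "P a b")
      case True
      then obtain u g h v where "b # w = u @ g # h # v" "\<not> P g h" using 3 by auto
      then show ?thesis by (metis append_Cons)
    next
      case False
      then show ?thesis by (metis append_Nil)
    qed
  qed auto
  then show ?thesis using that by blast
qed

context algebra begin

lemma span_mult_left: "s \<in> span B \<Longrightarrow> a * s \<in> span ((*) a ` B)"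
proof (induction rule: span_induct_alt)
  case (step c b s)
  then show ?case by (auto simp: ring_distribs mult_scale_right intro!: span_add span_scale intro: span_base)
qed (simp add: span_zero)

lemma span_mult:
  assumes "a \<in> span A" "b \<in> span B" shows "a * b \<in> span {a * b | a b. a \<in> A \<and> b \<in> B}"
  using assms(1)
proof (induction rule: span_induct_alt)
  case (step c x s)
  have "x * b \<in> span ((*) x ` B)" using assms(2) by (rule span_mult_left)
  then have "x * b \<in> span {a * b | a b. a \<in> A \<and> b \<in> B}"
    using span_mono[of "(*) x ` B" "{a * b | a b. a \<in> A \<and> b \<in> B}"] step(1) by blast
  then show ?case using step by (auto simp: ring_distribs mult_scale_left intro!: span_add span_scale)
qed (simp add: span_zero)

abbreviation ev :: "('l \<Rightarrow> 'r) \<Rightarrow> 'l list \<Rightarrow> 'r" where "ev X w \<equiv> prod_list (map X w)"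

text \<open>
  Replacing a bad factor \<open>g h\<close> by terms \<open>a b\<close> with \<open>a < g\<close> lowers words in the lexicographic order of
  words of fixed length.
\<close>

lemma straightening:
  fixes X :: "'l::wellorder \<Rightarrow> 'r"
  assumes S: "subspace S"
    and rewrite: "\<And>g h. \<lbrakk>g \<in> L; h \<in> L; \<not> good g h\<rbrakk> \<Longrightarrow>
      \<exists>s\<in>span {X a * X b | a b. a \<in> L \<and> b \<in> L \<and> a < g}. X g * X h - s \<in> N"
    and N: "\<And>r u v. \<lbrakk>r \<in> N; u \<in> lists L; v \<in> lists L\<rbrakk> \<Longrightarrow> ev X u * r * ev X v \<in> S"
    and good: "\<And>w. \<lbrakk>w \<in> lists L; successively good w\<rbrakk> \<Longrightarrow> ev X w \<in> S"
  shows "w \<in> lists L \<Longrightarrow> ev X w \<in> S"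
proof (induction w rule: wf_induct_rule[OF wf_lenlex[OF wf]])
  case (1 w)
  show ?case
  proof (cases "successively good w")
    case False
    then obtain u g h v where w: "w = u @ g # h # v" "\<not> good g h" by (rule not_successivelyE)
    then have L: "g \<in> L" "h \<in> L" "u \<in> lists L" "v \<in> lists L" using 1 by auto
    then obtain s where s: "s \<in> span {X a * X b | a b. a \<in> L \<and> b \<in> L \<and> a < g}" "X g * X h - s \<in> N"
      using rewrite w by blast
    \<comment> \<open>The elements whose insertion between the two outer words lands in
      \<open>S\<close> form a subspace, so it is enough to insert the generators of the
      span.\<close>
    have "subspace {r. ev X u * r * ev X v \<in> S}"
      using subspace_0[OF S] subspace_add[OF S] subspace_scale[OF S]
      by (intro subspaceI) (auto simp: ring_distribs scale_simps)
    moreover have "{X a * X b | a b. a \<in> L \<and> b \<in> L \<and> a < g} \<subseteq> {r. ev X u * r * ev X v \<in> S}"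
    proof clarify
      fix a b assume ab: "a \<in> L" "b \<in> L" "a < g"
      have "(u @ a # b # v, w) \<in> lenlex {(x, y). x < y}"
        using ab w unfolding lenlex_conv lex_conv by fastforce
      moreover have "u @ a # b # v \<in> lists L" using ab L by simp
      ultimately have "ev X (u @ a # b # v) \<in> S" using "1.IH" by blast
      then show "ev X u * (X a * X b) * ev X v \<in> S" by (simp add: mult.assoc)
    qed
    ultimately have "ev X u * s * ev X v \<in> S" using s(1) span_minimal by blast
    then have "ev X u * s * ev X v + ev X u * (X g * X h - s) * ev X v \<in> S"
      using N[OF s(2) L(3,4)] subspace_add[OF S] by blast
    then show ?thesis using w by (simp add: algebra_simps)
  qed (use good "1.prems" in blast)
qed

end

section \<open>Commutation rules for minors of two adjacent rows\<close>

context quantum_matrix begin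

definition minor :: "nat \<Rightarrow> nat \<Rightarrow> nat \<Rightarrow> 'r"
  where "minor i j l = x i j * x (Suc i) l - q *s (x i l * x (Suc i) j)"

lemma swap_row: "\<lbrakk>1 \<le> i; i \<le> m; 1 \<le> j; j < l; l \<le> n\<rbrakk> \<Longrightarrow> x i l * x i j = inverse q *s (x i j * x i l)"
  using q_nonzero by (intro q_commute_sym row)

lemma swap_col: "\<lbrakk>1 \<le> i; i < k; k \<le> m; 1 \<le> j; j \<le> n\<rbrakk> \<Longrightarrow> x k j * x i j = inverse q *s (x i j * x k j)"
  using q_nonzero by (intro q_commute_sym col)

text \<open>The factor \<open>1\<close> keeps the simplifier from treating the rule as permutative.\<close>

lemma swap_anti: "\<lbrakk>1 \<le> i; i < k; k \<le> m; 1 \<le> j; j < l; l \<le> n\<rbrakk> \<Longrightarrow> x k j * x i l = 1 *s (x i l * x k j)"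
  by (subst scale_one) (rule anti[symmetric])

lemma swap_diag: "\<lbrakk>1 \<le> i; i < k; k \<le> m; 1 \<le> j; j < l; l \<le> n\<rbrakk>
    \<Longrightarrow> x k l * x i j = x i j * x k l - (q - inverse q) *s (x i l * x k j)"
  by (simp add: diag)

lemma swap_row': "\<lbrakk>1 \<le> i; i \<le> m; 1 \<le> j; j < l; l \<le> n\<rbrakk>
    \<Longrightarrow> x i l * (x i j * z) = inverse q *s (x i j * (x i l * z))"
  using q_commute_assoc[OF swap_row] by blast

lemma swap_col': "\<lbrakk>1 \<le> i; i < k; k \<le> m; 1 \<le> j; j \<le> n\<rbrakk>
    \<Longrightarrow> x k j * (x i j * z) = inverse q *s (x i j * (x k j * z))"
  using q_commute_assoc[OF swap_col] by blast

lemma swap_anti': "\<lbrakk>1 \<le> i; i < k; k \<le> m; 1 \<le> j; j < l; l \<le> n\<rbrakk>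
    \<Longrightarrow> x k j * (x i l * z) = 1 *s (x i l * (x k j * z))"
  using q_commute_assoc[OF swap_anti] by blast

lemma swap_diag': "\<lbrakk>1 \<le> i; i < k; k \<le> m; 1 \<le> j; j < l; l \<le> n\<rbrakk>
    \<Longrightarrow> x k l * (x i j * z) = x i j * (x k l * z) - (q - inverse q) *s (x i l * (x k j * z))"
  using arg_cong[OF swap_diag, of i k j l "\<lambda>u. u * z"] by (simp add: algebra_simps scale_simps)

lemmas swaps = swap_row swap_col swap_anti swap_diag swap_row' swap_col' swap_anti' swap_diag'

lemma q_cancel: "q * inverse q = 1" "inverse q * q = 1" "q * (inverse q * z) = z" "inverse q * (q * z) = z"
  using q_nonzero by (simp_all add: field_simps)

text \<open>A terminating rewriting of products of entries into increasing order of (row, column).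
  Identities between minors are verified by comparing normal forms.\<close>

lemmas nf = minor_def ring_distribs mult.assoc scale_simps swaps q_cancel scale_minus_left
  scale_minus_right scale_scale

context
  fixes k i j l p :: nat
  assumes i: "1 \<le> i" "i < m" and jl: "1 \<le> j" "j < l" "l \<le> n"
begin

text \<open>Every term on the right begins with an entry of row \<open>k < i\<close>, hence with a
  smaller letter than the minor. In the companion rules for rows below, every term begins with a
  minor.\<close>

lemma minor_above:
  assumes k: "1 \<le> k" "k < i"
  shows "\<lbrakk>1 \<le> p; p < j\<rbrakk> \<Longrightarrow> minor i j l * x k p = x k p * minor i j l
      - (q - inverse q) *s (x k j * minor i p l) + (q * (q - inverse q)) *s (x k l * minor i p j)"
    "minor i j l * x k j = inverse q *s (x k j * minor i j l)"
    "\<lbrakk>j < p; p < l\<rbrakk> \<Longrightarrow> minor i j l * x k p = x k p * minor i j l - (q - inverse q) *s (x k l * minor i j p)"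
    "minor i j l * x k l = inverse q *s (x k l * minor i j l)"
    "\<lbrakk>l < p; p \<le> n\<rbrakk> \<Longrightarrow> minor i j l * x k p = x k p * minor i j l"
  using i jl k by (simp_all add: nf)

lemma minor_below:
  assumes k: "Suc i < k" "k \<le> m"
  shows "\<lbrakk>1 \<le> p; p < j\<rbrakk> \<Longrightarrow> x k p * minor i j l = minor i j l * x k p"
    "x k j * minor i j l = inverse q *s (minor i j l * x k j)"
    "\<lbrakk>j < p; p < l\<rbrakk> \<Longrightarrow> x k p * minor i j l = minor i j l * x k p - (q - inverse q) *s (minor i p l * x k j)"
    "x k l * minor i j l = inverse q *s (minor i j l * x k l)"
    "\<lbrakk>l < p; p \<le> n\<rbrakk> \<Longrightarrow> x k p * minor i j l = minor i j l * x k p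
      - (q - inverse q) *s (minor i j p * x k l) + (q * (q - inverse q)) *s (minor i l p * x k j)"
  using i jl k by (simp_all add: nf)

end

context
  fixes i a b c d :: nat
  assumes i: "1 \<le> i" "i < m" and abc: "1 \<le> a" "a < b" "b < c" "c \<le> n"
begin

lemma minor_minor3:
  shows "minor i a c * minor i a b = inverse q *s (minor i a b * minor i a c)"
    and "minor i b c * minor i a b = inverse q *s (minor i a b * minor i b c)"
    and "minor i b c * minor i a c = inverse q *s (minor i a c * minor i b c)"
  using i abc by (simp_all add: nf)

text \<open>The second and third equations are the quantum Pluecker relation; their equal right-hand
  sides also show that nested minors commute.\<close>

lemma minor_minor4:
  assumes d: "c < d" "d \<le> n"
  shows "minor i c d * minor i a b = (inverse q * inverse q) *s (minor i a b * minor i c d)"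
    and "minor i a d * minor i b c = inverse q *s (minor i a c * minor i b d)
      - (inverse q * inverse q) *s (minor i a b * minor i c d)"
    and "minor i b c * minor i a d = inverse q *s (minor i a c * minor i b d)
      - (inverse q * inverse q) *s (minor i a b * minor i c d)"
    and "minor i b d * minor i a c = (inverse q * inverse q) *s (minor i a c * minor i b d)
      + (inverse q - inverse q * inverse q * inverse q) *s (minor i a b * minor i c d)"
  using i abc d by (simp_all add: nf)

end

end

text \<open>
  The generators used for the rows \<open>i\<close> and \<open>i + 1\<close>: the letter \<open>(k, j, 0)\<close> stands for the entry
  \<open>x k j\<close> of another row \<open>k\<close>, and \<open>(i, j, l)\<close> for the \<open>2 \<times> 2\<close> minor of these two rows with columns
  \<open>j < l\<close>.  The lexicographic order of letters is the one used for straightening.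
\<close>

definition letters_at :: "nat \<Rightarrow> nat \<Rightarrow> nat \<Rightarrow> (nat \<times> nat \<times> nat) set"
  where "letters_at m n i = {(k, j, 0) | k j. 1 \<le> k \<and> k \<le> m \<and> k \<noteq> i \<and> k \<noteq> Suc i \<and> 1 \<le> j \<and> j \<le> n} \<union>
    {(i, j, l) | j l. 1 \<le> j \<and> j < l \<and> l \<le> n}"

fun standard :: "nat \<times> nat \<times> nat \<Rightarrow> nat \<times> nat \<times> nat \<Rightarrow> bool"
  where "standard (k, j, l) (k', j', l') \<longleftrightarrow> k < k' \<or> k = k' \<and> j \<le> j' \<and> l \<le> l'"

context quantum_matrix begin

fun gen :: "nat \<times> nat \<times> nat \<Rightarrow> 'r"
  where "gen (k, j, l) = (if l = 0 then x k j else minor k j l)"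

text \<open>Only the first letter has to drop, so each commutation rule for entries and minors can
  be used as it stands, whatever becomes of the second letter.\<close>

lemma straighten_pair:
  assumes i: "1 \<le> i" "i < m" and g: "g \<in> letters_at m n i" and h: "h \<in> letters_at m n i" and "\<not> standard g h"
  shows "gen g * gen h \<in> span {gen a * gen b | a b. a \<in> letters_at m n i \<and> b \<in> letters_at m n i \<and> a < g}"
    (is "_ \<in> ?S g")
proof -
  note st = \<open>\<not> standard g h\<close>
  define S where "S = ?S g"
  have add: "u + v \<in> S" and diff: "u - v \<in> S" if "u \<in> S" "v \<in> S" for u v
    using that span_add span_diff unfolding S_def by blast+
  have scale: "c *s u \<in> S" if "u \<in> S" for u c
    using that span_scale unfolding S_def by blast
  have base: "gen a * gen b \<in> S"
    if "a \<in> letters_at m n i" "b \<in> letters_at m n i" "a < g" for a b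
    unfolding S_def using that by (intro span_base) blast
  have XX: "x k j * x k' j' \<in> S"
    if "1 \<le> k" "k \<le> m" "k \<noteq> i" "k \<noteq> Suc i" "1 \<le> j" "j \<le> n"
      "1 \<le> k'" "k' \<le> m" "k' \<noteq> i" "k' \<noteq> Suc i" "1 \<le> j'" "j' \<le> n" "(k, j, 0) < g" for k j k' j'
    using base[of "(k, j, 0)" "(k', j', 0)"] that by (auto simp: letters_at_def)
  have XM: "x k j * minor i j' l' \<in> S"
    if "1 \<le> k" "k \<le> m" "k \<noteq> i" "k \<noteq> Suc i" "1 \<le> j" "j \<le> n"
      "1 \<le> j'" "j' < l'" "l' \<le> n" "(k, j, 0) < g" for k j j' l'
    using base[of "(k, j, 0)" "(i, j', l')"] that by (auto simp: letters_at_def)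
  have MX: "minor i j' l' * x k j \<in> S"
    if "1 \<le> k" "k \<le> m" "k \<noteq> i" "k \<noteq> Suc i" "1 \<le> j" "j \<le> n"
      "1 \<le> j'" "j' < l'" "l' \<le> n" "(i, j', l') < g" for k j j' l'
    using base[of "(i, j', l')" "(k, j, 0)"] that by (auto simp: letters_at_def)
  have MM: "minor i j l * minor i j' l' \<in> S"
    if "1 \<le> j" "j < l" "l \<le> n" "1 \<le> j'" "j' < l'" "l' \<le> n" "(i, j, l) < g" for j l j' l'
    using base[of "(i, j, l)" "(i, j', l')"] that by (auto simp: letters_at_def)
  obtain k j l where gd: "g = (k, j, l)" by (cases g)
  obtain k' j' l' where hd: "h = (k', j', l')" by (cases h)
  have gl: "(l = 0 \<and> 1 \<le> k \<and> k \<le> m \<and> k \<noteq> i \<and> k \<noteq> Suc i \<and> 1 \<le> j \<and> j \<le> n) \<or>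
      (l \<noteq> 0 \<and> k = i \<and> 1 \<le> j \<and> j < l \<and> l \<le> n)"
    using g unfolding gd letters_at_def by auto
  have hl: "(l' = 0 \<and> 1 \<le> k' \<and> k' \<le> m \<and> k' \<noteq> i \<and> k' \<noteq> Suc i \<and> 1 \<le> j' \<and> j' \<le> n) \<or>
      (l' \<noteq> 0 \<and> k' = i \<and> 1 \<le> j' \<and> j' < l' \<and> l' \<le> n)"
    using h unfolding hd letters_at_def by auto
  have st': "\<not> (k < k' \<or> k = k' \<and> j \<le> j' \<and> l \<le> l')" using st unfolding gd hd by simp
  consider (xx) "l = 0" "l' = 0" | (xm) "l = 0" "l' \<noteq> 0" | (mx) "l \<noteq> 0" "l' = 0" | (mm) "l \<noteq> 0" "l' \<noteq> 0"
    by blast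
  then have "gen g * gen h \<in> S"
  proof cases
    case xx
    then have r: "1 \<le> k" "k \<le> m" "k \<noteq> i" "k \<noteq> Suc i" "1 \<le> j" "j \<le> n"
      "1 \<le> k'" "k' \<le> m" "k' \<noteq> i" "k' \<noteq> Suc i" "1 \<le> j'" "j' \<le> n" using gl hl by auto
    have e: "gen g * gen h = x k j * x k' j'" using xx by (simp add: gd hd)
    consider "k = k'" "j' < j" | "k' < k" "j = j'" | "k' < k" "j < j'" | "k' < k" "j' < j"
      using st' xx by linarith
    then show ?thesis
    proof cases
      case 1
      show ?thesis unfolding e unfolding 1 using r 1
        by (subst swap_row) (auto intro!: scale XX simp: gd)
    next
      case 2
      show ?thesis unfolding e unfolding 2 using r 2
        by (subst swap_col) (auto intro!: scale XX simp: gd)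
    next
      case 3
      show ?thesis unfolding e using r 3
        by (subst swap_anti) (auto intro!: scale XX simp: gd)
    next
      case 4
      show ?thesis unfolding e using r 4
        by (subst swap_diag) (auto intro!: scale diff XX simp: gd)
    qed
  next
    case xm
    then have r: "k' = i" "1 \<le> j'" "j' < l'" "l' \<le> n" "Suc i < k" "k \<le> m" "1 \<le> j" "j \<le> n"
      using gl hl st' by auto
    have e: "gen g * gen h = x k j * minor i j' l'" using xm r by (simp add: gd hd)
    note B = minor_below[OF i r(2-6)]
    consider "j < j'" | "j = j'" | "j' < j" "j < l'" | "j = l'" | "l' < j" by linarith
    then show ?thesis
      unfolding e using r
      by cases (auto simp: B gd intro!: add diff scale MX)
  next
    case mx
    then have r: "k = i" "1 \<le> j" "j < l" "l \<le> n" "1 \<le> k'" "k' < i" "1 \<le> j'" "j' \<le> n"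
      using gl hl st' by auto
    have e: "gen g * gen h = minor i j l * x k' j'" using mx r by (simp add: gd hd)
    note B = minor_above[OF i r(2-6)]
    consider "j' < j" | "j' = j" | "j < j'" "j' < l" | "j' = l" | "l < j'" by linarith
    then show ?thesis
      unfolding e using r i
      by cases (auto simp: B gd intro!: add diff scale XM)
  next
    case mm
    then have r: "k = i" "k' = i" "1 \<le> j" "j < l" "l \<le> n" "1 \<le> j'" "j' < l'" "l' \<le> n"
      using gl hl by auto
    have e: "gen g * gen h = minor i j l * minor i j' l'" using mm r by (simp add: gd hd)
    \<comment> \<open>The possible positions of two column pairs that are not standard: 1, 4 and 6
      share a column, 2 and 7 are nested, 3 is disjoint and 5 is crossing.\<close>
    consider (1) "j' < j" "l = l'" | (2) "j' < j" "l < l'" | (3) "l' < j" | (4) "j = l'"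
      | (5) "j' < j" "j < l'" "l' < l" | (6) "j = j'" "l' < l" | (7) "j < j'" "l' < l"
      using st' r by linarith
    then show ?thesis
    proof cases
      case 1
      show ?thesis unfolding e unfolding 1(2)
        using r 1 by (subst minor_minor3(3)[OF i]) (auto simp: gd intro!: scale MM)
    next
      case 2
      show ?thesis unfolding e
        using r 2 by (subst minor_minor4(3)[OF i]) (auto simp: gd intro!: diff scale MM)
    next
      case 3
      show ?thesis unfolding e
        using r 3 by (subst minor_minor4(1)[OF i]) (auto simp: gd intro!: diff scale MM)
    next
      case 4
      show ?thesis unfolding e unfolding 4
        using r 4 by (subst minor_minor3(2)[OF i]) (auto simp: gd intro!: diff scale MM)
    next
      case 5
      show ?thesis unfolding e
        using r 5 by (subst minor_minor4(4)[OF i]) (auto simp: gd intro!: add scale MM)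
    next
      case 6
      show ?thesis unfolding e unfolding 6(1)
        using r 6 by (subst minor_minor3(1)[OF i]) (auto simp: gd intro!: add scale MM)
    next
      case 7
      show ?thesis unfolding e
        using r 7 by (subst minor_minor4(2)[OF i]) (auto simp: gd intro!: diff scale MM)
    qed
  qed
  then show ?thesis unfolding S_def .
qed

lemma span_standard:
  assumes i: "1 \<le> i" "i < m"
  shows "span (ev gen ` lists (letters_at m n i)) \<subseteq>
    span (ev gen ` {w \<in> lists (letters_at m n i). successively standard w})"
proof (rule span_minimal[OF image_subsetI subspace_span])
  fix w assume w: "w \<in> lists (letters_at m n i)"
  show "ev gen w \<in> span (ev gen ` {w \<in> lists (letters_at m n i). successively standard w})"
  proof (rule straightening[OF subspace_span, where N = "{0}" and X = gen and good = standard, OF _ _ _ w])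
    fix g h assume "g \<in> letters_at m n i" "h \<in> letters_at m n i" "\<not> standard g h"
    from straighten_pair[OF i this]
    show "\<exists>s\<in>span {gen a * gen b |a b. a \<in> letters_at m n i \<and> b \<in> letters_at m n i \<and> a < g}.
        gen g * gen h - s \<in> {0}"
      by (intro bexI[of _ "gen g * gen h"]) auto
  qed (auto intro: span_base span_zero)
qed

end

section \<open>Exponents of standard words and the interlacing inequalities\<close>

lemma standard_trans: "standard a b \<Longrightarrow> standard b c \<Longrightarrow> standard a c"
  by (cases a; cases b; cases c) auto

lemma standard_less_eq: "standard a b \<Longrightarrow> a \<le> b"
  by (cases a; cases b) (auto simp: less_eq_prod_def)

fun letter_exp :: "nat \<times> nat \<times> nat \<Rightarrow> exponent"
  where "letter_exp (k, j, l) = unit_exp k j + (if l = 0 then 0 else unit_exp (Suc k) l)"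

abbreviation word_exp :: "(nat \<times> nat \<times> nat) list \<Rightarrow> exponent" where "word_exp w \<equiv> sum_list (map letter_exp w)"

lemma lookup_letter_exp:
  assumes "g \<in> letters_at m n i"
  shows "\<lbrakk>k \<noteq> i; k \<noteq> Suc i\<rbrakk> \<Longrightarrow> lookup (letter_exp g) (k, j) = (if g = (k, j, 0) then 1 else 0)"
    and "lookup (letter_exp g) (i, j) = (if fst g = i \<and> fst (snd g) = j then 1 else 0)"
    and "lookup (letter_exp g) (Suc i, l) = (if fst g = i \<and> snd (snd g) = l then 1 else 0)"
proof -
  consider k j where "g = (k, j, 0)" "k \<noteq> i" "k \<noteq> Suc i" | j l where "g = (i, j, l)" "1 \<le> j" "j < l" "l \<le> n"
    using assms unfolding letters_at_def by blast
  note cs = this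
  show "\<lbrakk>k \<noteq> i; k \<noteq> Suc i\<rbrakk> \<Longrightarrow> lookup (letter_exp g) (k, j) = (if g = (k, j, 0) then 1 else 0)"
    by (rule cs) (auto simp: lookup_add lookup_single when_def)
  show "lookup (letter_exp g) (i, j) = (if fst g = i \<and> fst (snd g) = j then 1 else 0)"
    by (rule cs) (auto simp: lookup_add lookup_single when_def)
  show "lookup (letter_exp g) (Suc i, l) = (if fst g = i \<and> snd (snd g) = l then 1 else 0)"
    by (rule cs) (auto simp: lookup_add lookup_single when_def)
qed

text \<open>Outside rows \<open>i\<close> and \<open>Suc i\<close> the exponent counts entry
  letters. On these two rows it records the multisets of first and of second columns of the minors,
  but not how they are paired.\<close>

lemma lookup_word_exp:
  assumes "w \<in> lists (letters_at m n i)"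
  shows "\<lbrakk>k \<noteq> i; k \<noteq> Suc i\<rbrakk> \<Longrightarrow> lookup (word_exp w) (k, j) = int (count (mset w) (k, j, 0))"
    and "lookup (word_exp w) (i, j) =
      int (count (mset (map (\<lambda>g. fst (snd g)) (filter (\<lambda>g. fst g = i) w))) j)"
    and "lookup (word_exp w) (Suc i, l) =
      int (count (mset (map (\<lambda>g. snd (snd g)) (filter (\<lambda>g. fst g = i) w))) l)"
proof -
  show "\<lbrakk>k \<noteq> i; k \<noteq> Suc i\<rbrakk> \<Longrightarrow> lookup (word_exp w) (k, j) = int (count (mset w) (k, j, 0))"
    using assms by (induction w) (simp_all add: lookup_add lookup_letter_exp(1) del: letter_exp.simps)
  show "lookup (word_exp w) (i, j) =
      int (count (mset (map (\<lambda>g. fst (snd g)) (filter (\<lambda>g. fst g = i) w))) j)"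
    using assms by (induction w) (simp_all add: lookup_add lookup_letter_exp(2) del: letter_exp.simps)
  show "lookup (word_exp w) (Suc i, l) =
      int (count (mset (map (\<lambda>g. snd (snd g)) (filter (\<lambda>g. fst g = i) w))) l)"
    using assms by (induction w) (simp_all add: lookup_add lookup_letter_exp(3) del: letter_exp.simps)
qed

text \<open>In a standard word the first columns and the second columns of the minors are both
  sorted, which restores the pairing that the exponent forgets. The letters are then known with
  multiplicity, and sorting them gives the word.\<close>

lemma word_exp_inj:
  assumes w: "w \<in> lists (letters_at m n i)" "successively standard w"
    and w': "w' \<in> lists (letters_at m n i)" "successively standard w'"
    and eq: "word_exp w = word_exp w'"
  shows "w = w'"
proof -
  define p where "p w = filter (\<lambda>g. fst g = i) w" for w :: "(nat \<times> nat \<times> nat) list"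
  have sw: "sorted_wrt standard w" "sorted_wrt standard w'"
    using w w' standard_trans by (auto simp: successively_iff_sorted_wrt_strong)
  then have sp: "sorted_wrt standard (p w)" "sorted_wrt standard (p w')"
    by (simp_all add: p_def sorted_wrt_filter)
  have s: "sorted (map (\<lambda>g. fst (snd g)) (p w)) \<and> sorted (map (\<lambda>g. snd (snd g)) (p w))"
    if "sorted_wrt standard (p w)" for w
  proof -
    have "fst (snd g) \<le> fst (snd h) \<and> snd (snd g) \<le> snd (snd h)"
      if "g \<in> set (p w)" "h \<in> set (p w)" "standard g h" for g h
    proof -
      have "fst g = i" "fst h = i" using that(1,2) unfolding p_def by simp_all
      then show ?thesis using that(3) by (cases g; cases h) auto
    qed
    then show ?thesis unfolding sorted_map
      using sorted_wrt_mono_rel[OF _ that, of "\<lambda>g h. fst (snd g) \<le> fst (snd h)"]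
        sorted_wrt_mono_rel[OF _ that, of "\<lambda>g h. snd (snd g) \<le> snd (snd h)"] by blast
  qed
  have "mset (map (\<lambda>g. fst (snd g)) (p w)) = mset (map (\<lambda>g. fst (snd g)) (p w'))"
    "mset (map (\<lambda>g. snd (snd g)) (p w)) = mset (map (\<lambda>g. snd (snd g)) (p w'))"
    using lookup_word_exp(2,3)[OF w(1)] lookup_word_exp(2,3)[OF w'(1)] eq
    by (auto intro!: multiset_eqI simp: p_def)
  then have "map (\<lambda>g. fst (snd g)) (p w) = map (\<lambda>g. fst (snd g)) (p w')"
    "map (\<lambda>g. snd (snd g)) (p w) = map (\<lambda>g. snd (snd g)) (p w')"
    using s[OF sp(1)] s[OF sp(2)] properties_for_sort by metis+
  moreover from this(1) have len: "length (p w) = length (p w')" by (rule map_eq_imp_length_eq)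
  moreover have "map fst (p w) = map fst (p w')"
  proof -
    have "map fst (p w) = replicate (length (p w)) i" for w
      by (intro replicate_eqI) (auto simp: p_def)
    then show ?thesis using len by metis
  qed
  ultimately have pp: "p w = p w'"
    by (auto simp: list_eq_iff_nth_eq prod_eq_iff)
  have "count (mset w) g = count (mset w') g" for g
  proof (cases "fst g = i")
    case True
    then show ?thesis using arg_cong[OF pp, of "\<lambda>l. count (mset l) g"] by (simp add: p_def)
  next
    case False
    show ?thesis
    proof (cases "g \<in> letters_at m n i")
      case True
      then obtain k j where "g = (k, j, 0)" "k \<noteq> i" "k \<noteq> Suc i"
        using False unfolding letters_at_def by auto
      then show ?thesis using lookup_word_exp(1)[OF w(1)] lookup_word_exp(1)[OF w'(1)] eq by (metis of_nat_eq_iff)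
    next
      case False
      then have "g \<notin> set w" "g \<notin> set w'" using w w' by auto
      then show ?thesis by (metis count_mset_0_iff)
    qed
  qed
  then have "mset w = mset w'" by (intro multiset_eqI)
  moreover have "sorted w" "sorted w'"
    using sorted_wrt_mono_rel[OF _ sw(1), of "(\<le>)"] sorted_wrt_mono_rel[OF _ sw(2), of "(\<le>)"] standard_less_eq
    by blast+
  ultimately show ?thesis using properties_for_sort by metis
qed

text \<open>For fillings: rows \<open>i\<close> and \<open>Suc i\<close> have equal length, and each
  entry of row \<open>i\<close> is smaller than the entry below it. The exclusive bound in
  \<open>{1..<l}\<close> encodes strictness.\<close>

definition interlaced :: "nat \<Rightarrow> nat \<Rightarrow> exponent \<Rightarrow> bool"
  where "interlaced n i a \<longleftrightarrow>
    (\<Sum>j\<in>{1..n}. lookup a (i, j)) = (\<Sum>j\<in>{1..n}. lookup a (Suc i, j)) \<and>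
    (\<forall>l. (\<Sum>j\<in>{1..l}. lookup a (Suc i, j)) \<le> (\<Sum>j\<in>{1..<l}. lookup a (i, j)))"

lemma interlaced_0: "interlaced n i 0"
  by (simp add: interlaced_def)

lemma interlaced_add: "\<lbrakk>interlaced n i a; interlaced n i b\<rbrakk> \<Longrightarrow> interlaced n i (a + b)"
  by (auto simp: interlaced_def lookup_add sum.distrib intro: add_mono)

lemma interlaced_letter_exp:
  assumes "g \<in> letters_at m n i" shows "interlaced n i (letter_exp g)"
proof -
  consider k j where "g = (k, j, 0)" "k \<noteq> i" "k \<noteq> Suc i" | j l where "g = (i, j, l)" "1 \<le> j" "j < l" "l \<le> n"
    using assms unfolding letters_at_def by blast
  then show ?thesis
    by cases (auto simp: interlaced_def lookup_add lookup_single when_def)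
qed

lemma interlaced_word_exp: "w \<in> lists (letters_at m n i) \<Longrightarrow> interlaced n i (word_exp w)"
  by (induction w) (auto intro: interlaced_0 interlaced_add interlaced_letter_exp)

text \<open>After zero coefficients are discarded, a nonzero combination is a sum with distinct
  leading exponents, so one of them survives.\<close>

lemma lead_span:
  assumes e: "\<And>w. w \<in> W \<Longrightarrow> lead (e w) (f w)" and inj: "inj_on f W"
    and x: "x \<in> E.span (e ` W)" "x \<noteq> 0"
  shows "\<exists>w\<in>W. lead x (f w)"
proof -
  have inj_e: "inj_on e W"
    using e inj by (metis inj_on_def lead_unique)
  obtain t r where t: "finite t" "t \<subseteq> e ` W" "(\<Sum>a\<in>t. escale (r a) a) = x"
    using x(1) unfolding E.span_explicit by blast
  define t' where "t' = {a \<in> t. r a \<noteq> 0}"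
  have "(\<Sum>a\<in>t'. escale (r a) a) = x"
    unfolding t(3)[symmetric] t'_def using t(1) by (intro sum.mono_neutral_left) auto
  moreover obtain A where A: "A \<subseteq> W" "t' = e ` A" using t unfolding t'_def by (metis (no_types, lifting) mem_Collect_eq subsetI subset_image_iff subset_trans)
  moreover have "inj_on e A" using inj_e A inj_on_subset by blast
  ultimately have eq: "(\<Sum>w\<in>A. escale (r (e w)) (e w)) = x" by (simp add: sum.reindex)
  have "finite t'" using t(1) by (simp add: t'_def)
  then have "finite A" using \<open>inj_on e A\<close> A(2) by (metis finite_imageD)
  moreover have "A \<noteq> {}" using eq x by auto
  moreover have "lead (e w) (f w) \<and> r (e w) \<noteq> 0" if "w \<in> A" for w
    using that A e unfolding t'_def by blast
  ultimately have "\<exists>w\<in>A. lead (\<Sum>w\<in>A. escale (r (e w)) (e w)) (f w)"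
    using inj A inj_on_subset by (intro lead_sum) blast+
  then show ?thesis using eq A by blast
qed

lemma lead_ev:
  assumes "\<And>g. g \<in> set w \<Longrightarrow> lead (e g) (f g)"
  shows "lead (prod_list (map e w)) (sum_list (map f w))"
  using assms by (induction w) (auto intro: lead_one lead_mult)

sublocale quantum_torus \<subseteq> Q: quantum_matrix escale q m n "X m"
  by (rule quantum_matrix_X)

context quantum_torus begin

lemma lead_minor:
  assumes "1 \<le> i" "i < m" "1 \<le> j" "j < l" "l \<le> n"
  shows "lead (Q.minor i j l) (unit_exp i j + unit_exp (Suc i) l)"
proof -
  have "lead (X m i l * X m (Suc i) j) (unit_exp i l + unit_exp (Suc i) j)"
    using assms by (intro lead_mult lead_X) auto
  moreover have "unit_exp i l + unit_exp (Suc i) j < unit_exp i j + unit_exp (Suc i) l"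
    using assms by (intro exponent_lessI[of _ "(i, j)"]) (auto simp: lookup_add lookup_single when_def)
  ultimately have "low (escale (- q) (X m i l * X m (Suc i) j)) (unit_exp i j + unit_exp (Suc i) l)"
    by (intro low_scale lead_imp_low)
  moreover have "lead (X m i j * X m (Suc i) l) (unit_exp i j + unit_exp (Suc i) l)"
    using assms by (intro lead_mult lead_X) auto
  ultimately have "lead (X m i j * X m (Suc i) l + escale (- q) (X m i l * X m (Suc i) j)) (unit_exp i j + unit_exp (Suc i) l)"
    by (intro lead_add_low)
  then show ?thesis by (simp add: Q.minor_def)
qed

lemma lead_gen: "\<lbrakk>1 \<le> i; i < m; g \<in> letters_at m n i\<rbrakk> \<Longrightarrow> lead (Q.gen g) (letter_exp g)"
proof -
  assume "1 \<le> i" "i < m" "g \<in> letters_at m n i"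
  then show ?thesis using lead_X lead_minor unfolding letters_at_def by fastforce
qed

text \<open>Standard words span and have distinct leading exponents, so the leading exponent of
  \<open>x\<close> is that of a single word, a sum of interlaced letter exponents.\<close>

lemma lead_interlaced:
  assumes i: "1 \<le> i" "i < m" and x: "x \<in> E.span (E.ev Q.gen ` lists (letters_at m n i))" "x \<noteq> 0"
  shows "\<exists>s. lead x s \<and> interlaced n i s"
proof -
  let ?W = "{w \<in> lists (letters_at m n i). successively standard w}"
  have "\<exists>w\<in>?W. lead x (word_exp w)"
  proof (rule lead_span)
    show "x \<in> E.span (E.ev Q.gen ` ?W)" using Q.span_standard[OF i] x by blast
    show "inj_on word_exp ?W" using word_exp_inj by (intro inj_onI) blast
    show "lead (E.ev Q.gen w) (word_exp w)" if "w \<in> ?W" for w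
      using that lead_gen[OF i] by (intro lead_ev) auto
  qed (rule x)
  then show ?thesis using interlaced_word_exp by blast
qed

end

section \<open>Maximal minors\<close>

text \<open>The transposition, applied to both components, keeps the order of every increasing pair
  except \<open>(i, Suc i)\<close>. It therefore carries inversions to inversions, and that pair is
  the one new inversion.\<close>

lemma perm_length_transpose:
  assumes \<sigma>: "\<sigma> permutes {1..m}" and i: "1 \<le> i" "i < m" "\<sigma> i < \<sigma> (Suc i)"
  shows "perm_length m (\<sigma> \<circ> transpose i (Suc i)) = Suc (perm_length m \<sigma>)"
proof -
  let ?s = "transpose i (Suc i)"
  define A where "A = {(a, b). 1 \<le> a \<and> a < b \<and> b \<le> m \<and> \<sigma> b < \<sigma> a}"
  define B where "B = {(a, b). 1 \<le> a \<and> a < b \<and> b \<le> m \<and> \<sigma> (?s b) < \<sigma> (?s a)}"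
  have fin: "finite A"
    by (rule finite_subset[of _ "{1..m} \<times> {1..m}"]) (auto simp: A_def)
  have "B = insert (i, Suc i) ((\<lambda>(a, b). (?s a, ?s b)) ` A)"
  proof (intro equalityI subsetI)
    fix p assume p: "p \<in> B"
    obtain a b where ab: "p = (a, b)" by (cases p)
    have h: "1 \<le> a" "a < b" "b \<le> m" "\<sigma> (?s b) < \<sigma> (?s a)" using p by (auto simp: B_def ab)
    show "p \<in> insert (i, Suc i) ((\<lambda>(a, b). (?s a, ?s b)) ` A)"
    proof (cases "p = (i, Suc i)")
      case False
      then have "(?s a, ?s b) \<in> A"
        using h i by (auto simp: A_def ab transpose_def split: if_splits)
      moreover have "p = (\<lambda>(a, b). (?s a, ?s b)) (?s a, ?s b)" by (simp add: ab)
      ultimately show ?thesis by blast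
    qed simp
  next
    fix p assume "p \<in> insert (i, Suc i) ((\<lambda>(a, b). (?s a, ?s b)) ` A)"
    then show "p \<in> B"
    proof
      assume "p = (i, Suc i)"
      then show ?thesis using i by (simp add: B_def)
    next
      assume "p \<in> (\<lambda>(a, b). (?s a, ?s b)) ` A"
      then obtain a b where ab: "(a, b) \<in> A" "p = (?s a, ?s b)" by auto
      then have h: "1 \<le> a" "a < b" "b \<le> m" "\<sigma> b < \<sigma> a" by (auto simp: A_def)
      then have "(a, b) \<noteq> (i, Suc i)" using i by auto
      then have "1 \<le> ?s a" "?s a < ?s b" "?s b \<le> m"
        using h i by (auto simp: transpose_def)
      then show ?thesis using h by (simp add: B_def ab)
    qed
  qed
  moreover have "(i, Suc i) \<notin> (\<lambda>(a, b). (?s a, ?s b)) ` A"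
  proof
    assume "(i, Suc i) \<in> (\<lambda>(a, b). (?s a, ?s b)) ` A"
    then obtain a b where "(a, b) \<in> A" "?s a = i" "?s b = Suc i" by auto
    then show False by (auto simp: A_def transpose_def split: if_splits)
  qed
  moreover have "inj_on (\<lambda>(a, b). (?s a, ?s b)) A"
    by (rule inj_onI) (auto simp: transpose_eq_iff)
  ultimately have "card B = Suc (card A)"
    using fin by (simp add: card_image)
  then show ?thesis by (simp add: perm_length_def A_def B_def)
qed

lemma perm_length_id: "perm_length m id = 0"
  by (auto simp: perm_length_def intro: card_eq_0_iff[THEN iffD2])

lemma sorted_list_nth:
  fixes J :: "nat set"
  assumes "J \<subseteq> {1..n}" "card J = m"
  shows "\<lbrakk>1 \<le> r; r \<le> m\<rbrakk> \<Longrightarrow> sorted_list_of_set J ! (r - 1) \<in> {1..n}"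
    and "\<lbrakk>1 \<le> r; r < r'; r' \<le> m\<rbrakk> \<Longrightarrow> sorted_list_of_set J ! (r - 1) < sorted_list_of_set J ! (r' - 1)"
proof -
  have fin: "finite J" using assms finite_subset by blast
  have len: "length (sorted_list_of_set J) = m" using assms by simp
  show "sorted_list_of_set J ! (r - 1) \<in> {1..n}" if "1 \<le> r" "r \<le> m"
  proof -
    have "sorted_list_of_set J ! (r - 1) \<in> set (sorted_list_of_set J)"
      using that len by (intro nth_mem) auto
    then show ?thesis using fin assms(1) by auto
  qed
  show "sorted_list_of_set J ! (r - 1) < sorted_list_of_set J ! (r' - 1)" if "1 \<le> r" "r < r'" "r' \<le> m"
    using sorted_wrt_nth_less[OF strict_sorted_list_of_set, of "r - 1" "r' - 1" J] that len by auto
qed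

lemma upt_split_two: "\<lbrakk>1 \<le> i; i < m\<rbrakk> \<Longrightarrow> [1..<Suc m] = [1..<i] @ [i, Suc i] @ [Suc (Suc i)..<Suc m]"
proof -
  assume i: "1 \<le> i" "i < m"
  have "[1..<Suc m] = [1..<i] @ [i..<Suc m]" using upt_add_eq_append[of 1 i "Suc m - i"] i by simp
  also have "[i..<Suc m] = [i, Suc i] @ [Suc (Suc i)..<Suc m]" using i by (simp add: upt_conv_Cons)
  finally show ?thesis .
qed

context quantum_matrix begin

definition row_product :: "(nat \<Rightarrow> nat) \<Rightarrow> 'r"
  where "row_product c = prod_list (map (\<lambda>i. x i (c i)) [1..<Suc m])"

definition max_minor :: "nat set \<Rightarrow> 'r"
  where "max_minor J = (\<Sum>\<sigma> | \<sigma> permutes {1..m}.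
    (- q) ^ perm_length m \<sigma> *s row_product (\<lambda>i. sorted_list_of_set J ! (\<sigma> i - 1)))"

text \<open>Permutations are paired with their products with the transposition \<open>(i, i + 1)\<close>.\<close>

lemma max_minor_in_span:
  assumes J: "J \<subseteq> {1..n}" "card J = m" and i: "1 \<le> i" "i < m"
  shows "max_minor J \<in> span (ev gen ` lists (letters_at m n i))"
proof -
  let ?s = "transpose i (Suc i)"
  let ?c = "\<lambda>\<sigma> i. sorted_list_of_set J ! (\<sigma> i - 1)"
  let ?f = "\<lambda>\<sigma>. (- q) ^ perm_length m \<sigma> *s row_product (?c \<sigma>)"
  define P where "P = {\<sigma>. \<sigma> permutes {1..m}}"
  \<comment> \<open>One representative from each coset of the transposition; the partner is the
    permutation with the two values exchanged.\<close>
  define P1 where "P1 = {\<sigma> \<in> P. \<sigma> i < \<sigma> (Suc i)}"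
  have s: "?s permutes {1..m}" using i by (intro permutes_swap_id) auto
  have finP: "finite P" unfolding P_def by (rule finite_permutations) simp
  have comp: "\<sigma> \<circ> ?s \<in> P" if "\<sigma> \<in> P" for \<sigma>
    using that s permutes_compose unfolding P_def by blast
  have "P = P1 \<union> (\<lambda>\<sigma>. \<sigma> \<circ> ?s) ` P1"
  proof (intro equalityI subsetI)
    fix \<sigma> assume \<sigma>: "\<sigma> \<in> P"
    then have "inj \<sigma>" unfolding P_def by (auto intro: permutes_inj)
    then have ne: "\<sigma> i \<noteq> \<sigma> (Suc i)" using injD[of \<sigma> i "Suc i"] by auto
    show "\<sigma> \<in> P1 \<union> (\<lambda>\<sigma>. \<sigma> \<circ> ?s) ` P1"
    proof (cases "\<sigma> i < \<sigma> (Suc i)")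
      case False
      then have "\<sigma> \<circ> ?s \<in> P1" using ne comp[OF \<sigma>] by (simp add: P1_def)
      moreover have "\<sigma> = (\<sigma> \<circ> ?s) \<circ> ?s" by (simp add: comp_assoc)
      ultimately show ?thesis by blast
    qed (use \<sigma> in \<open>simp add: P1_def\<close>)
  qed (use comp in \<open>auto simp: P1_def\<close>)
  moreover have "P1 \<inter> (\<lambda>\<sigma>. \<sigma> \<circ> ?s) ` P1 = {}" by (auto simp: P1_def)
  moreover have "finite P1" using finP by (simp add: P1_def)
  moreover have inj: "inj_on (\<lambda>\<sigma>. \<sigma> \<circ> ?s) P1"
  proof (rule inj_onI)
    fix \<sigma> \<tau> assume "\<sigma> \<circ> ?s = \<tau> \<circ> ?s"
    then have "\<sigma> \<circ> ?s \<circ> ?s = \<tau> \<circ> ?s \<circ> ?s" by simp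
    then show "\<sigma> = \<tau>" by (simp add: comp_assoc)
  qed
  ultimately have "sum ?f P = sum ?f P1 + sum (\<lambda>\<sigma>. ?f (\<sigma> \<circ> ?s)) P1"
    by (simp add: sum.union_disjoint sum.reindex)
  then have "max_minor J = (\<Sum>\<sigma>\<in>P1. ?f \<sigma> + ?f (\<sigma> \<circ> ?s))"
    by (simp add: max_minor_def P_def sum.distrib)
  also have "\<dots> \<in> span (ev gen ` lists (letters_at m n i))"
  proof (rule span_sum)
    fix \<sigma> assume \<sigma>: "\<sigma> \<in> P1"
    then have per: "\<sigma> permutes {1..m}" and lt: "\<sigma> i < \<sigma> (Suc i)" by (auto simp: P1_def P_def)
    have rng: "1 \<le> \<sigma> r \<and> \<sigma> r \<le> m" if "1 \<le> r" "r \<le> m" for r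
      using permutes_in_image[OF per, of r] that by auto
    define c where "c = ?c \<sigma>"
    have c: "c r \<in> {1..n}" if "1 \<le> r" "r \<le> m" for r
      unfolding c_def using rng[OF that] by (intro sorted_list_nth(1)[OF J]) auto
    have cc: "c i < c (Suc i)"
      unfolding c_def using rng[of i] rng[of "Suc i"] i lt by (intro sorted_list_nth(2)[OF J]) auto
    define u v where "u = map (\<lambda>r. (r, c r, 0 :: nat)) [1..<i]"
      and "v = map (\<lambda>r. (r, c r, 0 :: nat)) [Suc (Suc i)..<Suc m]"
    have uv: "u \<in> lists (letters_at m n i)" "v \<in> lists (letters_at m n i)"
      using c i by (auto simp: u_def v_def letters_at_def)
    have split: "row_product (?c \<tau>) = ev gen u * (x i (?c \<tau> i) * x (Suc i) (?c \<tau> (Suc i))) * ev gen v"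
      if \<tau>: "\<And>r. \<lbrakk>r \<noteq> i; r \<noteq> Suc i\<rbrakk> \<Longrightarrow> \<tau> r = \<sigma> r" for \<tau>
    proof -
      have "map (\<lambda>r. x r (?c \<tau> r)) [1..<i] = map gen u"
        "map (\<lambda>r. x r (?c \<tau> r)) [Suc (Suc i)..<Suc m] = map gen v"
        using \<tau> by (auto simp: u_def v_def c_def)
      then show ?thesis
        unfolding row_product_def upt_split_two[OF i] map_append prod_list.append
        by (simp add: mult.assoc)
    qed
    have "row_product (?c \<sigma>) = ev gen u * (x i (c i) * x (Suc i) (c (Suc i))) * ev gen v"
      using split[of \<sigma>] by (simp add: c_def)
    moreover have "row_product (?c (\<sigma> \<circ> ?s)) = ev gen u * (x i (c (Suc i)) * x (Suc i) (c i)) * ev gen v"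
      using split[of "\<sigma> \<circ> ?s"] by (simp add: c_def)
    \<comment> \<open>The additional inversion contributes \<open>- q\<close>, which is the
      coefficient of the second term of \<open>minor\<close>.\<close>
    moreover have "(- q) ^ perm_length m (\<sigma> \<circ> ?s) = - (q * (- q) ^ perm_length m \<sigma>)"
      using perm_length_transpose[OF per i lt] by simp
    ultimately have "?f \<sigma> + ?f (\<sigma> \<circ> ?s) =
        (- q) ^ perm_length m \<sigma> *s (ev gen u * minor i (c i) (c (Suc i)) * ev gen v)"
      by (simp add: minor_def ring_distribs scale_simps mult.commute[of q])
    also have "ev gen u * minor i (c i) (c (Suc i)) * ev gen v = ev gen (u @ (i, c i, c (Suc i)) # v)"
      using cc by (simp add: mult.assoc)
    also have "(- q) ^ perm_length m \<sigma> *s ev gen (u @ (i, c i, c (Suc i)) # v) \<in>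
        span (ev gen ` lists (letters_at m n i))"
    proof (intro span_scale span_base imageI)
      have "(i, c i, c (Suc i)) \<in> letters_at m n i"
        using c[of i] c[of "Suc i"] cc i by (auto simp: letters_at_def)
      then show "u @ (i, c i, c (Suc i)) # v \<in> lists (letters_at m n i)" using uv by simp
    qed
    finally show "?f \<sigma> + ?f (\<sigma> \<circ> ?s) \<in> span (ev gen ` lists (letters_at m n i))" .
  qed
  finally show ?thesis .
qed

end

definition row_exp :: "nat \<Rightarrow> (nat \<Rightarrow> nat) \<Rightarrow> exponent"
  where "row_exp m c = (\<Sum>r\<in>{1..m}. unit_exp r (c r))"

definition diag_exp :: "nat \<Rightarrow> nat set \<Rightarrow> exponent"
  where "diag_exp m J = row_exp m (\<lambda>r. sorted_list_of_set J ! (r - 1))"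

lemma lookup_row_exp:
  "lookup (row_exp m c) (a, b) = (if 1 \<le> a \<and> a \<le> m \<and> c a = b then 1 else 0)"
proof -
  have "lookup (row_exp m c) (a, b) = (\<Sum>r\<in>{1..m}. if r = a then (if c a = b then 1 else 0) else 0)"
    unfolding row_exp_def lookup_sum by (intro sum.cong) (auto simp: lookup_single when_def)
  then show ?thesis by (auto simp: sum.delta')
qed

text \<open>At the least moved point the smaller values are already taken, so the point moves
  up.\<close>

lemma permutes_first_moved:
  fixes \<sigma> :: "nat \<Rightarrow> nat"
  assumes "\<sigma> permutes {1..m}" "\<sigma> \<noteq> id"
  obtains i where "1 \<le> i" "i \<le> m" "i < \<sigma> i" "\<And>a. a < i \<Longrightarrow> \<sigma> a = a"
proof -
  define i where "i = (LEAST i. \<sigma> i \<noteq> i)"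
  have "\<exists>i. \<sigma> i \<noteq> i" using assms(2) by (auto simp: fun_eq_iff)
  then have i: "\<sigma> i \<noteq> i" unfolding i_def by (rule LeastI_ex)
  have less: "\<sigma> a = a" if "a < i" for a using that not_less_Least unfolding i_def by blast
  have "i \<in> {1..m}" using i assms(1) by (meson permutes_not_in)
  moreover have "i < \<sigma> i"
  proof (rule ccontr)
    assume "\<not> i < \<sigma> i"
    then have "\<sigma> (\<sigma> i) = \<sigma> i" using i less by simp
    then show False using i permutes_inj[OF assms(1)] by (auto dest: injD)
  qed
  ultimately show ?thesis using that less by auto
qed

context quantum_torus begin

text \<open>In its first moved row, a permutation other than \<open>id\<close> takes a later column
  than the diagonal does, so its exponent lacks the unit at a key before which both agree.\<close>

lemma lead_max_minor:
  assumes J: "J \<subseteq> {1..n}" "card J = m"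
  shows "lead (Q.max_minor J) (diag_exp m J)"
proof -
  let ?c = "\<lambda>\<sigma> i. sorted_list_of_set J ! (\<sigma> i - 1)"
  define P where "P = {\<sigma>. \<sigma> permutes {1..m}}"
  have finP: "finite P" unfolding P_def by (rule finite_permutations) simp
  have id: "id \<in> P" by (simp add: P_def permutes_id)
  have l: "lead (Q.row_product (?c \<sigma>)) (row_exp m (?c \<sigma>))" if "\<sigma> \<in> P" for \<sigma>
  proof -
    have "lead (X m r (?c \<sigma> r)) (unit_exp r (?c \<sigma> r))" if r: "r \<in> set [1..<Suc m]" for r
    proof -
      have "\<sigma> r \<in> {1..m}" using r \<open>\<sigma> \<in> P\<close> permutes_in_image[of \<sigma> "{1..m}" r] by (auto simp: P_def)
      then show ?thesis using r sorted_list_nth(1)[OF J, of "\<sigma> r"] by (intro lead_X) auto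
    qed
    then have "lead (Q.row_product (?c \<sigma>)) (\<Sum>r\<leftarrow>[1..<Suc m]. unit_exp r (?c \<sigma> r))"
      unfolding Q.row_product_def by (rule lead_ev)
    also have "(\<Sum>r\<leftarrow>[1..<Suc m]. unit_exp r (?c \<sigma> r)) = row_exp m (?c \<sigma>)"
      unfolding row_exp_def interv_sum_list_conv_sum_set_nat by (intro sum.cong) auto
    finally show ?thesis .
  qed
  have less: "row_exp m (?c \<sigma>) < diag_exp m J" if \<sigma>: "\<sigma> \<in> P - {id}" for \<sigma>
  proof -
    have per: "\<sigma> permutes {1..m}" using \<sigma> by (simp add: P_def)
    then obtain i where i: "1 \<le> i" "i \<le> m" "i < \<sigma> i" "\<And>a. a < i \<Longrightarrow> \<sigma> a = a"
      using permutes_first_moved \<sigma> by blast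
    have "\<sigma> i \<le> m" using permutes_in_image[OF per, of i] i by auto
    then have lt: "?c id i < ?c \<sigma> i" using sorted_list_nth(2)[OF J, of i "\<sigma> i"] i by simp
    show ?thesis
      unfolding diag_exp_def
    proof (rule exponent_lessI[of _ "(i, ?c id i)"])
      show "lookup (row_exp m (?c \<sigma>)) (i, ?c id i) < lookup (row_exp m (\<lambda>r. sorted_list_of_set J ! (r - 1))) (i, ?c id i)"
        using i lt by (simp add: lookup_row_exp)
      fix k assume k: "k < (i, ?c id i)"
      obtain a b where ab: "k = (a, b)" by (cases k)
      have "a < i \<or> a = i \<and> b < ?c id i" using k unfolding ab by auto
      then show "lookup (row_exp m (?c \<sigma>)) k = lookup (row_exp m (\<lambda>r. sorted_list_of_set J ! (r - 1))) k"
        unfolding ab lookup_row_exp using i(4) lt by auto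
    qed
  qed
  have "low (\<Sum>\<sigma>\<in>P - {id}. escale ((- q) ^ perm_length m \<sigma>) (Q.row_product (?c \<sigma>))) (diag_exp m J)"
    using l less by (intro low_sum low_scale) (blast intro: lead_imp_low)
  moreover have "lead (escale ((- q) ^ perm_length m id) (Q.row_product (?c id))) (diag_exp m J)"
    using l[OF id] by (simp add: perm_length_id diag_exp_def)
  ultimately have "lead (escale ((- q) ^ perm_length m id) (Q.row_product (?c id)) +
      (\<Sum>\<sigma>\<in>P - {id}. escale ((- q) ^ perm_length m \<sigma>) (Q.row_product (?c \<sigma>)))) (diag_exp m J)"
    by (rule lead_add_low[rotated])
  then show ?thesis
    unfolding Q.max_minor_def P_def[symmetric] by (simp only: sum.remove[OF finP id])
qed

end

section \<open>The monoid of leading exponents\<close>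

text \<open>Contents, row by row, of semistandard tableaux with \<open>m\<close> rows of equal
  length and entries up to \<open>n\<close>. Being cut out by homogeneous linear conditions, these
  exponents form a saturated monoid.\<close>

definition admissible :: "nat \<Rightarrow> nat \<Rightarrow> exponent \<Rightarrow> bool"
  where "admissible m n a \<longleftrightarrow>
    (\<forall>k j. 0 \<le> lookup a (k, j) \<and>
      (lookup a (k, j) \<noteq> 0 \<longrightarrow> 1 \<le> k \<and> k \<le> m \<and> 1 \<le> j \<and> j \<le> n)) \<and>
    (\<forall>i. 1 \<le> i \<and> i < m \<longrightarrow> interlaced n i a)"

abbreviation row_sum :: "nat \<Rightarrow> exponent \<Rightarrow> nat \<Rightarrow> int"
  where "row_sum n a i \<equiv> \<Sum>j\<in>{1..n}. lookup a (i, j)"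

lemma admissible_0: "admissible m n 0"
  by (simp add: admissible_def interlaced_0)

lemma admissible_add: "\<lbrakk>admissible m n a; admissible m n b\<rbrakk> \<Longrightarrow> admissible m n (a + b)"
proof -
  assume ab: "admissible m n a" "admissible m n b"
  have "1 \<le> k \<and> k \<le> m \<and> 1 \<le> j \<and> j \<le> n" if "lookup a (k, j) + lookup b (k, j) \<noteq> 0" for k j
  proof -
    have "lookup a (k, j) \<noteq> 0 \<or> lookup b (k, j) \<noteq> 0" using that by auto
    then show ?thesis using ab unfolding admissible_def by blast
  qed
  then show ?thesis using ab unfolding admissible_def lookup_add by (simp add: interlaced_add)
qed

lemma admissible_nonneg: "admissible m n a \<Longrightarrow> 0 \<le> a"
proof (rule ccontr)
  assume a: "admissible m n a" and "\<not> 0 \<le> a"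
  then have "a < 0" by simp
  then obtain k where "lookup a k < 0"
    unfolding less_poly_mapping.rep_eq less_fun_def by auto
  then show False using a unfolding admissible_def by (metis not_less surj_pair)
qed

lemma admissible_row_sum:
  assumes "admissible m n a" "1 \<le> r" "r \<le> m" shows "row_sum n a r = row_sum n a 1"
  using assms(2,3)
proof (induction r rule: dec_induct)
  case (step r)
  then show ?case using assms(1) unfolding admissible_def interlaced_def by simp
qed simp

lemma admissible_diag_exp:
  assumes J: "J \<subseteq> {1..n}" "card J = m"
  shows "admissible m n (diag_exp m J)"
proof -
  define c where "c r = sorted_list_of_set J ! (r - 1)" for r
  have c: "1 \<le> c r \<and> c r \<le> n" if "1 \<le> r" "r \<le> m" for r
    using sorted_list_nth(1)[OF J that] by (auto simp: c_def)
  have lt: "c r < c (Suc r)" if "1 \<le> r" "r < m" for r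
    using sorted_list_nth(2)[OF J, of r "Suc r"] that by (auto simp: c_def)
  have 1: "(\<Sum>j\<in>A. lookup (row_exp m c) (r, j)) = (if c r \<in> A then 1 else 0)"
    if "1 \<le> r" "r \<le> m" "finite A" for r A
    using that by (simp add: lookup_row_exp sum.delta')
  have "interlaced n r (row_exp m c)" if r: "1 \<le> r" "r < m" for r
    using r c[of r] c[of "Suc r"] lt[OF r] by (auto simp: interlaced_def 1)
  then show ?thesis
    unfolding admissible_def diag_exp_def c_def[symmetric] using c by (auto simp: lookup_row_exp)
qed

text \<open>The greedy step: in each row remove one unit from the first nonzero column.\<close>

lemma admissible_minus_diag_exp:
  assumes a: "admissible m n a" and "a \<noteq> 0" and "1 \<le> m"
  shows "\<exists>J. J \<subseteq> {1..n} \<and> card J = m \<and> admissible m n (a - diag_exp m J)"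
proof -
  let ?l = "lookup a"
  have nn: "0 \<le> ?l (k, j)" for k j using a unfolding admissible_def by blast
  have supp: "1 \<le> k \<and> k \<le> m \<and> 1 \<le> j \<and> j \<le> n" if "?l (k, j) \<noteq> 0" for k j
    using a that unfolding admissible_def by blast
  have inter: "(\<Sum>j\<in>{1..l}. ?l (Suc i, j)) \<le> (\<Sum>j\<in>{1..<l}. ?l (i, j))" if "1 \<le> i" "i < m" for i l
    using a that unfolding admissible_def interlaced_def by blast
  obtain k0 j0 where kj: "?l (k0, j0) \<noteq> 0" using \<open>a \<noteq> 0\<close> by (metis poly_mapping_eqI lookup_zero surj_pair)
  have "?l (k0, j0) \<le> row_sum n a k0"
    using supp[OF kj] nn by (intro member_le_sum[where f = "\<lambda>j. ?l (k0, j)"]) auto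
  then have "0 < row_sum n a k0" using nn[of k0 j0] kj by linarith
  then have pos: "0 < row_sum n a r" if "1 \<le> r" "r \<le> m" for r
    using admissible_row_sum[OF a] that supp[OF kj] by metis
  have ex: "\<exists>j. 0 < ?l (r, j)" if "1 \<le> r" "r \<le> m" for r
  proof (rule ccontr)
    assume "\<nexists>j. 0 < ?l (r, j)"
    then have "row_sum n a r \<le> 0" by (intro sum_nonpos) (simp add: not_less)
    then show False using pos[OF that] by simp
  qed
  define c where "c r = (LEAST j. 0 < ?l (r, j))" for r
  have c: "0 < ?l (r, c r)" if "1 \<le> r" "r \<le> m" for r
    using LeastI_ex[OF ex[OF that]] by (simp add: c_def)
  have c0: "?l (r, j) = 0" if "j < c r" for r j
    using that not_less_Least[of j "\<lambda>j. 0 < ?l (r, j)"] nn[of r j] unfolding c_def by fastforce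
  have cn: "1 \<le> c r \<and> c r \<le> n" if "1 \<le> r" "r \<le> m" for r using supp[of r "c r"] c[OF that] by auto
  \<comment> \<open>Evaluated at \<open>l = c (Suc r)\<close>, the inequality needs a unit of row
    \<open>r\<close> strictly before that column.\<close>
  have lt: "c r < c (Suc r)" if "1 \<le> r" "r < m" for r
  proof (rule ccontr)
    assume "\<not> c r < c (Suc r)"
    then have "(\<Sum>j\<in>{1..<c (Suc r)}. ?l (r, j)) = 0" using c0 by (intro sum.neutral) auto
    moreover have "?l (Suc r, c (Suc r)) \<le> (\<Sum>j\<in>{1..c (Suc r)}. ?l (Suc r, j))"
      using cn[of "Suc r"] that nn by (intro member_le_sum[where f = "\<lambda>j. ?l (Suc r, j)"]) auto
    ultimately show False using inter[OF that, of "c (Suc r)"] c[of "Suc r"] that by linarith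
  qed
  have mono: "c r < c r'" if "r < r'" "1 \<le> r" "r' \<le> m" for r r'
    using that
  proof (induction rule: less_Suc_induct)
    case (2 i j k)
    then show ?case by simp
  qed (use lt in auto)
  define J where "J = c ` {1..m}"
  have inj: "inj_on c {1..m}"
    by (rule linorder_inj_onI) (use mono in force)+
  then have cJ: "card J = m" by (simp add: J_def card_image)
  have JJ: "J \<subseteq> {1..n}" using cn by (auto simp: J_def)
  have "sorted_list_of_set J = map c [1..<Suc m]"
  proof (rule sorted_distinct_set_unique)
    have "sorted_wrt (<) [1..<Suc m]" by (rule sorted_wrt_upt)
    moreover have "c a \<le> c b" if "a \<in> set [1..<Suc m]" "b \<in> set [1..<Suc m]" "a < b" for a b
      using mono[of a b] that by (simp del: upt_Suc)
    ultimately have "sorted_wrt (\<lambda>a b. c a \<le> c b) [1..<Suc m]"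
      by (rule sorted_wrt_mono_rel[rotated])
    then show "sorted (map c [1..<Suc m])" by (simp add: sorted_map)
    show "distinct (map c [1..<Suc m])" using inj by (simp add: distinct_map atLeastLessThanSuc_atLeastAtMost del: upt_Suc)
  qed (auto simp: J_def)
  then have "diag_exp m J = row_exp m c"
    unfolding diag_exp_def row_exp_def by (intro sum.cong refl) (auto simp: nth_upt simp del: upt_Suc)
  have s: "(\<Sum>j\<in>A. lookup (row_exp m c) (r, j)) = (if c r \<in> A then 1 else 0)"
    if "1 \<le> r" "r \<le> m" "finite A" for r A
    using that by (simp add: lookup_row_exp sum.delta')
  have "interlaced n r (a - row_exp m c)" if r: "1 \<le> r" "r < m" for r
    unfolding interlaced_def
  proof (intro conjI allI)
    show "row_sum n (a - row_exp m c) r = row_sum n (a - row_exp m c) (Suc r)"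
      using admissible_row_sum[OF a, of r] admissible_row_sum[OF a, of "Suc r"] r cn[of r] cn[of "Suc r"]
      by (simp add: lookup_minus sum_subtractf s)
    fix l
    show "(\<Sum>j\<in>{1..l}. lookup (a - row_exp m c) (Suc r, j)) \<le>
        (\<Sum>j\<in>{1..<l}. lookup (a - row_exp m c) (r, j))"
    \<comment> \<open>In the first case both sides lose one unit, as \<open>c r\<close> lies before
      \<open>c (Suc r)\<close>. In the second the left side vanishes, and the right side stays
      nonnegative.\<close>
    proof (cases "c (Suc r) \<le> l")
      case True
      then show ?thesis using inter[OF r, of l] r cn[of r] cn[of "Suc r"] lt[OF r]
        by (simp add: lookup_minus sum_subtractf s)
    next
      case False
      have "(\<Sum>j\<in>{1..l}. lookup (a - row_exp m c) (Suc r, j)) = 0"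
        using False c0 by (intro sum.neutral) (auto simp: lookup_minus lookup_row_exp)
      also have "0 \<le> (\<Sum>j\<in>{1..<l}. lookup (a - row_exp m c) (r, j))"
        using nn c[of r] r by (intro sum_nonneg) (auto simp: lookup_minus lookup_row_exp)
      finally show ?thesis .
    qed
  qed
  then have "admissible m n (a - row_exp m c)"
    unfolding admissible_def
    using nn c supp cn by (auto simp: lookup_minus lookup_row_exp) (metis add_0 int_one_le_iff_zero_less)+
  then show ?thesis using JJ cJ \<open>diag_exp m J = row_exp m c\<close> by metis
qed

text \<open>A tableau is split into its columns one by one; the number of columns, which is the sum
  of row 1, drops each time.\<close>

lemma admissible_generated:
  assumes "admissible m n a" "1 \<le> m"
  shows "\<exists>M. set_mset M \<subseteq> {J. J \<subseteq> {1..n} \<and> card J = m} \<and> a = (\<Sum>J\<in>#M. diag_exp m J)"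
  using assms(1)
proof (induction "nat (row_sum n a 1)" arbitrary: a rule: less_induct)
  case less
  show ?case
  proof (cases "a = 0")
    case True
    then show ?thesis by (intro exI[of _ "{#}"]) simp
  next
    case False
    then obtain J where J: "J \<subseteq> {1..n}" "card J = m" "admissible m n (a - diag_exp m J)"
      using admissible_minus_diag_exp less.prems assms(2) by blast
    have "row_sum n (diag_exp m J) 1 = 1"
      using sorted_list_nth(1)[OF J(1,2), of 1] assms(2) by (simp add: diag_exp_def lookup_row_exp sum.delta')
    then have d: "row_sum n (a - diag_exp m J) 1 = row_sum n a 1 - 1"
      by (simp add: lookup_minus sum_subtractf)
    moreover have "0 \<le> row_sum n (a - diag_exp m J) 1"
      using J(3) unfolding admissible_def by (intro sum_nonneg) blast
    ultimately have "nat (row_sum n (a - diag_exp m J) 1) < nat (row_sum n a 1)" by linarith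
    then obtain M where M: "set_mset M \<subseteq> {J. J \<subseteq> {1..n} \<and> card J = m}"
      "a - diag_exp m J = (\<Sum>J\<in>#M. diag_exp m J)"
      using less.hyps J(3) by blast
    then show ?thesis using J by (intro exI[of _ "add_mset J M"]) (auto simp: algebra_simps)
  qed
qed

section \<open>Well-quasi-order and integral closedness of the exponents\<close>

lemma nat_seq_incseq_subseq:
  fixes g :: "nat \<Rightarrow> nat"
  obtains r :: "nat \<Rightarrow> nat" where "strict_mono r" "incseq (g \<circ> r)"
proof -
  obtain f :: "nat \<Rightarrow> nat" where f: "strict_mono f" "monoseq (\<lambda>n. g (f n))"
    using seq_monosub by blast
  show ?thesis
  proof (cases "incseq (\<lambda>n. g (f n))")
    case True
    then show ?thesis using that f by (simp add: comp_def)
  next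
    case False
    then have dec: "decseq (\<lambda>n. g (f n))" using f(2) by (simp add: monoseq_iff)
    define N where "N = (ARG_MIN (\<lambda>n. g (f n)) n. True)"
    have N: "g (f N) \<le> g (f n)" for n unfolding N_def by (rule arg_min_nat_le) simp
    have "g (f (n + N)) = g (f N)" for n
      using N[of "n + N"] decseqD[OF dec, of N "n + N"] by simp
    then have "incseq (g \<circ> (\<lambda>n. f (n + N)))" by (simp add: incseq_def)
    moreover have "strict_mono (\<lambda>n. f (n + N))" using f(1) by (simp add: strict_mono_def)
    ultimately show ?thesis using that by blast
  qed
qed

text \<open>Passing to subsequences one element of \<open>A\<close> at a time makes all
  multiplicities increase simultaneously; any two members of the result are then comparable.\<close>

lemma Dickson_multiset:
  fixes F :: "nat \<Rightarrow> 'a multiset"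
  assumes "finite A" and F: "\<And>i. set_mset (F i) \<subseteq> A"
  shows "\<exists>i j. i < j \<and> F i \<subseteq># F j"
proof -
  have "\<exists>r :: nat \<Rightarrow> nat. strict_mono r \<and> (\<forall>a\<in>A. incseq (\<lambda>n. count (F (r n)) a))"
    using assms(1)
  proof (induction A rule: finite_induct)
    case empty
    show ?case by (rule exI[of _ id]) (simp add: strict_mono_def)
  next
    case (insert a A)
    then obtain r :: "nat \<Rightarrow> nat" where r: "strict_mono r" "\<forall>a\<in>A. incseq (\<lambda>n. count (F (r n)) a)" by blast
    obtain s :: "nat \<Rightarrow> nat" where s: "strict_mono s" "incseq ((\<lambda>n. count (F (r n)) a) \<circ> s)"
      by (rule nat_seq_incseq_subseq)
    have "incseq (\<lambda>n. count (F (r (s n))) b)" if "b \<in> A" for b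
      using r(2) that s(1) by (auto simp: incseq_def strict_mono_less_eq)
    then show ?case using r(1) s by (intro exI[of _ "r \<circ> s"]) (auto simp: strict_mono_def comp_def)
  qed
  then obtain r :: "nat \<Rightarrow> nat" where r: "strict_mono r" "\<And>a. a \<in> A \<Longrightarrow> incseq (\<lambda>n. count (F (r n)) a)" by blast
  have "count (F (r 0)) a \<le> count (F (r 1)) a" for a
  proof (cases "a \<in> A")
    case True
    then show ?thesis using incseqD[OF r(2), of a 0 1] by simp
  next
    case False
    then show ?thesis using F[of "r 0"] by (metis count_eq_zero_iff subsetD zero_le)
  qed
  then have "F (r 0) \<subseteq># F (r 1)" by (simp add: subseteq_mset_def)
  moreover have "r 0 < r 1" using r(1) by (simp add: strict_mono_def)
  ultimately show ?thesis by blast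
qed

text \<open>Exponents are lifted to multisets of columns. Inclusion of multisets makes the
  difference of the exponents a sum of the remaining columns.\<close>

lemma admissible_wqo:
  assumes f: "\<And>k :: nat. admissible m n (f k)" and "1 \<le> m"
  shows "\<exists>i j. i < j \<and> admissible m n (f j - f i)"
proof -
  let ?A = "{J. J \<subseteq> {1..n} \<and> card J = m}"
  have "\<forall>k. \<exists>M. set_mset M \<subseteq> ?A \<and> f k = (\<Sum>J\<in>#M. diag_exp m J)"
    using admissible_generated[OF f \<open>1 \<le> m\<close>] by blast
  then obtain M where M: "\<And>k. set_mset (M k) \<subseteq> ?A" "\<And>k. f k = (\<Sum>J\<in>#M k. diag_exp m J)" by metis
  have "finite ?A" by (rule finite_subset[of _ "Pow {1..n}"]) auto
  then obtain i j where ij: "i < j" "M i \<subseteq># M j" using Dickson_multiset[of ?A M] M(1) by blast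
  then have "f j = f i + (\<Sum>J\<in>#M j - M i. diag_exp m J)"
    unfolding M(2) image_mset_union[symmetric] sum_mset.union[symmetric]
    by (simp add: subset_mset.add_diff_inverse)
  then have "f j - f i = (\<Sum>J\<in>#M j - M i. diag_exp m J)" by simp
  moreover have "admissible m n (\<Sum>J\<in>#N. diag_exp m J)" if "set_mset N \<subseteq> ?A" for N
    using that
  proof (induction N)
    case (add J N)
    then have "admissible m n (diag_exp m J)" by (intro admissible_diag_exp) auto
    then show ?case using add admissible_add by simp
  qed (simp add: admissible_0)
  moreover have "set_mset (M j - M i) \<subseteq> ?A" using M(1)[of j] in_diffD by fast
  ultimately show ?thesis using ij(1) by metis
qed

lemma nonneg_slope:
  fixes u :: "nat \<Rightarrow> int"
  assumes "\<And>k. 0 \<le> u k" "\<And>k. u (Suc k) = u k + d"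
  shows "0 \<le> d"
proof (rule ccontr)
  assume "\<not> 0 \<le> d"
  then have "u k \<le> u 0 - int k" for k using assms(2) by (induction k) auto
  from this[of "nat (u 0) + 1"] show False using assms(1)[of "nat (u 0) + 1"] assms(1)[of 0] by simp
qed

text \<open>A linear form that is nonnegative along the whole progression has nonnegative slope, and
  the slope is its value at \<open>g\<close>. The equations and the support conditions pass to
  \<open>g\<close> as a difference of two members.\<close>

lemma admissible_integrally_closed:
  assumes f: "\<And>k :: nat. admissible m n (f k)" and g: "\<And>k. f (Suc k) = f k + g"
  shows "admissible m n g"
proof -
  have 1: "0 \<le> lookup g (k, j)" for k j
  proof (rule nonneg_slope[of "\<lambda>r. lookup (f r) (k, j)"])
    show "0 \<le> lookup (f r) (k, j)" for r using f[of r] unfolding admissible_def by blast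
  qed (simp add: g lookup_add)
  have geq: "g = f 1 - f 0" using g[of 0] by simp
  have 2: "1 \<le> k \<and> k \<le> m \<and> 1 \<le> j \<and> j \<le> n" if "lookup g (k, j) \<noteq> 0" for k j
  proof -
    have "lookup (f 1) (k, j) \<noteq> 0 \<or> lookup (f 0) (k, j) \<noteq> 0"
      using that unfolding geq lookup_minus by auto
    then show ?thesis using f unfolding admissible_def by blast
  qed
  have 3: "interlaced n i g" if i: "1 \<le> i" "i < m" for i
  proof -
    have fi: "interlaced n i (f k)" for k using f i unfolding admissible_def by blast
    have "row_sum n g i = row_sum n g (Suc i)"
      using fi[of 0] fi[of 1] by (simp add: geq interlaced_def lookup_minus sum_subtractf)
    moreover have "0 \<le> (\<Sum>j\<in>{1..<l}. lookup g (i, j)) - (\<Sum>j\<in>{1..l}. lookup g (Suc i, j))" for l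
    proof (rule nonneg_slope[of "\<lambda>k. (\<Sum>j\<in>{1..<l}. lookup (f k) (i, j)) -
        (\<Sum>j\<in>{1..l}. lookup (f k) (Suc i, j))"])
      show "0 \<le> (\<Sum>j\<in>{1..<l}. lookup (f k) (i, j)) -
        (\<Sum>j\<in>{1..l}. lookup (f k) (Suc i, j))" for k
        using fi[of k] unfolding interlaced_def by simp
    qed (simp add: g lookup_add sum.distrib)
    ultimately show ?thesis unfolding interlaced_def by simp
  qed
  show ?thesis unfolding admissible_def using 1 2 3 by blast
qed

section \<open>Evaluation on the free algebra\<close>

lemma poly_mapping_monomials:
  "p = (\<Sum>w\<in>keys p. single w (lookup p w))"
proof (rule poly_mapping_eqI)
  fix k
  have "lookup (\<Sum>w\<in>keys p. single w (lookup p w)) k =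
      (\<Sum>w\<in>keys p. if w = k then lookup p w else 0)"
    unfolding lookup_sum by (intro sum.cong) (auto simp: lookup_single when_def)
  also have "\<dots> = lookup p k" by (auto simp: sum.delta' in_keys_iff)
  finally show "lookup p k =
      lookup (\<Sum>w\<in>keys p. single w (lookup p w)) k"
    by (rule sym)
qed

lemma scal_simps: "scal (c + d) = scal c + scal d" "scal (c * d) = scal c * scal d"
    "scal 1 = 1" "scal 0 = 0" "scal (c - d) = scal c - scal d"
  by (simp_all add: scal_def single_add mult_single single_diff)

lemma scal_central:
  fixes c :: "'k::field"
  shows "p * scal c = scal c * p"
proof -
  have "p * scal c = (\<Sum>w\<in>keys p. single w (lookup p w) * scal c)"
    by (subst poly_mapping_monomials[of p]) (simp add: sum_distrib_right)
  also have "\<dots> = (\<Sum>w\<in>keys p. scal c * single w (lookup p w))"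
    by (simp add: scal_def mult_single mult.commute)
  also have "\<dots> = scal c * p"
    by (subst (3) poly_mapping_monomials[of p]) (simp add: sum_distrib_left)
  finally show ?thesis .
qed

text \<open>Makes spans and \<open>straightening\<close> available in the free algebra, where
  congruences modulo the ideal will be handled.\<close>

interpretation F: algebra "\<lambda>(c :: 'k::field) (p :: 'i free_monoid \<Rightarrow>\<^sub>0 'k). scal c * p"
proof
  show "p * (scal c * r) = scal c * (p * r)" for p r :: "'i free_monoid \<Rightarrow>\<^sub>0 'k" and c
    using scal_central[of p c] by (metis mult.assoc)
qed (simp_all add: scal_simps algebra_simps)

context algebra begin

definition eval_free :: "('i \<Rightarrow> 'r) \<Rightarrow> ('i free_monoid \<Rightarrow>\<^sub>0 'k) \<Rightarrow> 'r"
  where "eval_free X p = (\<Sum>w\<in>keys p. lookup p w *s ev X (letters w))"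

lemma eval_free_superset:
  assumes "finite S" "keys p \<subseteq> S"
  shows "eval_free X p = (\<Sum>w\<in>S. lookup p w *s ev X (letters w))"
  unfolding eval_free_def using assms by (intro sum.mono_neutral_left) (auto simp: in_keys_iff)

lemma eval_free_add: "eval_free X (p + r) = eval_free X p + eval_free X r"
proof -
  let ?S = "keys p \<union> keys r"
  have "keys (p + r) \<subseteq> ?S" by (rule keys_add)
  then have "eval_free X (p + r) = (\<Sum>w\<in>?S. lookup (p + r) w *s ev X (letters w))"
    by (intro eval_free_superset) auto
  also have "\<dots> = eval_free X p + eval_free X r"
    by (subst (1 2) eval_free_superset[of ?S]) (auto simp: lookup_add scale_left_distrib sum.distrib)
  finally show ?thesis .
qed

lemma eval_free_zero: "eval_free X 0 = 0"
  by (simp add: eval_free_def)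

lemma eval_free_sum: "eval_free X (sum f A) = (\<Sum>a\<in>A. eval_free X (f a))"
  by (induction A rule: infinite_finite_induct) (simp_all add: eval_free_zero eval_free_add)

lemma eval_free_uminus: "eval_free X (- p) = - eval_free X p"
  by (metis add.right_inverse add_eq_0_iff eval_free_add eval_free_zero)

lemma eval_free_diff: "eval_free X (p - r) = eval_free X p - eval_free X r"
  by (metis diff_conv_add_uminus eval_free_add eval_free_uminus)

lemma eval_free_single: "eval_free X (single w c) = c *s ev X (letters w)"
  by (subst eval_free_superset[of "{w}"]) auto

lemma eval_free_mult: "eval_free X (p * r) = eval_free X p * eval_free X r"
proof -
  let ?P = "lookup p" and ?R = "lookup r"
  have "p * r = (\<Sum>v\<in>keys p. \<Sum>w\<in>keys r. single (v + w) (?P v * ?R w))"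
    by (subst poly_mapping_monomials[of p], subst poly_mapping_monomials[of r])
      (simp add: sum_product mult_single)
  then have "eval_free X (p * r) =
      (\<Sum>v\<in>keys p. \<Sum>w\<in>keys r. (?P v * ?R w) *s (ev X (letters v) * ev X (letters w)))"
    by (simp add: eval_free_sum eval_free_single plus_free_monoid_def)
  also have "\<dots> = eval_free X p * eval_free X r"
    by (simp add: eval_free_def sum_product scale_simps mult.commute)
  finally show ?thesis .
qed

lemma eval_free_scal: "eval_free X (scal c) = c *s 1"
  by (simp add: scal_def eval_free_single zero_free_monoid_def)

lemma eval_free_one: "eval_free X 1 = 1"
  using eval_free_scal[of X 1] by (simp add: scal_simps)

lemma eval_free_var: "eval_free X (var i) = X i"
  by (simp add: var_def eval_free_single)

lemma eval_free_prod_list: "eval_free X (prod_list ps) = prod_list (map (eval_free X) ps)"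
  by (induction ps) (simp_all add: eval_free_one eval_free_mult)

end

lemma prod_list_var: "prod_list (map var w) = single (Word w) 1"
  by (induction w) (simp_all add: var_def mult_single plus_free_monoid_def single_one[symmetric]
      zero_free_monoid_def del: single_one)

section \<open>A basis of the algebra of quantum matrices\<close>

locale qmatrices = quantum_torus q m n for q :: "'k::field" and m n
begin

definition FR :: "((nat \<times> nat) free_monoid \<Rightarrow>\<^sub>0 'k) ring" where "FR = qmat_free m n"

abbreviation (input) MQ where "MQ \<equiv> qmat q m n"
abbreviation (input) GQ where "GQ \<equiv> qgrass q m n"

abbreviation C :: "((nat \<times> nat) free_monoid \<Rightarrow>\<^sub>0 'k) set" where "C \<equiv> carrier FR"
abbreviation J :: "((nat \<times> nat) free_monoid \<Rightarrow>\<^sub>0 'k) set" where "J \<equiv> qmat_ideal q m n"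
abbreviation \<Phi> where "\<Phi> \<equiv> E.eval_free (\<lambda>(i, j). X m i j)"

lemma FR_simps: "\<zero>\<^bsub>FR\<^esub> = 0" "\<one>\<^bsub>FR\<^esub> = 1"
  "x \<oplus>\<^bsub>FR\<^esub> y = x + y" "x \<otimes>\<^bsub>FR\<^esub> y = x * y"
  by (simp_all add: FR_def free_algebra_def)

interpretation FA: ring FR
  unfolding FR_def by (rule ring_free_algebra)

interpretation J: ideal J FR
  unfolding FR_def by (rule ideal_qmat_ideal)

lemma uminus_closed: "p \<in> C \<Longrightarrow> - p \<in> C"
  by (simp add: FR_def free_algebra_def keys_minus)

lemma a_inv_free: "p \<in> C \<Longrightarrow> \<ominus>\<^bsub>FR\<^esub> p = - p"
  using FA.minus_equality[of "- p" p] uminus_closed by (simp add: FR_simps)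

lemma a_minus_free: "\<lbrakk>p \<in> C; r \<in> C\<rbrakk> \<Longrightarrow> p \<ominus>\<^bsub>FR\<^esub> r = p - r"
  by (simp add: a_minus_def a_inv_free FR_simps)

lemma C_closed: "0 \<in> C" "1 \<in> C" "\<lbrakk>p \<in> C; r \<in> C\<rbrakk> \<Longrightarrow> p + r \<in> C" "\<lbrakk>p \<in> C; r \<in> C\<rbrakk> \<Longrightarrow> p * r \<in> C"
  "\<lbrakk>p \<in> C; r \<in> C\<rbrakk> \<Longrightarrow> p - r \<in> C" "scal c \<in> C"
  using FA.zero_closed FA.one_closed FA.a_closed[of p r] FA.m_closed[of p r] minus_in_carrier[of p _ r] scal_in_carrier
  by (simp_all add: FR_simps) (simp_all add: FR_def)

lemma C_sum: "(\<And>a. a \<in> A \<Longrightarrow> f a \<in> C) \<Longrightarrow> sum f A \<in> C"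
  by (induction A rule: infinite_finite_induct) (auto intro: C_closed)

lemma C_prod_list: "set ps \<subseteq> C \<Longrightarrow> prod_list ps \<in> C"
  by (induction ps) (auto intro: C_closed)

lemma J_closed: "J \<subseteq> C" "0 \<in> J" "\<lbrakk>p \<in> J; r \<in> J\<rbrakk> \<Longrightarrow> p + r \<in> J" "p \<in> J \<Longrightarrow> - p \<in> J"
  "\<lbrakk>p \<in> J; r \<in> J\<rbrakk> \<Longrightarrow> p - r \<in> J"
  "\<lbrakk>p \<in> J; r \<in> C\<rbrakk> \<Longrightarrow> p * r \<in> J" "\<lbrakk>p \<in> J; r \<in> C\<rbrakk> \<Longrightarrow> r * p \<in> J"
proof -
  show "J \<subseteq> C" by (rule J.a_subset)
  then have u: "p \<in> J \<Longrightarrow> - p \<in> J" for p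
    using J.a_inv_closed[of p] a_inv_free[of p] by (metis subsetD)
  have a: "\<lbrakk>p \<in> J; r \<in> J\<rbrakk> \<Longrightarrow> p + r \<in> J" for p r using J.a_closed[of p r] by (simp add: FR_simps)
  show "0 \<in> J" using J.zero_closed by (simp add: FR_simps)
  show "\<lbrakk>p \<in> J; r \<in> J\<rbrakk> \<Longrightarrow> p + r \<in> J" by (rule a)
  show "p \<in> J \<Longrightarrow> - p \<in> J" by (rule u)
  show "\<lbrakk>p \<in> J; r \<in> J\<rbrakk> \<Longrightarrow> p - r \<in> J" using a[of p "- r"] u by simp
  show "\<lbrakk>p \<in> J; r \<in> C\<rbrakk> \<Longrightarrow> p * r \<in> J" using J.I_r_closed[of p r] by (simp add: FR_simps)
  show "\<lbrakk>p \<in> J; r \<in> C\<rbrakk> \<Longrightarrow> r * p \<in> J" using J.I_l_closed[of p r] by (simp add: FR_simps)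
qed

lemma rels_in_C: "qmat_rels q m n \<subseteq> C"
  unfolding FR_def by (rule qmat_rels_subset_carrier)

lemma rels_in_J: "qmat_rels q m n \<subseteq> J"
  unfolding qmat_ideal_def FR_def[symmetric] by (rule FA.genideal_self[OF rels_in_C])

text \<open>The elements of the free algebra killed by evaluation form an ideal, and this ideal
  contains the relations because the operators \<open>X m i j\<close> form a quantum matrix.\<close>

lemma \<Phi>_J: assumes "p \<in> J" shows "\<Phi> p = 0"
proof -
  let ?K = "{p \<in> C. \<Phi> p = 0}"
  have "ideal ?K FR"
  proof (rule idealI)
    show "subgroup ?K (add_monoid FR)"
    proof (rule FA.add.subgroupI)
      show "?K \<noteq> {}" using C_closed(1) E.eval_free_zero by blast
      fix a assume "a \<in> ?K"
      then show "\<ominus>\<^bsub>FR\<^esub> a \<in> ?K"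
        by (simp add: a_inv_free uminus_closed E.eval_free_uminus)
    qed (auto simp: FR_simps E.eval_free_add C_closed)
  qed (auto simp: FR_simps E.eval_free_mult C_closed FA.ring_axioms)
  moreover have "qmat_rels q m n \<subseteq> ?K"
  proof
    fix r assume r: "r \<in> qmat_rels q m n"
    then have "\<Phi> r = 0"
      unfolding qmat_rels_def
      by (auto simp: E.eval_free_diff E.eval_free_mult E.eval_free_var E.eval_free_scal E.mult_scale_left
          Q.row Q.col Q.swap_anti Q.diag)
    then show "r \<in> ?K" using r rels_in_C by blast
  qed
  ultimately have "J \<subseteq> ?K" unfolding qmat_ideal_def FR_def[symmetric] by (rule FA.genideal_minimal)
  then show ?thesis using assms by blast
qed

section \<open>Sorted words span modulo the relations\<close>

definition L :: "(nat \<times> nat) set" where "L = {1..m} \<times> {1..n}"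

abbreviation sorted_words :: "(nat \<times> nat) list set"
  where "sorted_words \<equiv> {w \<in> lists L. successively (\<le>) w}"

lemma ev_var_in_C: "w \<in> lists L \<Longrightarrow> F.ev var w \<in> C"
  unfolding FR_def L_def by (rule C_prod_list[unfolded FR_def]) (auto intro: var_in_carrier)

lemma straighten_entries:
  assumes "g \<in> L" "h \<in> L" "\<not> g \<le> h"
  shows "\<exists>s\<in>F.span {var a * var b | a b. a \<in> L \<and> b \<in> L \<and> a < g}. var g * var h - s \<in> J"
proof -
  obtain k l i j where g: "g = (k, l)" and h: "h = (i, j)" by (cases g; cases h)
  have r: "1 \<le> k" "k \<le> m" "1 \<le> l" "l \<le> n" "1 \<le> i" "i \<le> m" "1 \<le> j" "j \<le> n"
    using assms by (auto simp: g h L_def)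
  define S where "S = F.span {var a * (var b :: _ \<Rightarrow>\<^sub>0 'k) | a b. a \<in> L \<and> b \<in> L \<and> a < g}"
  have S: "qX i' j' * qX k' l' \<in> S"
    if "i' \<in> {1..m}" "k' \<in> {1..m}" "j' \<in> {1..n}" "l' \<in> {1..n}" "(i', j') < g" for i' j' k' l'
    unfolding S_def using that by (intro F.span_base) (auto simp: L_def)
  have scale: "scal c * u \<in> S" if "u \<in> S" for c u using that F.span_scale unfolding S_def by blast
  have diff: "u - v \<in> S" if "u \<in> S" "v \<in> S" for u v using that F.span_diff unfolding S_def by blast
  \<comment> \<open>Row and column relations say that \<open>v\<close> is \<open>q\<close> times
    \<open>u\<close> modulo \<open>J\<close>, with \<open>u\<close> the unsorted product; solving
    for \<open>u\<close> uses that \<open>q\<close> is invertible.\<close>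
  have q_case: "\<exists>s\<in>S. u - s \<in> J"
    if "v - scal q * u \<in> J" "v \<in> S" for u v :: "(nat \<times> nat) free_monoid \<Rightarrow>\<^sub>0 'k"
  proof -
    have "- (scal (inverse q) * (v - scal q * u)) \<in> J"
      using that C_closed(6) J_closed(4,7) by blast
    also have "- (scal (inverse q) * (v - scal q * u)) = u - scal (inverse q) * v"
      by (simp add: right_diff_distrib q_nonzero)
    finally show ?thesis using scale[OF that(2)] by blast
  qed
  consider (row) "k = i" "j < l" | (col) "i < k" "j = l" | (anti) "i < k" "l < j" | (diag) "i < k" "j < l"
    using assms(3) unfolding g h by (auto simp: not_le) (metis linorder_neqE_nat)+
  then have "\<exists>s\<in>S. var g * var h - s \<in> J"
  proof cases
    case row
    have "qX i j * qX i l - scal q * qX i l * qX i j \<in> qmat_rels q m n"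
      unfolding qmat_rels_def using r row by blast
    then have "qX i j * qX i l - scal q * (qX i l * qX i j) \<in> J" using rels_in_J by (auto simp: mult.assoc)
    moreover have "qX i j * qX i l \<in> S" using r row by (intro S) (auto simp: g)
    ultimately show ?thesis unfolding g h row(1) by (rule q_case)
  next
    case col
    have "qX i j * qX k j - scal q * qX k j * qX i j \<in> qmat_rels q m n"
      unfolding qmat_rels_def using r col by blast
    then have "qX i j * qX k j - scal q * (qX k j * qX i j) \<in> J" using rels_in_J by (auto simp: mult.assoc)
    moreover have "qX i j * qX k j \<in> S" using r col by (intro S) (auto simp: g)
    ultimately show ?thesis unfolding g h col(2)[symmetric] by (rule q_case)
  next
    case anti
    have "qX i j * qX k l - qX k l * qX i j \<in> qmat_rels q m n"
      unfolding qmat_rels_def using r anti by blast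
    then have "- (qX i j * qX k l - qX k l * qX i j) \<in> J" using rels_in_J J_closed(4) by blast
    then have "var g * var h - qX i j * qX k l \<in> J" by (simp add: g h)
    moreover have "qX i j * qX k l \<in> S" using r anti by (intro S) (auto simp: g)
    ultimately show ?thesis by blast
  next
    case diag
    have "qX i j * qX k l - qX k l * qX i j - scal (q - inverse q) * qX i l * qX k j \<in> qmat_rels q m n"
      unfolding qmat_rels_def using r diag by blast
    then have "- (qX i j * qX k l - qX k l * qX i j - scal (q - inverse q) * qX i l * qX k j) \<in> J"
      using rels_in_J J_closed(4) by blast
    then have "var g * var h - (qX i j * qX k l - scal (q - inverse q) * (qX i l * qX k j)) \<in> J"
      by (simp add: g h algebra_simps)
    moreover have "qX i j * qX k l - scal (q - inverse q) * (qX i l * qX k j) \<in> S"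
      using r diag by (intro diff scale S) (auto simp: g)
    ultimately show ?thesis by blast
  qed
  then show ?thesis unfolding S_def .
qed

text \<open>Straightening takes place in the free algebra with \<open>N = J\<close>, so a rewriting
  step need only be correct up to the ideal.\<close>

lemma spanning:
  assumes p: "p \<in> C"
  shows "\<exists>s\<in>F.span (F.ev var ` sorted_words). p - s \<in> J"
proof -
  define S where "S = {p. \<exists>s\<in>F.span (F.ev var ` sorted_words). p - s \<in> J}"
  have sub: "F.subspace S"
  proof (rule F.subspaceI)
    show "0 \<in> S" unfolding S_def using F.span_zero J_closed(2) by force
  next
    fix x y assume "x \<in> S" "y \<in> S"
    then obtain s t where st: "s \<in> F.span (F.ev var ` sorted_words)" "x - s \<in> J"
      "t \<in> F.span (F.ev var ` sorted_words)" "y - t \<in> J" unfolding S_def by blast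
    have "x + y - (s + t) = (x - s) + (y - t)" by simp
    also have "\<dots> \<in> J" using st J_closed(3) by blast
    finally show "x + y \<in> S" unfolding S_def using F.span_add[OF st(1,3)] by blast
  next
    fix c x assume "x \<in> S"
    then obtain s where s: "s \<in> F.span (F.ev var ` sorted_words)" "x - s \<in> J" unfolding S_def by blast
    have "scal c * x - scal c * s = scal c * (x - s)" by (simp add: right_diff_distrib)
    also have "\<dots> \<in> J" using s(2) J_closed(7) C_closed(6) by blast
    finally show "scal c * x \<in> S" unfolding S_def using F.span_scale[OF s(1)] by blast
  qed
  have w: "F.ev var w \<in> S" if "w \<in> lists L" for w
  proof (rule F.straightening[OF sub, where N = J and X = var and good = "(\<le>)", OF _ _ _ that])
    show "F.ev var u * r * F.ev var v \<in> S" if "r \<in> J" "u \<in> lists L" "v \<in> lists L" for r u v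
    proof -
      have "F.ev var u * r * F.ev var v - 0 \<in> J" using that ev_var_in_C J_closed(6,7) by simp
      then show ?thesis unfolding S_def using F.span_zero by blast
    qed
    show "F.ev var w \<in> S" if "w \<in> lists L" "successively (\<le>) w" for w
    proof -
      have "F.ev var w \<in> F.span (F.ev var ` sorted_words)" using that by (intro F.span_base) blast
      moreover have "F.ev var w - F.ev var w \<in> J" using J_closed(2) by simp
      ultimately show ?thesis unfolding S_def by blast
    qed
  qed (rule straighten_entries)
  have "p = (\<Sum>w\<in>keys p. scal (lookup p w) * F.ev var (letters w))"
    by (subst poly_mapping_monomials) (simp add: prod_list_var scal_def mult_single)
  also have "\<dots> \<in> S"
    using p by (intro F.subspace_sum[OF sub] F.subspace_scale[OF sub] w) (auto simp: FR_def L_def free_algebra_def)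
  finally show ?thesis unfolding S_def by blast
qed

abbreviation entries_exp :: "(nat \<times> nat) list \<Rightarrow> exponent"
  where "entries_exp w \<equiv> sum_list (map (\<lambda>g. single g 1) w)"

lemma lookup_entries_exp: "lookup (entries_exp w) g = int (count (mset w) g)"
  by (induction w) (auto simp: lookup_add lookup_single when_def)

lemma entries_exp_inj: "inj_on entries_exp sorted_words"
proof (rule inj_onI)
  fix v w assume vw: "v \<in> sorted_words" "w \<in> sorted_words" "entries_exp v = entries_exp w"
  then have "mset v = mset w"
    using lookup_entries_exp by (intro multiset_eqI) (metis of_nat_eq_iff)
  moreover have "sorted v" "sorted w"
    using vw by (auto simp: successively_iff_sorted_wrt_strong)
  ultimately show "v = w" using properties_for_sort by metis
qed

text \<open>Modulo \<open>J\<close>, \<open>p\<close> is a nonzero combination of sorted words, and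
  their images have distinct leading exponents. Evaluation is thus injective modulo
  \<open>J\<close>, which gives the basis of ordered monomials.\<close>

lemma lead_\<Phi>:
  assumes p: "p \<in> C" "p \<notin> J"
  shows "\<exists>w\<in>sorted_words. lead (\<Phi> p) (entries_exp w)"
proof -
  obtain s where s: "s \<in> F.span (F.ev var ` sorted_words)" "p - s \<in> J" using spanning p by blast
  have "\<Phi> (p - s) = 0" using \<Phi>_J s by blast
  then have eq: "\<Phi> p = \<Phi> s" by (simp add: E.eval_free_diff)
  have "s \<noteq> 0" using s p by auto
  have keys: "keys s \<subseteq> Word ` sorted_words"
    using s(1)
  proof (induction rule: F.span_induct_alt)
    case (step c x y)
    then obtain w where w: "w \<in> sorted_words" "x = single (Word w) 1" by (auto simp: prod_list_var)
    have "scal c * x = single (Word w) c" by (simp add: w scal_def mult_single)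
    then show ?case
      using keys_add[of "scal c * x" y] step w(1) by (auto split: if_splits)
  qed simp
  have "\<exists>v\<in>keys s. lead (\<Sum>v\<in>keys s. escale (lookup s v)
      (E.ev (\<lambda>(i, j). X m i j) (letters v))) (entries_exp (letters v))"
  proof (rule lead_sum)
    show "keys s \<noteq> {}" using \<open>s \<noteq> 0\<close> by simp
    show "inj_on (\<lambda>v. entries_exp (letters v)) (keys s)"
    proof (rule inj_onI)
      fix u v assume uv: "u \<in> keys s" "v \<in> keys s"
        "entries_exp (letters u) = entries_exp (letters v)"
      then obtain u' v' where w: "u = Word u'" "v = Word v'" "u' \<in> sorted_words" "v' \<in> sorted_words"
        using keys by blast
      then show "u = v" using inj_onD[OF entries_exp_inj, of u' v'] uv(3) by simp
    qed
    show "lead (E.ev (\<lambda>(i, j). X m i j) (letters v)) (entries_exp (letters v)) \<and> lookup s v \<noteq> 0"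
      if "v \<in> keys s" for v
    proof -
      have "letters v \<in> lists L" using keys that by auto
      then have "\<And>g. g \<in> set (letters v) \<Longrightarrow> g \<in> L" by auto
      then show ?thesis using that by (intro conjI lead_ev) (auto simp: in_keys_iff L_def intro!: lead_X)
    qed
  qed simp
  then have "\<exists>v\<in>keys s. lead (\<Phi> s) (entries_exp (letters v))"
    by (simp add: E.eval_free_def)
  then show ?thesis using keys eq by fastforce
qed

section \<open>The quantum grassmannian\<close>

abbreviation cls where "cls \<equiv> qmat_class q m n"

interpretation A: ring "MQ"
  unfolding qmat_def FR_def[symmetric] by (rule J.quotient_is_ring)

lemma cls_hom: "cls \<in> ring_hom FR (MQ)"
  using J.rcos_ring_hom unfolding qmat_class_def[abs_def] qmat_def FR_def .

lemma cls_simps: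
  "cls 1 = \<one>\<^bsub>MQ\<^esub>" "\<lbrakk>p \<in> C; r \<in> C\<rbrakk> \<Longrightarrow> cls (p + r) = cls p \<oplus>\<^bsub>MQ\<^esub> cls r"
  "\<lbrakk>p \<in> C; r \<in> C\<rbrakk> \<Longrightarrow> cls (p * r) = cls p \<otimes>\<^bsub>MQ\<^esub> cls r" "p \<in> C \<Longrightarrow> cls p \<in> carrier (MQ)"
  using ring_hom_one[OF cls_hom] ring_hom_add[OF cls_hom, of p r] ring_hom_mult[OF cls_hom, of p r]
    ring_hom_closed[OF cls_hom, of p] by (simp_all add: FR_simps)

lemma cls_zero: "cls 0 = \<zero>\<^bsub>MQ\<^esub>"
  using ring_hom_zero[OF cls_hom FA.ring_axioms A.ring_axioms] by (simp add: FR_simps)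

lemma carrier_qmat: "x \<in> carrier (MQ) \<Longrightarrow> \<exists>p\<in>C. x = cls p"
  unfolding qmat_def FactRing_def A_RCOSETS_def' qmat_class_def FR_def by auto

lemma cls_eq_iff: "\<lbrakk>p \<in> C; r \<in> C\<rbrakk> \<Longrightarrow> cls p = cls r \<longleftrightarrow> p - r \<in> J"
proof -
  assume pr: "p \<in> C" "r \<in> C"
  have "p - r \<in> J \<longleftrightarrow> p \<in> J +>\<^bsub>FR\<^esub> r"
    using J.a_rcos_module_minus[OF FA.ring_axioms pr(2,1)] a_minus_free[OF pr] by simp
  also have "\<dots> \<longleftrightarrow> cls p = cls r"
    unfolding qmat_class_def FR_def[symmetric]
    using J.a_repr_independence'[of p r] J.a_rcos_self[of p] pr by blast
  finally show ?thesis by blast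
qed

text \<open>The map induced by \<open>\<Phi>\<close> on cosets; it does not depend on the chosen
  representative because \<open>\<Phi>\<close> vanishes on \<open>J\<close>.\<close>

definition \<psi> where "\<psi> x = \<Phi> (SOME p. p \<in> C \<and> cls p = x)"

lemma \<psi>_cls: "p \<in> C \<Longrightarrow> \<psi> (cls p) = \<Phi> p"
proof -
  assume p: "p \<in> C"
  define r where "r = (SOME r. r \<in> C \<and> cls r = cls p)"
  have "r \<in> C \<and> cls r = cls p" unfolding r_def by (rule someI[of _ p]) (use p in simp)
  then have "\<Phi> (r - p) = 0" using \<Phi>_J cls_eq_iff p by blast
  then show ?thesis by (simp add: \<psi>_def r_def E.eval_free_diff)
qed

lemma \<psi>_simps:
  "\<psi> \<one>\<^bsub>MQ\<^esub> = 1" "\<psi> \<zero>\<^bsub>MQ\<^esub> = 0"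
  "\<lbrakk>x \<in> carrier (MQ); y \<in> carrier (MQ)\<rbrakk> \<Longrightarrow> \<psi> (x \<oplus>\<^bsub>MQ\<^esub> y) = \<psi> x + \<psi> y"
  "\<lbrakk>x \<in> carrier (MQ); y \<in> carrier (MQ)\<rbrakk> \<Longrightarrow> \<psi> (x \<otimes>\<^bsub>MQ\<^esub> y) = \<psi> x * \<psi> y"
proof -
  show "\<psi> \<one>\<^bsub>MQ\<^esub> = 1" using \<psi>_cls[of 1] cls_simps(1) C_closed(2) by (simp add: E.eval_free_one)
  show "\<psi> \<zero>\<^bsub>MQ\<^esub> = 0" using \<psi>_cls[of 0] cls_zero C_closed(1) by (simp add: E.eval_free_zero)
  assume "x \<in> carrier (MQ)" "y \<in> carrier (MQ)"
  then obtain p r where pr: "p \<in> C" "r \<in> C" "x = cls p" "y = cls r" using carrier_qmat by metis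
  show "\<psi> (x \<oplus>\<^bsub>MQ\<^esub> y) = \<psi> x + \<psi> y"
    using pr by (simp add: cls_simps(2)[symmetric] \<psi>_cls C_closed E.eval_free_add)
  show "\<psi> (x \<otimes>\<^bsub>MQ\<^esub> y) = \<psi> x * \<psi> y"
    using pr by (simp add: cls_simps(3)[symmetric] \<psi>_cls C_closed E.eval_free_mult)
qed

lemma \<psi>_lead:
  assumes "x \<in> carrier (MQ)" "x \<noteq> \<zero>\<^bsub>MQ\<^esub>"
  shows "\<exists>w\<in>sorted_words. lead (\<psi> x) (entries_exp w)"
proof -
  obtain p where p: "p \<in> C" "x = cls p" using assms carrier_qmat by blast
  then have "p \<notin> J" using assms(2) cls_eq_iff[of p 0] C_closed(1) cls_zero by auto
  then show ?thesis using lead_\<Phi> p by (simp add: \<psi>_cls)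
qed

lemma \<psi>_uminus:
  assumes "x \<in> carrier (MQ)" shows "\<psi> (\<ominus>\<^bsub>MQ\<^esub> x) = - \<psi> x"
proof -
  have "\<psi> (\<ominus>\<^bsub>MQ\<^esub> x) + \<psi> x = 0"
    using assms by (simp add: \<psi>_simps(3)[symmetric] A.l_neg \<psi>_simps(2))
  then show ?thesis by (simp add: eq_neg_iff_add_eq_0)
qed

text \<open>A nonzero difference would have a leading exponent, but the zero operator has none.
  Identities in the quotient may hence be checked on operators.\<close>

lemma \<psi>_inj:
  assumes "x \<in> carrier (MQ)" "y \<in> carrier (MQ)" "\<psi> x = \<psi> y"
  shows "x = y"
proof (rule ccontr)
  assume "x \<noteq> y"
  then have "x \<ominus>\<^bsub>MQ\<^esub> y \<noteq> \<zero>\<^bsub>MQ\<^esub>" using assms by (simp add: A.r_right_minus_eq)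
  then have "\<exists>s. lead (\<psi> (x \<ominus>\<^bsub>MQ\<^esub> y)) s" using \<psi>_lead assms by blast
  moreover have "\<psi> (x \<ominus>\<^bsub>MQ\<^esub> y) = 0" using assms by (simp add: a_minus_def \<psi>_simps \<psi>_uminus)
  ultimately show False using lead_nonzero by blast
qed

definition generators where "generators =
  range (\<lambda>c. cls (scal c)) \<union> {qminor q m n J | J. J \<subseteq> {1..n} \<and> card J = m}"

lemma qminor_poly_in_C:
  assumes I: "I \<subseteq> {1..n}" "card I = m"
  shows "(\<Sum>\<sigma> | \<sigma> permutes {1..m}. scal ((- q) ^ perm_length m \<sigma>) *
       prod_list (map (\<lambda>i. qX i (sorted_list_of_set I ! (\<sigma> i - 1))) [1..<Suc m])) \<in> C"
proof (intro C_sum C_closed C_prod_list subsetI)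
  fix \<sigma> and x :: "(nat \<times> nat) free_monoid \<Rightarrow>\<^sub>0 'k"
  assume \<sigma>: "\<sigma> \<in> {\<sigma>. \<sigma> permutes {1..m}}"
    and "x \<in> set (map (\<lambda>i. qX i (sorted_list_of_set I ! (\<sigma> i - 1))) [1..<Suc m])"
  then obtain i where i: "i \<in> {1..m}" "x = qX i (sorted_list_of_set I ! (\<sigma> i - 1))" by fastforce
  then have "\<sigma> i \<in> {1..m}" using \<sigma> permutes_in_image by fastforce
  then show "x \<in> C" using i sorted_list_nth(1)[OF I, of "\<sigma> i"] unfolding FR_def by (auto intro: var_in_carrier)
qed

lemma qminor_closed: "\<lbrakk>I \<subseteq> {1..n}; card I = m\<rbrakk> \<Longrightarrow> qminor q m n I \<in> carrier (MQ)"
  unfolding qminor_def using cls_simps(4) qminor_poly_in_C by blast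

lemma \<psi>_qminor:
  assumes "I \<subseteq> {1..n}" "card I = m"
  shows "\<psi> (qminor q m n I) = Q.max_minor I"
  unfolding qminor_def \<psi>_cls[OF qminor_poly_in_C[OF assms]] Q.max_minor_def Q.row_product_def
  by (simp add: E.eval_free_sum E.eval_free_mult E.eval_free_scal E.eval_free_prod_list E.eval_free_var
      E.mult_scale_left comp_def del: upt_Suc)

lemma \<psi>_scal: "\<psi> (cls (scal c)) = escale c 1"
  using \<psi>_cls[OF C_closed(6)] by (simp add: E.eval_free_scal)

abbreviation G where "G \<equiv> qgrass_carrier q m n"

lemma G_def: "G = generate_ring (MQ) generators"
  by (simp add: qgrass_carrier_def generators_def)

lemma generators_closed: "generators \<subseteq> carrier (MQ)"
  unfolding generators_def using cls_simps(4) C_closed(6) qminor_closed by auto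

lemma G_closed: "x \<in> G \<Longrightarrow> x \<in> carrier (MQ)"
  using A.generate_ring_in_carrier[OF generators_closed] unfolding G_def by blast

interpretation R: ring "GQ"
  unfolding qgrass_def G_def
  by (rule A.subring_is_ring) (rule A.generate_ring_is_subring[OF generators_closed])

lemma qgrass_simps: "carrier (GQ) = G" "\<one>\<^bsub>GQ\<^esub> = \<one>\<^bsub>MQ\<^esub>" "\<zero>\<^bsub>GQ\<^esub> = \<zero>\<^bsub>MQ\<^esub>"
  "x \<oplus>\<^bsub>GQ\<^esub> y = x \<oplus>\<^bsub>MQ\<^esub> y" "x \<otimes>\<^bsub>GQ\<^esub> y = x \<otimes>\<^bsub>MQ\<^esub> y"
  by (simp_all add: qgrass_def)

text \<open>Maximal minors lie in the span by pairing permutations, and the span is a subalgebra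
  because words can be concatenated.\<close>

lemma \<psi>_in_span:
  assumes x: "x \<in> G" and i: "1 \<le> i" "i < m"
  shows "\<psi> x \<in> E.span (E.ev Q.gen ` lists (letters_at m n i))" (is "_ \<in> ?S")
proof -
  have one: "1 \<in> ?S" by (rule E.span_base) (auto intro!: image_eqI[of _ _ "[]"])
  have mult: "a * b \<in> ?S" if "a \<in> ?S" "b \<in> ?S" for a b
  proof -
    have "{a * b |a b. a \<in> E.ev Q.gen ` lists (letters_at m n i) \<and> b \<in> E.ev Q.gen ` lists (letters_at m n i)}
      \<subseteq> E.ev Q.gen ` lists (letters_at m n i)"
    proof
      fix z assume "z \<in> {a * b |a b. a \<in> E.ev Q.gen ` lists (letters_at m n i) \<and> b \<in> E.ev Q.gen ` lists (letters_at m n i)}"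
      then obtain u v where uv: "u \<in> lists (letters_at m n i)" "v \<in> lists (letters_at m n i)"
        "z = E.ev Q.gen u * E.ev Q.gen v" by blast
      then show "z \<in> E.ev Q.gen ` lists (letters_at m n i)"
        by (intro image_eqI[of _ _ "u @ v"]) auto
    qed
    then show ?thesis using E.span_mult[OF that] E.span_mono by blast
  qed
  show ?thesis
    using x unfolding G_def
  proof (induction rule: generate_ring.induct)
    case one
    then show ?case using \<open>1 \<in> ?S\<close> by (simp add: \<psi>_simps)
  next
    case (incl h)
    then consider c where "h = cls (scal c)" | I where "h = qminor q m n I" "I \<subseteq> {1..n}" "card I = m"
      unfolding generators_def by blast
    then show ?case
    proof cases
      case 1
      then show ?thesis using \<open>1 \<in> ?S\<close> by (simp add: \<psi>_scal E.span_scale)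
    next
      case 2
      then show ?thesis using Q.max_minor_in_span[OF _ _ i] by (simp add: \<psi>_qminor)
    qed
  next
    case (a_inv h)
    then show ?case using G_closed by (simp add: \<psi>_uminus G_def E.span_neg)
  next
    case (eng_add h1 h2)
    then show ?case using G_closed by (simp add: \<psi>_simps G_def E.span_add)
  next
    case (eng_mult h1 h2)
    then show ?case using G_closed mult by (simp add: \<psi>_simps G_def)
  qed
qed

text \<open>Sorted words give nonnegativity and support. Each pair of adjacent rows gives its own
  interlaced leading exponent; by uniqueness all of these are the same one.\<close>

lemma lead_admissible:
  assumes x: "x \<in> G" "x \<noteq> \<zero>\<^bsub>MQ\<^esub>"
  shows "\<exists>s. lead (\<psi> x) s \<and> admissible m n s"
proof -
  obtain w where w: "w \<in> sorted_words" "lead (\<psi> x) (entries_exp w)" using \<psi>_lead G_closed x by blast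
  have "interlaced n i (entries_exp w)" if i: "1 \<le> i" "i < m" for i
    using lead_interlaced[OF i \<psi>_in_span[OF x(1) i] lead_nonzero[OF w(2)]] lead_unique[OF w(2)] by metis
  moreover have "1 \<le> k \<and> k \<le> m \<and> 1 \<le> j \<and> j \<le> n" if "lookup (entries_exp w) (k, j) \<noteq> 0" for k j
  proof -
    have "(k, j) \<in> set w" using that by (simp add: lookup_entries_exp count_mset_0_iff)
    then have "(k, j) \<in> L" using w(1) by auto
    then show ?thesis by (simp add: L_def)
  qed
  ultimately have "admissible m n (entries_exp w)"
    unfolding admissible_def lookup_entries_exp by simp
  then show ?thesis using w by blast
qed

text \<open>Leading exponents add on products of minors, so every sum of column exponents is
  attained.\<close>

lemma lead_surj:
  assumes "set_mset M \<subseteq> {I. I \<subseteq> {1..n} \<and> card I = m}"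
  shows "\<exists>x\<in>G. lead (\<psi> x) (\<Sum>I\<in>#M. diag_exp m I)"
  using assms
proof (induction M)
  case empty
  then show ?case using generate_ring.one[of "MQ" generators] lead_one
    by (auto simp: G_def \<psi>_simps intro!: bexI[of _ "\<one>\<^bsub>MQ\<^esub>"])
next
  case (add I M)
  then obtain x where x: "x \<in> G" "lead (\<psi> x) (\<Sum>I\<in>#M. diag_exp m I)" by auto
  have I: "I \<subseteq> {1..n}" "card I = m" using add.prems by auto
  have g: "qminor q m n I \<in> G" unfolding G_def generators_def using I by (intro generate_ring.incl) blast
  have "lead (\<psi> (qminor q m n I)) (diag_exp m I)" using I lead_max_minor by (simp add: \<psi>_qminor)
  then have "lead (\<psi> (qminor q m n I \<otimes>\<^bsub>MQ\<^esub> x)) (\<Sum>I\<in>#add_mset I M. diag_exp m I)"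
    using lead_mult x(2) g x(1) G_closed by (simp add: \<psi>_simps)
  moreover have "qminor q m n I \<otimes>\<^bsub>MQ\<^esub> x \<in> G"
    using g x(1) unfolding G_def by (rule generate_ring.eng_mult)
  ultimately show ?case by blast
qed

definition lead_exp :: "'k qmat_elt \<Rightarrow> exponent" where "lead_exp x = (THE s. lead (\<psi> x) s)"

lemma lead_exp_eq: "lead (\<psi> x) s \<Longrightarrow> lead_exp x = s"
  unfolding lead_exp_def by (rule the_equality) (auto intro: lead_unique)

lemma lead_lead_exp: "\<lbrakk>x \<in> G; x \<noteq> \<zero>\<^bsub>MQ\<^esub>\<rbrakk> \<Longrightarrow> lead (\<psi> x) (lead_exp x)"
  using lead_admissible lead_exp_eq by metis

lemma lead_exp_image:
  assumes "1 \<le> m"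
  shows "lead_exp ` (carrier (GQ) - {\<zero>\<^bsub>GQ\<^esub>}) = {a. admissible m n a}"
proof (intro equalityI subsetI)
  fix a assume "a \<in> lead_exp ` (carrier (GQ) - {\<zero>\<^bsub>GQ\<^esub>})"
  then show "a \<in> {a. admissible m n a}" using lead_admissible lead_exp_eq by (auto simp: qgrass_simps)
next
  fix a assume "a \<in> {a. admissible m n a}"
  then obtain M where M: "set_mset M \<subseteq> {I. I \<subseteq> {1..n} \<and> card I = m}" "a = (\<Sum>I\<in>#M. diag_exp m I)"
    using admissible_generated assms by blast
  then obtain x where x: "x \<in> G" "lead (\<psi> x) a" using lead_surj by blast
  then have "x \<noteq> \<zero>\<^bsub>MQ\<^esub>" using lead_nonzero \<psi>_simps(2) by blast
  then show "a \<in> lead_exp ` (carrier (GQ) - {\<zero>\<^bsub>GQ\<^esub>})"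
    using x lead_exp_eq by (auto simp: qgrass_simps intro!: image_eqI[of _ _ x])
qed

lemma \<psi>_minus_qgrass:
  assumes "x \<in> G" "y \<in> G" shows "\<psi> (x \<ominus>\<^bsub>GQ\<^esub> y) = \<psi> x - \<psi> y"
proof -
  have c: "x \<ominus>\<^bsub>GQ\<^esub> y \<in> G" using R.minus_closed[of x y] assms by (simp add: qgrass_simps)
  have "(x \<ominus>\<^bsub>GQ\<^esub> y) \<oplus>\<^bsub>GQ\<^esub> y = x"
  proof -
    have "x \<in> carrier (GQ)" "y \<in> carrier (GQ)" using assms by (simp_all add: qgrass_simps(1))
    then show ?thesis by (simp add: a_minus_def R.a_assoc R.l_neg)
  qed
  then have "\<psi> (x \<ominus>\<^bsub>GQ\<^esub> y) + \<psi> y = \<psi> x"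
    using c assms G_closed by (simp add: qgrass_simps \<psi>_simps(3)[symmetric])
  then show ?thesis by (simp add: eq_diff_eq)
qed

text \<open>Classes of scalars are the central coefficients of \<open>v_cancel\<close>. A nonzero
  difference lies in \<open>G\<close> and so has a leading exponent, which
  \<open>lead_cancel\<close> bounds. The last three axioms concern only the value set, that is, the
  admissible exponents.\<close>

lemma leading_exponent_qgrass:
  assumes "1 \<le> m"
  shows "leading_exponent (GQ) lead_exp"
proof
  show "\<one>\<^bsub>GQ\<^esub> \<noteq> \<zero>\<^bsub>GQ\<^esub>"
    unfolding qgrass_simps using \<psi>_simps(1,2) by (metis zero_neq_one)
next
  fix a b assume "a \<in> carrier (GQ) - {\<zero>\<^bsub>GQ\<^esub>}" "b \<in> carrier (GQ) - {\<zero>\<^bsub>GQ\<^esub>}"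
  then have ab: "a \<in> G" "b \<in> G" "lead (\<psi> a) (lead_exp a)" "lead (\<psi> b) (lead_exp b)"
    using lead_lead_exp by (auto simp: qgrass_simps)
  have l: "lead (\<psi> (a \<otimes>\<^bsub>GQ\<^esub> b)) (lead_exp a + lead_exp b)"
    using lead_mult[OF ab(3,4)] ab(1,2) G_closed by (simp add: qgrass_simps \<psi>_simps)
  then show "a \<otimes>\<^bsub>GQ\<^esub> b \<noteq> \<zero>\<^bsub>GQ\<^esub> \<and> lead_exp (a \<otimes>\<^bsub>GQ\<^esub> b) = lead_exp a + lead_exp b"
    using lead_exp_eq[OF l] lead_nonzero[OF l] \<psi>_simps(2) by (metis qgrass_simps(3))
  assume eq: "lead_exp a = lead_exp b"
  obtain c where c: "\<And>t. lead (\<psi> a - escale c (\<psi> b)) t \<Longrightarrow> t < lead_exp a"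
    using lead_cancel ab(3,4) eq by metis
  define z where "z = cls (scal c)"
  have z: "z \<in> G" unfolding z_def G_def generators_def by (intro generate_ring.incl) blast
  have central: "z \<otimes>\<^bsub>GQ\<^esub> x = x \<otimes>\<^bsub>GQ\<^esub> z" if x: "x \<in> G" for x
    unfolding qgrass_simps
  proof (rule \<psi>_inj)
    show "\<psi> (z \<otimes>\<^bsub>MQ\<^esub> x) = \<psi> (x \<otimes>\<^bsub>MQ\<^esub> z)"
      using z x G_closed by (simp add: \<psi>_simps z_def \<psi>_scal E.scale_simps)
  qed (use z x G_closed in auto)
  have zb: "z \<otimes>\<^bsub>GQ\<^esub> b \<in> G" using R.m_closed[of z b] z ab(2) by (simp add: qgrass_simps(1))
  have d: "a \<ominus>\<^bsub>GQ\<^esub> z \<otimes>\<^bsub>GQ\<^esub> b \<in> G"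
    using R.minus_closed[of a "z \<otimes>\<^bsub>GQ\<^esub> b"] zb ab(1) by (simp add: qgrass_simps(1))
  have "\<psi> (a \<ominus>\<^bsub>GQ\<^esub> z \<otimes>\<^bsub>GQ\<^esub> b) = \<psi> a - \<psi> (z \<otimes>\<^bsub>GQ\<^esub> b)"
    by (rule \<psi>_minus_qgrass[OF ab(1) zb])
  also have "\<psi> (z \<otimes>\<^bsub>GQ\<^esub> b) = escale c (\<psi> b)"
    using z ab(2) G_closed by (simp add: qgrass_simps \<psi>_simps z_def \<psi>_scal E.scale_simps)
  finally have "a \<ominus>\<^bsub>GQ\<^esub> z \<otimes>\<^bsub>GQ\<^esub> b = \<zero>\<^bsub>GQ\<^esub> \<or>
      lead_exp (a \<ominus>\<^bsub>GQ\<^esub> z \<otimes>\<^bsub>GQ\<^esub> b) < lead_exp a"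
    using c lead_lead_exp[OF d] by (metis qgrass_simps(3))
  then show "\<exists>c\<in>carrier (GQ). (\<forall>x\<in>carrier (GQ). c \<otimes>\<^bsub>GQ\<^esub> x = x \<otimes>\<^bsub>GQ\<^esub> c) \<and>
      (a \<ominus>\<^bsub>GQ\<^esub> c \<otimes>\<^bsub>GQ\<^esub> b = \<zero>\<^bsub>GQ\<^esub> \<or>
       lead_exp (a \<ominus>\<^bsub>GQ\<^esub> c \<otimes>\<^bsub>GQ\<^esub> b) < lead_exp a)"
    using z central by (auto simp: qgrass_simps(1))
next
  fix a assume "a \<in> carrier (GQ) - {\<zero>\<^bsub>GQ\<^esub>}"
  then have "lead_exp a \<in> {a. admissible m n a}" using lead_exp_image[OF assms] by blast
  then show "0 \<le> lead_exp a" by (auto intro: admissible_nonneg)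
next
  fix f :: "nat \<Rightarrow> exponent"
  assume f: "\<And>k. f k \<in> lead_exp ` (carrier (GQ) - {\<zero>\<^bsub>GQ\<^esub>})"
  show "\<exists>i j. i < j \<and> f j - f i \<in> lead_exp ` (carrier (GQ) - {\<zero>\<^bsub>GQ\<^esub>})"
    using f admissible_wqo[OF _ assms, of n f] unfolding lead_exp_image[OF assms] by simp
next
  fix f :: "nat \<Rightarrow> exponent" and g
  assume f: "\<And>k. f k \<in> lead_exp ` (carrier (GQ) - {\<zero>\<^bsub>GQ\<^esub>})" "\<And>k. f (Suc k) = f k + g"
  show "g \<in> lead_exp ` (carrier (GQ) - {\<zero>\<^bsub>GQ\<^esub>})"
    using f admissible_integrally_closed[of m n f g] unfolding lead_exp_image[OF assms] by simp
qed

end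

theorem theorem6p2:
  fixes q :: "'k::field" and m n :: nat
  assumes "q \<noteq> 0" and "1 \<le> m" and "m \<le> n"
  shows "(\<exists>(Q :: ('k qmat_elt \<times> 'k qmat_elt) set ring) \<iota>.
            division_ring_of_fractions (qgrass q m n) Q \<iota>) \<and>
         (\<forall>(Q :: 'd ring) \<iota>. division_ring_of_fractions (qgrass q m n) Q \<iota> \<longrightarrow>
            maximal_order (qgrass q m n) Q \<iota>)"
proof -
  interpret qmatrices q m n
    by unfold_locales (rule assms(1))
  interpret leading_exponent "qgrass q m n" lead_exp
    by (rule leading_exponent_qgrass[OF assms(2)])
  show ?thesis using ex_division_ring_of_fractions maximal_order by blast
qed

end
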